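(* Let $\mathbb{K}=\mathbb{R}$ or $\mathbb{C}$. Suppose that $h:(\mathbb{K}^p,0)\to(\mathbb{K}^q,0)$ is a smooth map-germ and that $V$ is a subgerm of $(\mathbb{K}^p,0)$ such that $\Theta_V$ is a finitely generated $\mathcal{E}_p$-module. If $g_1,\dots,g_s$ are homogeneous polynomial maps (from $\mathbb{K}^p$ to $\mathbb{K}^q$) of degree $k+1$ such that $$\mathfrak{m}^{k+1}\theta(h)\subseteq T_V\mathcal{K}_1(h)+\operatorname{span}\{g_1,\dots,g_s\}+\mathfrak{m}^{k+2}\theta(h),$$ then every smooth map-germ $g:(\mathbb{K}^p,0)\to(\mathbb{K}^q,0)$ with $j^k(h)=j^k(g)$ is ${}_V\mathcal{K}_1$-equivalent to some $f$ where $j^{k+1}(f)$ is of the form $$j^k(h)+\sum_{i=1}^s\alpha_i g_i,\qquad \alpha_i\in\mathbb{K}.$$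
   Context: Smooth means infinitely differentiable for $\mathbb{K}=\mathbb{R}$ (the real analytic theory is similar) and complex analytic for $\mathbb{K}=\mathbb{C}$. $\mathcal{E}_p$ is the ring of germs of smooth functions on $(\mathbb{K}^p,0)$ (for $\mathbb{K}=\mathbb{C}$, analytic germs, $\mathcal{O}_p$), and $\mathfrak{m}=\mathfrak{m}_p$ is its maximal ideal. For $h:(\mathbb{K}^p,0)\to(\mathbb{K}^q,0)$, $\theta(h)\cong\mathcal{E}_p^q$ is the module of vector fields along $h$, and $h^*(\mathfrak{m}_q)$ is the ideal of $\mathcal{E}_p$ generated by the components of $h$. $j^k(h)$ is the $k$-jet (Taylor polynomial of degree $k$ at $0$). For a vector field $\xi$, $\xi(h)=dh(\xi)\in\theta(h)$. Span means $\mathbb{K}$-linear span. $\Theta_V$ is the $\mathcal{E}_p$-module of vector fields that integrate to give a diffeomorphism of $(\mathbb{K}^p,0)$ preserving $V$. $\Theta_{V,1}$ is the set of vector fields that integrate to diffeomorphisms with $1$-jet the identity and preserve $V$. The ${}_V\mathcal{K}_1$-tangent space is $$T_V\mathcal{K}_1(h)=\{\xi(h)\mid\xi\in\Theta_{V,1}\}+\mathfrak{m}_p\,h^*(\mathfrak{m}_q)\theta(h).$$ Smooth germs $f,\widetilde f:(\mathbb{K}^p,0)\to(\mathbb{K}^q,0)$ are $\mathcal{K}$-equivalent if there is a diffeomorphism germ $\Psi$ of $(\mathbb{K}^p\times\mathbb{K}^q,0\times 0)$ with $\Psi(\mathbb{K}^p\times\{0\})=\mathbb{K}^p\times\{0\}$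 and $\Psi(\mathrm{graph}(f))=\mathrm{graph}(\widetilde f)$; $\Psi$ determines a diffeomorphism germ $\psi$ of $(\mathbb{K}^p,0)$ by $\Psi(x,0)=(\psi(x),0)$. They are ${}_V\mathcal{K}$-equivalent if such $\Psi$ exists with $\psi(V)=V$. ${}_V\mathcal{K}_1$ is the subgroup of ${}_V\mathcal{K}$ consisting of those equivalences for which the diffeomorphism $\psi$ preserving $V$ has $1$-jet equal to the identity; ${}_V\mathcal{K}_1$-equivalence is equivalence by an element of this subgroup. *)

theory Defs
  imports "HOL-Complex_Analysis.Complex_Analysis"
begin

text \<open>
  All notions are defined over an arbitrary normed field; they are used for the real and the
  complex numbers.  The space of n-tuples is the type \<open>'k ^ 'n\<close>.  A germ at 0 is given by a total
  function of which only the values near 0 matter; \<open>germ_eq\<close> is equality of germs, and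
  the ideals and modules of germs below are closed under it.
\<close>

definition germ_eq :: "('a::{zero,topological_space} \<Rightarrow> 'b) \<Rightarrow> ('a \<Rightarrow> 'b) \<Rightarrow> bool" where
  "germ_eq f g \<longleftrightarrow> (\<forall>\<^sub>F x in nhds 0. f x = g x)"


section \<open>Smooth germs\<close>

definition partial :: "'n::finite \<Rightarrow> ('k::real_normed_field ^ 'n \<Rightarrow> 'k) \<Rightarrow> 'k ^ 'n \<Rightarrow> 'k" where
  "partial i f x = deriv (\<lambda>t. f (x + t *s axis i 1)) 0"

primrec partials :: "'n::finite list \<Rightarrow> ('k::real_normed_field ^ 'n \<Rightarrow> 'k) \<Rightarrow> 'k ^ 'n \<Rightarrow> 'k" where
  "partials [] f = f"
| "partials (i # is) f = partial i (partials is f)"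

text \<open>
  \<open>smooth_on S f\<close>, for open \<open>S\<close>: the partial derivatives of all orders, taken with respect to the
  field \<open>'k\<close>, exist and are continuous on \<open>S\<close>.  Over the reals this is infinite differentiability;
  over the complex numbers the derivatives are complex derivatives, so that this is complex
  analyticity, see \<open>smooth_on_complex_iff\<close> below.
\<close>

definition smooth_on :: "('k::real_normed_field ^ 'n::finite) set \<Rightarrow> ('k ^ 'n \<Rightarrow> 'k) \<Rightarrow> bool" where
  "smooth_on S f \<longleftrightarrow>
     (\<forall>is. continuous_on S (partials is f) \<and>
           (\<forall>x\<in>S. \<forall>i. (\<lambda>t. partials is f (x + t *s axis i 1)) field_differentiable (at 0)))"

lemma cauchy_remainder:
  assumes holg: "g holomorphic_on ball 0 (2 * r)" and r: "r > 0"
    and bd: "\<And>u. u \<in> ball 0 (2 * r) \<Longrightarrow> norm (g u) \<le> B" and t: "norm t < r"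
  shows "norm (g t - g 0 - deriv g 0 * t) \<le> 2 * B / r\<^sup>2 * 4 * (norm t)\<^sup>2"
proof -
  have bound: "norm (deriv (deriv g) u) \<le> 2 * B / (r / 2)\<^sup>2" if u: "u \<in> ball 0 r" for u
  proof -
    have sub: "cball u (r / 2) \<subseteq> ball 0 (2 * r)"
    proof
      fix y assume "y \<in> cball u (r / 2)"
      then have "norm y \<le> norm u + r / 2"
        by (smt (verit) dist_norm mem_cball norm_triangle_sub norm_minus_commute)
      then show "y \<in> ball 0 (2 * r)" using u r by simp
    qed
    have "norm ((deriv ^^ 2) g u) \<le> fact 2 * B / (r / 2) ^ 2"
    proof (rule Cauchy_inequality)
      show "g holomorphic_on ball u (r / 2)"
        using holg sub by (meson ball_subset_cball holomorphic_on_subset)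
      show "continuous_on (cball u (r / 2)) g"
        using holg sub by (meson continuous_on_subset holomorphic_on_imp_continuous_on)
      show "norm (g x) \<le> B" if "norm (u - x) = r / 2" for x
        using sub that by (intro bd) (auto simp: dist_norm subset_iff)
    qed (use r in auto)
    then show ?thesis by (simp add: numeral_2_eq_2)
  qed
  have "norm ((deriv ^^ 0) g t - (\<Sum>i\<le>1. (deriv ^^ i) g 0 * (t - 0) ^ i / fact i))
          \<le> 2 * B / (r / 2)\<^sup>2 * norm (t - 0) ^ Suc 1 / fact 1"
  proof (rule complex_Taylor[where S = "ball 0 r"])
    show "((deriv ^^ i) g has_field_derivative (deriv ^^ Suc i) g x) (at x within ball 0 r)"
      if "x \<in> ball 0 r" for i x
    proof -
      have "(deriv ^^ i) g holomorphic_on ball 0 (2 * r)"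
        using holg by (simp add: holomorphic_higher_deriv)
      moreover have "x \<in> ball 0 (2 * r)" using that r by simp
      ultimately have "((deriv ^^ i) g has_field_derivative deriv ((deriv ^^ i) g) x) (at x)"
        by (meson holomorphic_derivI open_ball)
      then show ?thesis by (simp add: has_field_derivative_at_within)
    qed
    show "norm ((deriv ^^ Suc 1) g x) \<le> 2 * B / (r / 2)\<^sup>2" if "x \<in> ball 0 r" for x
      using bound[OF that] by simp
  qed (use t r in auto)
  then show ?thesis by (simp add: field_simps power2_eq_square)
qed

definition separately_holomorphic :: "(complex ^ 'n::finite) set \<Rightarrow> (complex ^ 'n \<Rightarrow> complex) \<Rightarrow> bool" where
  "separately_holomorphic S f \<longleftrightarrow> continuous_on S f \<and>
     (\<forall>x\<in>S. \<forall>i. (\<lambda>t. f (x + t *s axis i 1)) field_differentiable (at 0))"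

lemma norm_axis_complex: "norm (t *s axis i (1::complex)) = norm t"
proof -
  have "t *s axis i (1::complex) = axis i t" by (simp add: vec_eq_iff axis_def)
  then show ?thesis by (metis inner_axis_axis norm_eq_sqrt_inner)
qed

lemma separately_holomorphic_line:
  assumes f: "separately_holomorphic S f" and x: "\<And>t. t \<in> T \<Longrightarrow> x + t *s axis i 1 \<in> S" and "open T"
  shows "(\<lambda>t. f (x + t *s axis i 1)) holomorphic_on T"
  unfolding holomorphic_on_def
proof
  fix t assume "t \<in> T"
  then have "(\<lambda>u. f ((x + t *s axis i 1) + u *s axis i 1)) field_differentiable (at 0)"
    using f x unfolding separately_holomorphic_def by blast
  then obtain D where "((\<lambda>u. f ((x + t *s axis i 1) + u *s axis i 1)) has_field_derivative D) (at 0)"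
    unfolding field_differentiable_def by blast
  then have "((\<lambda>u. f (x + (u + t) *s axis i 1)) has_field_derivative D) (at 0)"
    by (simp add: vector_sadd_rdistrib algebra_simps)
  then have "((\<lambda>u. f (x + u *s axis i 1)) has_field_derivative D) (at t)"
    using DERIV_shift[of "\<lambda>u. f (x + u *s axis i 1)" D 0 t] by simp
  then show "(\<lambda>t. f (x + t *s axis i 1)) field_differentiable (at t within T)"
    using field_differentiable_at_within field_differentiable_def by blast
qed

lemma separately_holomorphic_partial_local:
  assumes f: "separately_holomorphic S f" and S: "open S" and x: "x \<in> S"
  obtains r where "r > 0" "ball x r \<subseteq> S" "separately_holomorphic (ball x r) (partial i f)"
proof -
  obtain e where e: "e > 0" "cball x e \<subseteq> S" using S x open_contains_cball by blast
  define r where "r = e / 3"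
  have r: "r > 0" and sub: "cball x (3 * r) \<subseteq> S" using e by (auto simp: r_def)
  have ballS: "ball x r \<subseteq> S" using sub r by (auto simp: subset_iff)
  have cont: "continuous_on S f" using f by (simp add: separately_holomorphic_def)
  have "compact (f ` cball x (3 * r))"
    using cont sub by (intro compact_continuous_image) (auto intro: continuous_on_subset)
  then obtain B where B: "\<And>y. y \<in> cball x (3 * r) \<Longrightarrow> norm (f y) \<le> B"
    by (meson bounded_iff compact_imp_bounded imageI)
  have shift: "z + u *s axis j 1 \<in> cball x (3 * r)" if "z \<in> ball x r" "norm u < 2 * r" for z u j
  proof -
    have "dist x (z + u *s axis j 1) \<le> dist x z + dist z (z + u *s axis j 1)"
      by (rule dist_triangle)
    also have "dist z (z + u *s axis j 1) = norm u"
      by (simp add: dist_norm norm_axis_complex)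
    finally show ?thesis using that r by simp
  qed
  define \<tau> where "\<tau> n = complex_of_real (r / real (n + 2))" for n
  have \<tau>: "\<tau> n \<noteq> 0" "norm (\<tau> n) < r" for n
  proof -
    have "norm (\<tau> n) = r / real (n + 2)" using r by (simp only: \<tau>_def norm_of_real) simp
    moreover have "0 < r / real (n + 2)" "r / real (n + 2) < r"
      using r by (simp_all add: field_simps add_pos_nonneg)
    ultimately show "\<tau> n \<noteq> 0" "norm (\<tau> n) < r" by auto
  qed
  define F where "F n z = (f (z + \<tau> n *s axis i 1) - f z) / \<tau> n" for n z
  define C where "C = 2 * B / r\<^sup>2 * 4"
  have est: "norm (F n z - partial i f z) \<le> C * norm (\<tau> n)" if z: "z \<in> ball x r" for n z
  proof -
    define g where "g u = f (z + u *s axis i 1)" for u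
    have "g holomorphic_on ball 0 (2 * r)"
      unfolding g_def using f by (rule separately_holomorphic_line) (use shift[OF z] sub in auto)
    moreover have "norm (g u) \<le> B" if "u \<in> ball 0 (2 * r)" for u
      unfolding g_def using that by (intro B shift z) auto
    ultimately have "norm (g (\<tau> n) - g 0 - deriv g 0 * \<tau> n) \<le> C * (norm (\<tau> n))\<^sup>2"
      unfolding C_def using r \<tau>(2) by (intro cauchy_remainder) auto
    moreover have "F n z - partial i f z = (g (\<tau> n) - g 0 - deriv g 0 * \<tau> n) / \<tau> n"
      using \<tau>(1) by (simp add: F_def partial_def g_def[abs_def] field_simps)
    ultimately show ?thesis
      using \<tau>(1) by (simp add: norm_divide divide_le_eq power2_eq_square mult.assoc)
  qed
  have "(\<lambda>n. C * norm (\<tau> n)) \<longlonglongrightarrow> 0"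
  proof -
    have "(\<lambda>n. r / real (n + 2)) \<longlonglongrightarrow> 0"
      using LIMSEQ_ignore_initial_segment[OF lim_const_over_n[of r], of 2] by simp
    then have "(\<lambda>n. complex_of_real (r / real (n + 2))) \<longlonglongrightarrow> of_real 0"
      by (rule tendsto_of_real)
    then have "\<tau> \<longlonglongrightarrow> 0" by (simp only: \<tau>_def[abs_def] of_real_0)
    then show ?thesis using tendsto_mult_right_zero tendsto_norm_zero by blast
  qed
  then have unif: "uniform_limit (ball x r) F (partial i f) sequentially"
    by (intro uniform_limitI) 
      (smt (verit) est dist_norm eventually_mono order_tendstoD(2))
  have holF: "separately_holomorphic (ball x r) (F n)" for n
    unfolding separately_holomorphic_def
  proof (intro conjI ballI allI)
    have "continuous_on (ball x r) (\<lambda>z. f (z + \<tau> n *s axis i 1))"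
    proof (rule continuous_on_compose2[OF cont])
      show "continuous_on (ball x r) (\<lambda>z. z + \<tau> n *s axis i 1)"
        by (intro continuous_intros)
      show "(\<lambda>z. z + \<tau> n *s axis i 1) ` ball x r \<subseteq> S"
        using shift[where u = "\<tau> n"] \<tau>(2)[of n] r sub by fastforce
    qed
    moreover have "continuous_on (ball x r) f"
      using cont ballS by (rule continuous_on_subset)
    ultimately show "continuous_on (ball x r) (F n)"
      unfolding F_def using \<tau>(1) by (intro continuous_intros) auto
    fix z j assume z: "z \<in> ball x r"
    have "z \<in> S" "z + \<tau> n *s axis i 1 \<in> S"
      using z ballS shift[OF z, of "\<tau> n" i] \<tau>(2)[of n] r sub by auto
    then have "(\<lambda>t. f (z + t *s axis j 1)) field_differentiable (at 0)"
      "(\<lambda>t. f ((z + \<tau> n *s axis i 1) + t *s axis j 1)) field_differentiable (at 0)"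
      using f unfolding separately_holomorphic_def by blast+
    then show "(\<lambda>t. F n (z + t *s axis j 1)) field_differentiable (at 0)"
      unfolding F_def using \<tau>(1)
      by (intro field_differentiable_divide field_differentiable_diff field_differentiable_const)
        (auto simp: algebra_simps)
  qed
  have "separately_holomorphic (ball x r) (partial i f)"
    unfolding separately_holomorphic_def
  proof (intro conjI ballI allI)
    show "continuous_on (ball x r) (partial i f)"
      using holF unif unfolding separately_holomorphic_def
      by (intro uniform_limit_theorem[of _ F sequentially]) (auto simp: always_eventually)
    fix z j assume z: "z \<in> ball x r"
    obtain d where d: "d > 0" "ball z d \<subseteq> ball x r"
      using z open_contains_ball by (metis open_ball)
    have mem: "z + t *s axis j 1 \<in> ball x r" if "t \<in> ball 0 d" for t
      using that d(2) by (auto simp: dist_norm norm_axis_complex subset_iff)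
    have "(\<lambda>t. partial i f (z + t *s axis j 1)) holomorphic_on ball 0 d"
    proof (rule holomorphic_uniform_sequence)
      show "(\<lambda>t. F n (z + t *s axis j 1)) holomorphic_on ball 0 d" for n
        using holF mem by (rule separately_holomorphic_line) auto
      fix t :: complex assume "t \<in> ball 0 d"
      then obtain \<epsilon> where \<epsilon>: "\<epsilon> > 0" "cball t \<epsilon> \<subseteq> ball 0 d"
        using open_contains_cball by (metis open_ball)
      have "uniform_limit (cball t \<epsilon>) (\<lambda>n t. F n (z + t *s axis j 1))
              (\<lambda>t. partial i f (z + t *s axis j 1)) sequentially"
        using unif by (rule uniform_limit_compose') (use \<epsilon> mem in blast)
      then show "\<exists>\<epsilon>>0. cball t \<epsilon> \<subseteq> ball 0 d \<and> uniform_limit (cball t \<epsilon>)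
          (\<lambda>n t. F n (z + t *s axis j 1)) (\<lambda>t. partial i f (z + t *s axis j 1)) sequentially"
        using \<epsilon> by blast
    qed auto
    then show "(\<lambda>t. partial i f (z + t *s axis j 1)) field_differentiable (at 0)"
      using d(1) by (meson centre_in_ball holomorphic_on_imp_differentiable_at open_ball)
  qed
  then show ?thesis using r ballS that by blast
qed

lemma separately_holomorphic_partial:
  assumes "separately_holomorphic S f" and S: "open S"
  shows "separately_holomorphic S (partial i f)"
  unfolding separately_holomorphic_def
proof (intro conjI ballI allI)
  show "continuous_on S (partial i f)"
  proof (rule continuous_at_imp_continuous_on, rule ballI)
    fix x assume "x \<in> S"
    with assms obtain r where "r > 0" "separately_holomorphic (ball x r) (partial i f)"
      using separately_holomorphic_partial_local by blast
    then show "isCont (partial i f) x"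
      by (meson centre_in_ball continuous_on_interior interior_open open_ball separately_holomorphic_def
          continuous_on_eq_continuous_at)
  qed
  show "(\<lambda>t. partial i f (x + t *s axis j 1)) field_differentiable (at 0)" if "x \<in> S" for x j
    using separately_holomorphic_partial_local[OF assms that] unfolding separately_holomorphic_def by (metis centre_in_ball)
qed

text \<open>
  Over the complex numbers, \<open>smooth_on\<close> is holomorphy in several variables (Osgood's form: continuous,
  and holomorphic in each variable separately).
\<close>

lemma smooth_on_complex_iff:
  fixes f :: "complex ^ 'n::finite \<Rightarrow> complex"
  assumes "open S"
  shows "smooth_on S f \<longleftrightarrow> continuous_on S f \<and>
     (\<forall>x\<in>S. \<forall>i. (\<lambda>t. f (x + t *s axis i 1)) field_differentiable (at 0))"
proof
  assume "smooth_on S f"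
  then show "continuous_on S f \<and>
     (\<forall>x\<in>S. \<forall>i. (\<lambda>t. f (x + t *s axis i 1)) field_differentiable (at 0))"
    unfolding smooth_on_def by (metis partials.simps(1))
next
  assume "continuous_on S f \<and>
     (\<forall>x\<in>S. \<forall>i. (\<lambda>t. f (x + t *s axis i 1)) field_differentiable (at 0))"
  then have "separately_holomorphic S f" by (simp add: separately_holomorphic_def)
  then have "separately_holomorphic S (partials is f)" for "is"
    by (induction "is") (simp_all add: separately_holomorphic_partial assms)
  then show "smooth_on S f" by (simp add: smooth_on_def separately_holomorphic_def)
qed

definition smooth_germs :: "('k::real_normed_field ^ 'n::finite \<Rightarrow> 'k) set" where
  "smooth_germs = {f. \<exists>S. open S \<and> 0 \<in> S \<and> smooth_on S f}"

definition max_ideal :: "('k::real_normed_field ^ 'n::finite \<Rightarrow> 'k) set" where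
  "max_ideal = {f \<in> smooth_germs. f 0 = 0}"

text \<open>
  The module of vector fields along a map germ \<open>h\<close>, in the form of the free module of \<open>'q\<close>-tuples
  of smooth germs; in this form it does not depend on \<open>h\<close>.  It is also the set of smooth map germs
  with an arbitrary value at 0.
\<close>

definition theta :: "('k::real_normed_field ^ 'p::finite \<Rightarrow> 'k ^ 'q::finite) set" where
  "theta = {v. \<forall>j. (\<lambda>x. v x $ j) \<in> smooth_germs}"

definition map_germs :: "('k::real_normed_field ^ 'p::finite \<Rightarrow> 'k ^ 'q::finite) set" where
  "map_germs = {f \<in> theta. f 0 = 0}"


section \<open>Ideals, modules, jets\<close>

text \<open>
  The set of all finite sums of products \<open>a v\<close> with \<open>a \<in> A\<close> and \<open>v \<in> M\<close>.  With \<open>act = (*)\<close> this is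
  the product of ideals, or the ideal generated by \<open>M\<close> if \<open>A = smooth_germs\<close>; with \<open>act = (*s)\<close>
  it is the corresponding construction for submodules of \<open>theta\<close>.
\<close>

definition germ_span ::
  "('k \<Rightarrow> 'v \<Rightarrow> 'v) \<Rightarrow> ('a::{zero,topological_space} \<Rightarrow> 'k) set
     \<Rightarrow> ('a \<Rightarrow> 'v::comm_monoid_add) set \<Rightarrow> ('a \<Rightarrow> 'v) set" where
  "germ_span act A M =
     {w. \<exists>(n::nat) a v. (\<forall>i<n. a i \<in> A \<and> v i \<in> M) \<and>
           germ_eq w (\<lambda>x. \<Sum>i<n. act (a i x) (v i x))}"

definition germ_plus ::
  "('a::{zero,topological_space} \<Rightarrow> 'v::plus) set \<Rightarrow> ('a \<Rightarrow> 'v) set \<Rightarrow> ('a \<Rightarrow> 'v) set" where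
  "germ_plus A B = {w. \<exists>a\<in>A. \<exists>b\<in>B. germ_eq w (\<lambda>x. a x + b x)}"

primrec max_ideal_power :: "nat \<Rightarrow> ('k::real_normed_field ^ 'n::finite \<Rightarrow> 'k) set" where
  "max_ideal_power 0 = smooth_germs"
| "max_ideal_power (Suc k) = germ_span (*) max_ideal (max_ideal_power k)"

definition pullback_ideal ::
  "('k::real_normed_field ^ 'p::finite \<Rightarrow> 'k ^ 'q::finite) \<Rightarrow> ('k ^ 'p \<Rightarrow> 'k) set" where
  "pullback_ideal h = germ_span (*) smooth_germs (range (\<lambda>j x. h x $ j))"

text \<open>Being finitely generated includes being a submodule of \<open>theta\<close>.\<close>

definition finitely_generated ::
  "('k::real_normed_field ^ 'p::finite \<Rightarrow> 'k ^ 'q::finite) set \<Rightarrow> bool" where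
  "finitely_generated M \<longleftrightarrow>
     (\<exists>F. finite F \<and> F \<subseteq> theta \<and> M = germ_span (*s) smooth_germs F)"

text \<open>\<open>lin_span s G\<close> is the linear span, over the field, of \<open>G 1, \<dots>, G s\<close>.\<close>

definition lin_span :: "nat \<Rightarrow> (nat \<Rightarrow> 'a \<Rightarrow> 'k::semiring_1 ^ 'q::finite) \<Rightarrow> ('a \<Rightarrow> 'k ^ 'q) set" where
  "lin_span s G = range (\<lambda>\<alpha>. \<lambda>x. \<Sum>i=1..s. \<alpha> i *s G i x)"

definition homogeneous_map ::
  "nat \<Rightarrow> ('k::comm_semiring_1 ^ 'p::finite \<Rightarrow> 'k ^ 'q::finite) \<Rightarrow> bool" where
  "homogeneous_map d P \<longleftrightarrow>
     (\<forall>j. \<exists>c :: ('p \<Rightarrow> nat) \<Rightarrow> 'k. \<forall>x.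
        P x $ j = (\<Sum>a | sum a UNIV = d. c a * (\<Prod>i\<in>UNIV. x $ i ^ a i)))"

text \<open>
  The Taylor polynomial of degree \<open>k\<close> at 0.  The sum over the lists of length \<open>m\<close> is the value at
  \<open>(x, \<dots>, x)\<close> of the \<open>m\<close>-th derivative, written out in coordinates.
\<close>

definition jet ::
  "nat \<Rightarrow> ('k::real_normed_field ^ 'p::finite \<Rightarrow> 'k ^ 'q::finite) \<Rightarrow> 'k ^ 'p \<Rightarrow> 'k ^ 'q" where
  "jet k f x =
     (\<chi> j. \<Sum>m\<le>k. (\<Sum>is | length is = m.
        partials is (\<lambda>y. f y $ j) 0 * prod_list (map (\<lambda>i. x $ i) is)) / fact m)"


section \<open>Diffeomorphism germs and contact equivalence\<close>

definition diffeo_germ :: "('k::real_normed_field ^ 'n::finite \<Rightarrow> 'k ^ 'n) \<Rightarrow> bool" where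
  "diffeo_germ \<psi> \<longleftrightarrow> \<psi> \<in> map_germs \<and>
     (\<exists>\<phi>\<in>map_germs. germ_eq (\<phi> \<circ> \<psi>) id \<and> germ_eq (\<psi> \<circ> \<phi>) id)"

text \<open>
  Equality of the germs at 0 of \<open>\<psi>(A)\<close> and \<open>B\<close>, for a diffeomorphism germ \<open>\<psi>\<close> fixing 0.
\<close>

definition maps_germ ::
  "('k::real_normed_field ^ 'n::finite \<Rightarrow> 'k ^ 'n) \<Rightarrow> ('k ^ 'n) set \<Rightarrow> ('k ^ 'n) set \<Rightarrow> bool" where
  "maps_germ \<psi> A B \<longleftrightarrow> (\<forall>\<^sub>F x in nhds 0. x \<in> A \<longleftrightarrow> \<psi> x \<in> B)"

text \<open>
  The product of the spaces \<open>'k ^ 'p\<close> and \<open>'k ^ 'q\<close> is the space \<open>'k ^ ('p + 'q)\<close>, with elements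
  \<open>join x y\<close>.
\<close>

definition join :: "'k ^ 'p::finite \<Rightarrow> 'k ^ 'q::finite \<Rightarrow> 'k ^ ('p + 'q)" where
  "join x y = (\<chi> s. case s of Inl i \<Rightarrow> x $ i | Inr j \<Rightarrow> y $ j)"

definition zero_section :: "('k::zero ^ ('p::finite + 'q::finite)) set" where
  "zero_section = range (\<lambda>x. join x 0)"

definition graph_of :: "('k ^ 'p::finite \<Rightarrow> 'k ^ 'q::finite) \<Rightarrow> ('k ^ ('p + 'q)) set" where
  "graph_of f = range (\<lambda>x. join x (f x))"

definition contact_equiv_by ::
  "('k::real_normed_field ^ ('p::finite + 'q::finite) \<Rightarrow> 'k ^ ('p + 'q))
     \<Rightarrow> ('k ^ 'p \<Rightarrow> 'k ^ 'q) \<Rightarrow> ('k ^ 'p \<Rightarrow> 'k ^ 'q) \<Rightarrow> bool" where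
  "contact_equiv_by \<Psi> f f' \<longleftrightarrow>
     diffeo_germ \<Psi> \<and> maps_germ \<Psi> zero_section zero_section \<and> maps_germ \<Psi> (graph_of f) (graph_of f')"

text \<open>The germ \<open>\<psi>\<close> determined by \<open>\<Psi>(x, 0) = (\<psi>(x), 0)\<close>.\<close>

definition base_map ::
  "('k::zero ^ ('p::finite + 'q::finite) \<Rightarrow> 'k ^ ('p + 'q)) \<Rightarrow> 'k ^ 'p \<Rightarrow> 'k ^ 'p" where
  "base_map \<Psi> x = (\<chi> i. \<Psi> (join x 0) $ Inl i)"

definition VK1_equiv ::
  "('k::real_normed_field ^ 'p::finite) set
     \<Rightarrow> ('k ^ 'p \<Rightarrow> 'k ^ 'q::finite) \<Rightarrow> ('k ^ 'p \<Rightarrow> 'k ^ 'q) \<Rightarrow> bool" where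
  "VK1_equiv V f f' \<longleftrightarrow>
     (\<exists>\<Psi>. contact_equiv_by \<Psi> f f' \<and> maps_germ (base_map \<Psi>) V V \<and> jet 1 (base_map \<Psi>) = id)"


section \<open>Vector fields preserving a subgerm, and the tangent space\<close>

text \<open>
  \<open>\<Phi>\<close> is a flow of the vector field \<open>\<xi>\<close> near the fixed point 0, with time in the field \<open>'k\<close>: it is
  smooth on an open neighbourhood \<open>U\<close> of all points (time \<open>t\<close>, position 0).  A pair of a time and a
  position is encoded as a vector \<open>z\<close> indexed by \<open>'p option\<close>, with time coordinate \<open>z $ None\<close>.
\<close>

definition time_space :: "'k \<Rightarrow> 'k ^ 'p::finite \<Rightarrow> 'k ^ ('p option)" where
  "time_space t x = (\<chi> s. case s of None \<Rightarrow> t | Some i \<Rightarrow> x $ i)"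

definition flow_of ::
  "('k::real_normed_field ^ 'p::finite \<Rightarrow> 'k ^ 'p) \<Rightarrow> ('k \<Rightarrow> 'k ^ 'p \<Rightarrow> 'k ^ 'p) \<Rightarrow> bool" where
  "flow_of \<xi> \<Phi> \<longleftrightarrow>
     (\<exists>U. open U \<and> (\<forall>t. time_space t 0 \<in> U) \<and>
        (\<forall>j. smooth_on U (\<lambda>z. \<Phi> (z $ None) (\<chi> i. z $ Some i) $ j)) \<and>
        (\<forall>x. time_space 0 x \<in> U \<longrightarrow> \<Phi> 0 x = x) \<and>
        (\<forall>t x. time_space t x \<in> U \<longrightarrow>
           (\<forall>j. ((\<lambda>s. \<Phi> s x $ j) has_field_derivative \<xi> (\<Phi> t x) $ j) (at t))))"

definition Theta :: "('k::real_normed_field ^ 'p::finite) set \<Rightarrow> ('k ^ 'p \<Rightarrow> 'k ^ 'p) set" where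
  "Theta V = {\<xi> \<in> theta. \<exists>\<Phi>. flow_of \<xi> \<Phi> \<and> (\<forall>t. diffeo_germ (\<Phi> t) \<and> maps_germ (\<Phi> t) V V)}"

definition Theta1 :: "('k::real_normed_field ^ 'p::finite) set \<Rightarrow> ('k ^ 'p \<Rightarrow> 'k ^ 'p) set" where
  "Theta1 V = {\<xi> \<in> theta. \<exists>\<Phi>. flow_of \<xi> \<Phi> \<and>
     (\<forall>t. diffeo_germ (\<Phi> t) \<and> maps_germ (\<Phi> t) V V \<and> jet 1 (\<Phi> t) = id)}"

text \<open>\<open>lie_deriv \<xi> h\<close> is \<open>\<xi>(h) = dh(\<xi>)\<close>.\<close>

definition lie_deriv ::
  "('k::real_normed_field ^ 'p::finite \<Rightarrow> 'k ^ 'p) \<Rightarrow> ('k ^ 'p \<Rightarrow> 'k ^ 'q::finite)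
     \<Rightarrow> 'k ^ 'p \<Rightarrow> 'k ^ 'q" where
  "lie_deriv \<xi> h x = (\<chi> j. \<Sum>i\<in>UNIV. partial i (\<lambda>y. h y $ j) x * \<xi> x $ i)"

definition tangent_VK1 ::
  "('k::real_normed_field ^ 'p::finite) set \<Rightarrow> ('k ^ 'p \<Rightarrow> 'k ^ 'q::finite)
     \<Rightarrow> ('k ^ 'p \<Rightarrow> 'k ^ 'q) set" where
  "tangent_VK1 V h =
     germ_plus {lie_deriv \<xi> h | \<xi>. \<xi> \<in> Theta1 V}
       (germ_span (*s) (germ_span (*) max_ideal (pullback_ideal h)) theta)"

end

theory Submission
  imports Defs
begin

text \<open>
  The hypothesis is infinitesimal, and the equivalence is obtained from it by exponentiation, up to
  terms of order \<open>k + 2\<close>.  An element of the tangent space has the form \<open>L(h) = \<xi>(h) + M h\<close> with \<open>\<xi>\<close> in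
  \<open>Theta1 V\<close> and \<open>M\<close> a matrix with entries in the maximal ideal (\<open>tangent_VK1_twisted\<close>).  Since the flow of
  \<open>\<xi>\<close> has the identity as its 1-jet, \<open>\<xi>\<close> vanishes to order 2 (\<open>flow_field_vanishes\<close>), so that \<open>L\<close> raises the
  order of vanishing by one and is nilpotent on jets.

  Let \<open>H\<close> be the part of degree \<open>k + 1\<close> of \<open>g\<close>.  The hypothesis, applied to \<open>-H\<close>, gives
  \<open>-H \<equiv> L(h) + b\<close> with \<open>b\<close> in the span of the \<open>G i\<close>; here and below \<open>\<equiv>\<close> means up to order \<open>k + 2\<close>.  As
  \<open>g - h\<close> vanishes to order \<open>k + 1\<close>, we have \<open>L(g) \<equiv> L(h)\<close>, which is of order \<open>k + 1\<close>, and \<open>L\<^sup>n(g) \<equiv> 0\<close> for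
  \<open>n \<ge> 2\<close>.  Hence \<open>exp(L) g \<equiv> g + L(g) \<equiv> g - H - b\<close>, whose \<open>(k + 1)\<close>-jet is \<open>j\<^sup>k(g) - b\<close>, as desired.

  It remains to see that \<open>exp(L)\<close> acts on \<open>g\<close> by an equivalence.  By Leibniz' formula it acts, up to higher
  order, as \<open>exp(\<xi>)\<close> followed by multiplication with the matrix \<open>A\<close> with columns \<open>exp(L) e\<^sub>l\<close>
  (\<open>exp_twisted_derivation\<close>), and \<open>exp(\<xi>) g \<equiv> g \<circ> \<Phi>\<^sub>1\<close> for the flow \<open>\<Phi>\<close> of \<open>\<xi>\<close> (\<open>flow_taylor\<close>).  So
  \<open>exp(L) g \<equiv> f\<close> for the germ \<open>f(x) = A(x) g(\<Phi>\<^sub>1(x))\<close>, in which \<open>A\<close> is a finite sum of smooth germs: no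
  differential equation with parameters has to be solved.  The germ \<open>f\<close> is equivalent to \<open>g\<close> because
  \<open>\<Phi>\<^sub>1\<close> preserves \<open>V\<close> and has the identity as its 1-jet (\<open>VK1_equiv_linear_fibre\<close>).

  The argument is carried out over an arbitrary normed field extending the reals, with orders of vanishing
  measured by derivatives at 0.  The real and the complex statement are instances of it.
\<close>

(* The infix $ denotes components of vectors throughout. *)
no_notation fps_nth (infixl \<open>$\<close> 75)

section \<open>Partial derivatives over a normed field\<close>

text \<open>
  The relational form of \<open>partial\<close>: the function \<open>partial\<close> is total and has an arbitrary value
  where the derivative does not exist.
\<close>

definition has_partial :: "'n::finite \<Rightarrow> ('k::real_normed_field ^ 'n \<Rightarrow> 'k) \<Rightarrow> 'k \<Rightarrow> 'k ^ 'n \<Rightarrow> bool" where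
  "has_partial i f D x \<longleftrightarrow> ((\<lambda>t. f (x + t *s axis i 1)) has_field_derivative D) (at 0)"

lemma has_partial_imp_eq: "has_partial i f D x \<Longrightarrow> partial i f x = D"
  by (simp add: has_partial_def partial_def DERIV_imp_deriv)

lemma has_partial_ex_iff:
  "(\<lambda>t. f (x + t *s axis i 1)) field_differentiable (at 0) \<longleftrightarrow> has_partial i f (partial i f x) x"
  by (metis DERIV_deriv_iff_field_differentiable has_partial_def partial_def)

lemma axis_scaled: "t *s axis i (1::'k::real_normed_field) = axis i t"
  by (simp add: vec_eq_iff axis_def)

lemma norm_axis_scaled: "norm (axis i (t::'k::real_normed_field)) = norm t"
proof -
  have "(\<lambda>j. norm (axis i t $ j)) = (\<lambda>j. if j = i then norm t else 0)"
    by (auto simp: axis_def)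
  then have "L2_set (\<lambda>j. norm (axis i t $ j)) UNIV = norm t"
    by (simp add: L2_set_def if_distrib[where f = "\<lambda>u. u\<^sup>2"] cong: if_cong)
  then show ?thesis by (simp add: norm_vec_def)
qed

lemma bounded_linear_axis: "bounded_linear (\<lambda>t::'k::real_normed_field. axis i t :: 'k ^ 'n::finite)"
  by (rule bounded_linear_intro[where K = 1])
    (simp_all add: norm_axis_scaled, simp_all add: vec_eq_iff axis_def)

lemma isCont_line: "isCont (\<lambda>t::'k::real_normed_field. x + t *s axis i 1 :: 'k ^ 'n::finite) t"
  unfolding axis_scaled
  by (intro continuous_add continuous_const bounded_linear.isCont[OF bounded_linear_axis, OF continuous_ident])

lemma eventually_line:
  fixes x :: "'k::real_normed_field ^ 'n::finite"
  assumes "open S" "x \<in> S"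
  shows "\<forall>\<^sub>F t in nhds 0. x + t *s axis i 1 \<in> S"
proof -
  have "((\<lambda>t. x + t *s axis i 1) \<longlongrightarrow> x + 0 *s axis i 1) (nhds 0)"
    using isCont_line[where x = x and i = i and t = 0] 
    by (simp only: isCont_def tendsto_at_iff_tendsto_nhds[where g = "\<lambda>t. x + t *s axis i 1"])
  then show ?thesis using assms by (auto dest: topological_tendstoD)
qed

lemma has_partial_cong:
  assumes "open S" "x \<in> S" "\<And>y. y \<in> S \<Longrightarrow> f y = g y"
  shows "has_partial i f D x \<longleftrightarrow> has_partial i g D x"
  unfolding has_partial_def
  by (rule DERIV_cong_ev[OF refl _ refl])
    (rule eventually_mono[OF eventually_line[OF assms(1,2)]], rule assms(3))

lemma partial_cong:
  assumes "open S" "x \<in> S" "\<And>y. y \<in> S \<Longrightarrow> f y = g y"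
  shows "partial i f x = partial i g x"
  unfolding partial_def
  by (rule deriv_cong_ev[OF _ refl])
    (rule eventually_mono[OF eventually_line[OF assms(1,2)]], rule assms(3))

lemma partials_cong:
  assumes "open S" "x \<in> S" "\<And>y. y \<in> S \<Longrightarrow> f y = g y"
  shows "partials is f x = partials is g x"
  using assms(2)
proof (induction "is" arbitrary: x)
  case (Cons i "is")
  then show ?case by (simp, intro partial_cong[OF assms(1)]) auto
qed (use assms(3) in auto)

lemma partials_snoc: "partials (is @ [i]) f = partials is (partial i f)"
  by (induction "is") auto

lemma has_partial_const: "has_partial i (\<lambda>x. c) 0 x"
  by (simp add: has_partial_def)

lemma has_partial_coord: "has_partial i (\<lambda>x. x $ j) (if i = j then 1 else 0) x"
  unfolding has_partial_def axis_scaled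
  by (cases "i = j") (auto simp: axis_def intro!: derivative_eq_intros)

lemma has_partial_add:
  "has_partial i f D x \<Longrightarrow> has_partial i g E x \<Longrightarrow> has_partial i (\<lambda>x. f x + g x) (D + E) x"
  unfolding has_partial_def by (rule DERIV_add)

lemma has_partial_mult:
  "has_partial i f D x \<Longrightarrow> has_partial i g E x \<Longrightarrow>
    has_partial i (\<lambda>x. f x * g x) (D * g x + f x * E) x"
  unfolding has_partial_def by (drule (1) DERIV_mult') (simp add: add.commute)

lemma has_partial_inverse:
  "has_partial i f D x \<Longrightarrow> f x \<noteq> 0 \<Longrightarrow>
    has_partial i (\<lambda>x. inverse (f x)) (- D * (inverse (f x) * inverse (f x))) x"
  unfolding has_partial_def
  by (drule DERIV_inverse') (auto simp: algebra_simps)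

lemma has_partial_line:
  assumes "has_partial i f D (x + s *s axis i 1)"
  shows "((\<lambda>t. f (x + t *s axis i 1)) has_field_derivative D) (at s)"
proof -
  have "((\<lambda>u. f (x + (u + s) *s axis i 1)) has_field_derivative D) (at 0)"
    using assms by (simp add: has_partial_def vector_sadd_rdistrib algebra_simps)
  then show ?thesis
    using DERIV_shift[of "\<lambda>u. f (x + u *s axis i 1)" D 0 s] by simp
qed

text \<open>
  Over the complex numbers there is no mean value theorem, but the mean value inequality on the
  convex ball of radius \<open>norm t\<close> serves both fields.  Subtracting the linear term \<open>D * s\<close> turns it
  into an estimate of the linear approximation.
\<close>

lemma mean_value_line:
  fixes f :: "'k::real_normed_field ^ 'n::finite \<Rightarrow> 'k"
  assumes "\<And>s. norm s \<le> norm t \<Longrightarrow> has_partial i f (f' s) (x + s *s axis i 1)"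
    and "\<And>s. norm s \<le> norm t \<Longrightarrow> norm (f' s - D) \<le> B"
  shows "norm (f (x + t *s axis i 1) - f x - D * t) \<le> B * norm t"
proof -
  define g where "g s = f (x + s *s axis i 1) - D * s" for s
  have "norm (g t - g 0) \<le> B * norm (t - 0)"
  proof (rule field_differentiable_bound[of "cball 0 (norm t)"])
    fix s :: 'k assume s: "s \<in> cball 0 (norm t)"
    then have "((\<lambda>s. f (x + s *s axis i 1)) has_field_derivative f' s) (at s)"
      by (intro has_partial_line assms(1)) simp
    then have "(g has_field_derivative f' s - D) (at s)"
      unfolding g_def by (auto intro!: derivative_eq_intros)
    then show "(g has_field_derivative f' s - D) (at s within cball 0 (norm t))"
      by (rule has_field_derivative_at_within)
    show "norm (f' s - D) \<le> B" using s by (intro assms(2)) simp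
  qed auto
  then show ?thesis by (simp add: g_def algebra_simps)
qed

text \<open>
  Pass from \<open>y\<close> to \<open>z\<close> by changing one coordinate after the other: each step is controlled by
  \<open>mean_value_line\<close>, and continuity of the partial derivatives at \<open>y\<close> makes all the errors small.
\<close>

lemma partials_imp_has_derivative:
  fixes f :: "'k::real_normed_field ^ 'n::finite \<Rightarrow> 'k"
  assumes S: "open S" and y: "y \<in> S"
    and f': "\<And>i x. x \<in> S \<Longrightarrow> has_partial i f (f' i x) x"
    and cont: "\<And>i. isCont (f' i) y"
  shows "(f has_derivative (\<lambda>v. \<Sum>i\<in>UNIV. f' i y * v $ i)) (at y)"
  unfolding has_derivative_at_alt
proof (intro conjI allI impI)
  show "bounded_linear (\<lambda>v. \<Sum>i\<in>UNIV. f' i y * v $ i)"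
    by (intro bounded_linear_sum bounded_linear_mult_const bounded_linear_const_mult bounded_linear_vec_nth)
  fix e :: real assume e: "e > 0"
  define c where "c = real CARD('n)"
  have c: "c > 0" by (simp add: c_def)
  obtain r where r: "r > 0" "ball y r \<subseteq> S" using S y open_contains_ball by blast
  have "\<exists>d>0. \<forall>x. dist x y < d \<longrightarrow> dist (f' i x) (f' i y) < e / c" for i
    using cont[of i] e c unfolding continuous_at_eps_delta by (simp add: dist_commute)
  then obtain d where d: "\<And>i. d i > 0" "\<And>i x. dist x y < d i \<Longrightarrow> dist (f' i x) (f' i y) < e / c"
    by metis
  define \<delta> where "\<delta> = Min (insert r (range d))"
  have \<delta>: "\<delta> > 0" "\<delta> \<le> r" "\<And>i. \<delta> \<le> d i" 
  proof -
    show "\<delta> > 0" "\<delta> \<le> r" using r d by (auto simp: \<delta>_def)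
    show "\<delta> \<le> d i" for i unfolding \<delta>_def by (rule Min_le) auto
  qed
  show "\<exists>d>0. \<forall>z. norm (z - y) < d \<longrightarrow>
      norm (f z - f y - (\<Sum>i\<in>UNIV. f' i y * (z - y) $ i)) \<le> e * norm (z - y)"
  proof (intro exI[of _ \<delta>] conjI allI impI \<delta>(1))
    fix z assume z: "norm (z - y) < \<delta>"
    \<comment> \<open>The displacement in the coordinates from \<open>J\<close> only.\<close>
    define w where "w J = (\<chi> i. if i \<in> J then (z - y) $ i else 0)" for J
    have "norm (f (y + w J) - f y - (\<Sum>i\<in>J. f' i y * (z - y) $ i)) \<le> real (card J) * (e / c * norm (z - y))" if "finite J" for J
      using that
    proof (induction J)
      case empty
      have "w {} = 0" by (simp add: w_def vec_eq_iff)
      then show ?case by simp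
    next
      case (insert i J)
      let ?t = "(z - y) $ i"
      have wi: "w (insert i J) = w J + ?t *s axis i 1"
        using insert by (auto simp: w_def vec_eq_iff axis_def)
      have small: "dist (y + w J + s *s axis i 1) y \<le> norm (z - y)" if "norm s \<le> norm ?t" for s :: 'k
      proof -
        have "norm (w J + s *s axis i 1) \<le> norm (z - y)"
          using that insert by (intro norm_le_componentwise_cart) (auto simp: w_def axis_def)
        then show ?thesis by (simp add: dist_norm)
      qed
      have "norm (f ((y + w J) + ?t *s axis i 1) - f (y + w J) - f' i y * ?t) \<le> e / c * norm ?t"
      proof (rule mean_value_line)
        fix s :: 'k assume s: "norm s \<le> norm ?t"
        have "dist (y + w J + s *s axis i 1) y < \<delta>" using small[OF s] z by simp
        then have "y + w J + s *s axis i 1 \<in> S" "dist (y + w J + s *s axis i 1) y < d i"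
          using r \<delta>(2) \<delta>(3)[of i] by (auto simp: subset_iff dist_commute)
        then show "has_partial i f (f' i (y + w J + s *s axis i 1)) (y + w J + s *s axis i 1)"
          "norm (f' i (y + w J + s *s axis i 1) - f' i y) \<le> e / c"
          using f' d(2) by (auto simp: dist_norm less_imp_le)
      qed
      also have "e / c * norm ?t \<le> e / c * norm (z - y)"
        using e c by (intro mult_left_mono) (auto simp: Finite_Cartesian_Product.norm_nth_le simp del: vector_minus_component)
      finally have step: "norm (f ((y + w J) + ?t *s axis i 1) - f (y + w J) - f' i y * ?t) \<le> e / c * norm (z - y)" .
      have "f (y + w (insert i J)) - f y - (\<Sum>i\<in>insert i J. f' i y * (z - y) $ i)
         = (f ((y + w J) + ?t *s axis i 1) - f (y + w J) - f' i y * ?t)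
            + (f (y + w J) - f y - (\<Sum>i\<in>J. f' i y * (z - y) $ i))"
        using insert by (simp add: wi add.assoc)
      also have "norm \<dots> \<le> e / c * norm (z - y) + real (card J) * (e / c * norm (z - y))"
        using step insert.IH by (intro norm_triangle_le add_mono)
      finally show ?case using insert(1,2) by (simp add: distrib_right add_divide_distrib)
    qed
    from this[of UNIV] have "norm (f (y + w UNIV) - f y - (\<Sum>i\<in>UNIV. f' i y * (z - y) $ i)) \<le> e * norm (z - y)"
      using c by (simp add: c_def)
    moreover have "y + w UNIV = z" by (simp add: w_def vec_eq_iff)
    ultimately show "norm (f z - f y - (\<Sum>i\<in>UNIV. f' i y * (z - y) $ i)) \<le> e * norm (z - y)" by simp
  qed
qed

text \<open>
  A partial derivative of a composite map is the derivative along the image of a coordinate line, so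
  the chain rule along curves contains the one for partial derivatives.
\<close>

lemma chain_rule_curve:
  fixes \<gamma> :: "'k::real_normed_field \<Rightarrow> 'k ^ 'n::finite" and f :: "'k::real_normed_field ^ 'n::finite \<Rightarrow> 'k"
  assumes S: "open S" and y: "\<gamma> s \<in> S"
    and f': "\<And>i x. x \<in> S \<Longrightarrow> has_partial i f (f' i x) x"
    and cont: "\<And>i. continuous_on S (f' i)"
    and \<gamma>: "\<And>i. ((\<lambda>t. \<gamma> t $ i) has_field_derivative d i) (at s)"
  shows "((\<lambda>t. f (\<gamma> t)) has_field_derivative (\<Sum>i\<in>UNIV. f' i (\<gamma> s) * d i)) (at s)"
proof -
  have "((\<lambda>t. \<Sum>i\<in>UNIV. axis i (\<gamma> t $ i)) has_derivative (\<lambda>t. \<Sum>i\<in>UNIV. axis i (d i * t))) (at s)"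
    using \<gamma> unfolding has_field_derivative_def
    by (intro has_derivative_sum bounded_linear.has_derivative[OF bounded_linear_axis]) auto
  moreover have "(\<lambda>t. \<Sum>i\<in>UNIV. axis i (\<gamma> t $ i)) = \<gamma>"
    by (auto simp: vec_eq_iff axis_def)
  ultimately have "(\<gamma> has_derivative (\<lambda>t. \<Sum>i\<in>UNIV. axis i (d i * t))) (at s)" by simp
  moreover have "(f has_derivative (\<lambda>v. \<Sum>i\<in>UNIV. f' i (\<gamma> s) * v $ i)) (at (\<gamma> s))"
    using S y f' cont by (intro partials_imp_has_derivative) (auto simp: continuous_on_eq_continuous_at)
  ultimately have "((\<lambda>t. f (\<gamma> t)) has_derivative
     (\<lambda>t. \<Sum>j\<in>UNIV. f' j (\<gamma> s) * (\<Sum>i\<in>UNIV. axis i (d i * t)) $ j)) (at s)"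
    by (rule has_derivative_compose)
  moreover have "(\<lambda>t. \<Sum>j\<in>UNIV. f' j (\<gamma> s) * (\<Sum>i\<in>UNIV. axis i (d i * t)) $ j)
     = (*) (\<Sum>i\<in>UNIV. f' i (\<gamma> s) * d i)"
    by (auto simp: axis_def sum_distrib_left sum_distrib_right mult_ac)
  ultimately show ?thesis by (simp add: has_field_derivative_def)
qed

text \<open>
  The second difference is the increment in direction \<open>j\<close> of the increment in direction \<open>i\<close>, so it
  is estimated by two applications of \<open>mean_value_line\<close>.
\<close>

lemma mixed_difference:
  fixes f :: "'k::real_normed_field ^ 'n::finite \<Rightarrow> 'k"
  assumes S: "open S" and x: "x \<in> S" and e: "e > 0"
    and f': "\<And>y. y \<in> S \<Longrightarrow> has_partial j f (f' y) y"
    and f'': "\<And>y. y \<in> S \<Longrightarrow> has_partial i f' (f'' y) y"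
    and cont: "isCont f'' x"
  obtains d where "d > 0" "\<And>s t. norm s < d \<Longrightarrow> norm t < d \<Longrightarrow>
     norm (f (x + s *s axis i 1 + t *s axis j 1) - f (x + s *s axis i 1) - f (x + t *s axis j 1) + f x
       - f'' x * s * t) \<le> e * norm s * norm t"
proof -
  obtain r where r: "r > 0" "ball x r \<subseteq> S" using S x open_contains_ball by blast
  obtain d0 where d0: "d0 > 0" "\<And>y. dist y x < d0 \<Longrightarrow> dist (f'' y) (f'' x) < e"
    using cont e unfolding continuous_at_eps_delta by (auto simp: dist_commute)
  define d where "d = min r d0 / 2"
  have d: "d > 0" using r d0 by (simp add: d_def)
  have near: "dist (x + s *s axis i 1 + t *s axis j 1) x < min r d0" if "norm s < d" "norm t < d" for s t
  proof -
    have "norm (s *s axis i 1 + t *s axis j 1) \<le> norm (axis i s :: 'k^'n) + norm (axis j t :: 'k^'n)"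
      unfolding axis_scaled by (rule norm_triangle_ineq)
    then show ?thesis using that by (simp add: dist_norm norm_axis_scaled d_def add.assoc)
  qed
  then have inS: "x + s *s axis i 1 + t *s axis j 1 \<in> S" if "norm s < d" "norm t < d" for s t
    using that r by (auto simp: subset_iff dist_commute)
  show ?thesis
  proof (rule that[OF d])
    fix s t :: 'k assume s: "norm s < d" and t: "norm t < d"
    define g where "g y = f (y + s *s axis i 1) - f y" for y
    have 1: "norm (g (x + t *s axis j 1) - g x - (f'' x * s) * t) \<le> (e * norm s) * norm t"
    proof (rule mean_value_line)
      fix u :: 'k assume "norm u \<le> norm t"
      then have u: "norm u < d" using t by simp
      let ?y = "x + u *s axis j 1"
      have ys: "?y + v *s axis i 1 \<in> S" if "norm v < d" for v
        using inS[OF that u] by (simp add: algebra_simps)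
      have y: "?y \<in> S" using ys[of 0] d by simp
      have "has_partial j (\<lambda>y. f (y + s *s axis i 1)) (f' (?y + s *s axis i 1)) ?y"
        using f'[OF ys[OF s]] by (simp add: has_partial_def algebra_simps)
      then show "has_partial j g (f' (?y + s *s axis i 1) - f' ?y) ?y"
        using f'[OF y] unfolding has_partial_def g_def by (rule DERIV_diff)
      show "norm (f' (?y + s *s axis i 1) - f' ?y - f'' x * s) \<le> e * norm s"
      proof (rule mean_value_line)
        fix v :: 'k assume "norm v \<le> norm s"
        then have v: "norm v < d" using s by simp
        show "has_partial i f' (f'' (?y + v *s axis i 1)) (?y + v *s axis i 1)"
          by (intro f'' ys v)
        have "dist (?y + v *s axis i 1) x < d0" using near[OF v u] by (simp add: algebra_simps)
        then show "norm (f'' (?y + v *s axis i 1) - f'' x) \<le> e"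
          using d0(2) by (simp add: dist_norm less_imp_le)
      qed
    qed
    then show "norm (f (x + s *s axis i 1 + t *s axis j 1) - f (x + s *s axis i 1) - f (x + t *s axis j 1) + f x
       - f'' x * s * t) \<le> e * norm s * norm t"
      by (simp add: g_def algebra_simps)
  qed
qed

text \<open>
  The second difference is symmetric in the two directions, hence is approximated up to
  \<open>o(|s| |t|)\<close> by both mixed derivatives times \<open>s t\<close>.
\<close>

lemma mixed_partials_commute:
  fixes f :: "'k::real_normed_field ^ 'n::finite \<Rightarrow> 'k"
  assumes S: "open S" and x: "x \<in> S"
    and fi: "\<And>y. y \<in> S \<Longrightarrow> has_partial i f (fi y) y"
    and fj: "\<And>y. y \<in> S \<Longrightarrow> has_partial j f (fj y) y"
    and fij: "\<And>y. y \<in> S \<Longrightarrow> has_partial j fi (fij y) y"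
    and fji: "\<And>y. y \<in> S \<Longrightarrow> has_partial i fj (fji y) y"
    and cont: "isCont fij x" "isCont fji x"
  shows "fij x = fji x"
proof (rule ccontr)
  assume neq: "fij x \<noteq> fji x"
  \<comment> \<open>Any \<open>e\<close> with \<open>2 e < norm (fij x - fji x)\<close> leads to a contradiction.\<close>
  define e where "e = norm (fij x - fji x) / 3"
  have e: "e > 0" using neq by (simp add: e_def)
  obtain d1 where d1: "d1 > 0" "\<And>s t. norm s < d1 \<Longrightarrow> norm t < d1 \<Longrightarrow>
     norm (f (x + s *s axis i 1 + t *s axis j 1) - f (x + s *s axis i 1) - f (x + t *s axis j 1) + f x
       - fji x * s * t) \<le> e * norm s * norm t"
    using mixed_difference[OF S x e fj fji cont(2)] by blast
  obtain d2 where d2: "d2 > 0" "\<And>s t. norm s < d2 \<Longrightarrow> norm t < d2 \<Longrightarrow>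
     norm (f (x + s *s axis j 1 + t *s axis i 1) - f (x + s *s axis j 1) - f (x + t *s axis i 1) + f x
       - fij x * s * t) \<le> e * norm s * norm t"
    using mixed_difference[OF S x e fi fij cont(1)] by blast
  define s where "s = (of_real (min d1 d2 / 2) :: 'k)"
  have ns: "norm s = min d1 d2 / 2" "norm s > 0" using d1(1) d2(1) by (simp_all add: s_def norm_divide norm_of_real)
  have "norm s < d1" "norm s < d2" using ns d1(1) d2(1) by auto
  define \<Delta> where "\<Delta> = f (x + s *s axis i 1 + s *s axis j 1) - f (x + s *s axis i 1) - f (x + s *s axis j 1) + f x"
  have "norm (\<Delta> - fji x * s * s) \<le> e * norm s * norm s"
    using d1(2)[of s s] \<open>norm s < d1\<close> by (simp add: \<Delta>_def)
  moreover have "norm (\<Delta> - fij x * s * s) \<le> e * norm s * norm s"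
    using d2(2)[of s s] \<open>norm s < d2\<close> by (simp add: \<Delta>_def algebra_simps)
  ultimately have "norm ((\<Delta> - fji x * s * s) - (\<Delta> - fij x * s * s)) \<le> 2 * (e * norm s * norm s)"
    using norm_triangle_ineq4 by (smt (verit))
  moreover have "(\<Delta> - fji x * s * s) - (\<Delta> - fij x * s * s) = (fij x - fji x) * s * s"
    by (simp add: algebra_simps)
  ultimately have "3 * e * (norm s * norm s) \<le> 2 * e * (norm s * norm s)"
    by (simp add: norm_mult e_def)
  then show False using e ns(2) by (simp add: mult_le_cancel_right)
qed

section \<open>Functions of class C to the n, and smooth functions\<close>

text \<open>
  The predicate \<open>smooth_on\<close> speaks of all iterated derivatives at once, which leaves no room for an
  induction: the derivative of a product is a sum of products.  Counting the order instead makes the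
  closure properties of smooth functions provable by induction on the order.
\<close>

primrec Ck :: "nat \<Rightarrow> ('k::real_normed_field ^ 'n::finite) set \<Rightarrow> ('k ^ 'n \<Rightarrow> 'k) \<Rightarrow> bool" where
  "Ck 0 S f = continuous_on S f"
| "Ck (Suc n) S f = (continuous_on S f \<and>
     (\<forall>i. (\<forall>x\<in>S. has_partial i f (partial i f x) x) \<and> Ck n S (partial i f)))"

lemma Ck_continuous: "Ck n S f \<Longrightarrow> continuous_on S f"
  by (cases n) auto

lemma Ck_SucD: "Ck (Suc n) S f \<Longrightarrow> Ck n S f"
  by (induction n arbitrary: f) (auto dest: Ck_continuous)

lemma Ck_cong:
  assumes "open S" "\<And>x. x \<in> S \<Longrightarrow> f x = g x"
  shows "Ck n S f \<longleftrightarrow> Ck n S g"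
  using assms(2)
proof (induction n arbitrary: f g)
  case 0
  then show ?case by (simp cong: continuous_on_cong)
next
  case (Suc n)
  have "continuous_on S f = continuous_on S g" using Suc.prems by (simp cong: continuous_on_cong)
  moreover have p: "partial i f x = partial i g x" if "x \<in> S" for i x
    using partial_cong[OF assms(1) that Suc.prems] .
  moreover have "has_partial i f D x = has_partial i g D x" if "x \<in> S" for i x D
    using has_partial_cong[OF assms(1) that Suc.prems] .
  moreover have "Ck n S (partial i f) = Ck n S (partial i g)" for i
    by (rule Suc.IH) (rule p)
  ultimately show ?case by simp
qed

text \<open>
  A formula for the first derivatives is only known on the open set \<open>S\<close>, whereas the definition refers
  to the total function \<open>partial i f\<close>.
\<close>

lemma Ck_SucI:
  assumes "open S" "continuous_on S f" "\<And>i x. x \<in> S \<Longrightarrow> has_partial i f (f' i x) x" "\<And>i. Ck n S (f' i)"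
  shows "Ck (Suc n) S f"
proof -
  have "partial i f x = f' i x" if "x \<in> S" for i x
    using assms(3)[OF that] by (rule has_partial_imp_eq)
  moreover from this have "Ck n S (partial i f)" for i
    using Ck_cong[OF assms(1), of "partial i f" "f' i" n] assms(4) by simp
  ultimately show ?thesis using assms by simp
qed

lemma Ck_subset: "T \<subseteq> S \<Longrightarrow> Ck n S f \<Longrightarrow> Ck n T f"
  by (induction n arbitrary: f) (auto intro: continuous_on_subset)

lemma Ck_const: "Ck n S (\<lambda>x. c)"
proof (induction n arbitrary: c)
  case (Suc n)
  have "partial i (\<lambda>x. c) = (\<lambda>x. 0)" for i :: 'b
    by (intro ext has_partial_imp_eq has_partial_const)
  then show ?case using Suc by (simp add: has_partial_const)
qed simp

lemma Ck_coord: "Ck n S (\<lambda>x. x $ j)"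
proof (cases n)
  case (Suc m)
  have "partial i (\<lambda>x::'a^'b. x $ j) = (\<lambda>x. if i = j then 1 else 0)" for i :: 'b
    by (intro ext has_partial_imp_eq has_partial_coord)
  then show ?thesis using Suc Ck_const[of m S "if _ then 1 else 0"]
    by (auto simp: has_partial_coord continuous_on_component)
qed (simp add: continuous_on_component)

lemma Ck_add:
  assumes "open S"
  shows "Ck n S f \<Longrightarrow> Ck n S g \<Longrightarrow> Ck n S (\<lambda>x. f x + g x)"
proof (induction n arbitrary: f g)
  case (Suc n)
  show ?case
    by (rule Ck_SucI[OF assms, where f' = "\<lambda>i x. partial i f x + partial i g x"])
      (use Suc in \<open>auto intro: has_partial_add continuous_on_add\<close>)
qed (auto intro: continuous_on_add)

lemma Ck_mult:
  assumes "open S"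
  shows "Ck n S f \<Longrightarrow> Ck n S g \<Longrightarrow> Ck n S (\<lambda>x. f x * g x)"
proof (induction n arbitrary: f g)
  case (Suc n)
  have "Ck n S (\<lambda>x. partial i f x * g x + f x * partial i g x)" for i
    using Suc.prems Ck_SucD[OF Suc.prems(1)] Ck_SucD[OF Suc.prems(2)]
    by (intro Ck_add[OF assms] Suc.IH) auto
  then show ?case
    by (intro Ck_SucI[OF assms, where f' = "\<lambda>i x. partial i f x * g x + f x * partial i g x"])
      (use Suc.prems in \<open>auto intro: has_partial_mult continuous_on_mult\<close>)
qed (auto intro: continuous_on_mult)

lemma Ck_sum:
  assumes "open S" "\<And>a. a \<in> A \<Longrightarrow> Ck n S (f a)"
  shows "Ck n S (\<lambda>x. \<Sum>a\<in>A. f a x)"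
  using assms(2) by (induction A rule: infinite_finite_induct) (auto intro: Ck_const Ck_add[OF assms(1)])

lemma Ck_inverse:
  assumes "open S" and nz: "\<And>x. x \<in> S \<Longrightarrow> f x \<noteq> 0"
  shows "Ck n S f \<Longrightarrow> Ck n S (\<lambda>x. inverse (f x))"
proof (induction n)
  case (Suc n)
  have inv: "Ck n S (\<lambda>x. inverse (f x))" using Suc Ck_SucD by blast
  have "Ck n S (\<lambda>x. - 1 * partial i f x * (inverse (f x) * inverse (f x)))" for i
    using Suc.prems inv by (intro Ck_mult[OF assms(1)] Ck_const) auto
  then have "Ck n S (\<lambda>x. - partial i f x * (inverse (f x) * inverse (f x)))" for i by simp
  moreover have "continuous_on S (\<lambda>x. inverse (f x))"
    using Suc.prems nz by (intro continuous_on_inverse) auto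
  moreover have "has_partial i (\<lambda>x. inverse (f x)) (- partial i f x * (inverse (f x) * inverse (f x))) x"
    if "x \<in> S" for i x
    using Suc.prems that by (intro has_partial_inverse nz) auto
  ultimately show ?case
    by (intro Ck_SucI[OF assms(1), where f' = "\<lambda>i x. - partial i f x * (inverse (f x) * inverse (f x))"])
qed (simp add: continuous_on_inverse nz)

lemma continuous_on_vec:
  fixes \<phi> :: "'a::topological_space \<Rightarrow> 'b::topological_space ^ 'n::finite"
  assumes "\<And>j. continuous_on S (\<lambda>x. \<phi> x $ j)"
  shows "continuous_on S \<phi>"
  using continuous_on_vec_lambda[of S "\<lambda>j x. \<phi> x $ j"] assms by simp

lemma has_partial_compose:
  fixes f :: "'k::real_normed_field ^ 'n::finite \<Rightarrow> 'k" and \<phi> :: "'k ^ 'm::finite \<Rightarrow> 'k ^ 'n"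
  assumes "open T" "Ck 1 T f" "\<phi> x \<in> T" "\<And>j. has_partial i (\<lambda>x. \<phi> x $ j) (d j) x"
  shows "has_partial i (\<lambda>x. f (\<phi> x)) (\<Sum>j\<in>UNIV. partial j f (\<phi> x) * d j) x"
  using chain_rule_curve[where S = T and f = f and \<gamma> = "\<lambda>t. \<phi> (x + t *s axis i 1)"
      and s = 0 and f' = "\<lambda>i. partial i f" and d = d] assms
  by (simp add: has_partial_def)

lemma Ck_compose:
  fixes \<phi> :: "'k ^ 'm::finite \<Rightarrow> 'k::real_normed_field ^ 'n::finite"
  assumes S: "open S" and T: "open T" and sub: "\<And>x. x \<in> S \<Longrightarrow> \<phi> x \<in> T"
  shows "Ck n T f \<Longrightarrow> (\<And>j. Ck n S (\<lambda>x. \<phi> x $ j)) \<Longrightarrow> Ck n S (\<lambda>x. f (\<phi> x))"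
proof (induction n arbitrary: f)
  case 0
  then have "continuous_on S \<phi>" by (intro continuous_on_vec) simp
  then show ?case using continuous_on_compose2[of T f S \<phi>] sub 0 by auto
next
  case (Suc n)
  have "continuous_on S \<phi>" using Suc.prems(2) by (intro continuous_on_vec) simp
  then have c: "continuous_on S (\<lambda>x. f (\<phi> x))"
    using continuous_on_compose2[of T f S \<phi>] sub Suc.prems(1) by auto
  have f1: "Ck 1 T f" using Suc.prems(1) by (auto dest: Ck_continuous)
  have \<phi>: "Ck n S (\<lambda>x. \<phi> x $ j)" for j using Suc.prems(2) by (rule Ck_SucD)
  have "Ck n S (\<lambda>x. partial j f (\<phi> x))" for j
    by (rule Suc.IH[OF _ \<phi>]) (use Suc.prems(1) in simp)
  moreover have "Ck n S (partial i (\<lambda>x. \<phi> x $ j))" for i j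
    using Suc.prems(2)[of j] by simp
  ultimately have "Ck n S (\<lambda>x. \<Sum>j\<in>UNIV. partial j f (\<phi> x) * partial i (\<lambda>x. \<phi> x $ j) x)" for i
    by (intro Ck_sum[OF S] Ck_mult[OF S])
  moreover have "has_partial i (\<lambda>x. f (\<phi> x)) (\<Sum>j\<in>UNIV. partial j f (\<phi> x) * partial i (\<lambda>x. \<phi> x $ j) x) x"
    if "x \<in> S" for i x
    using Suc.prems(2) that by (intro has_partial_compose[OF T f1, of \<phi>] sub) auto
  ultimately show ?case
    by (intro Ck_SucI[OF S c, where f' = "\<lambda>i x. \<Sum>j\<in>UNIV. partial j f (\<phi> x) * partial i (\<lambda>x. \<phi> x $ j) x"])
qed

lemma smooth_on_iff_Ck: "smooth_on S f \<longleftrightarrow> (\<forall>n. Ck n S f)"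
proof
  assume "smooth_on S f"
  then have "Ck n S (partials is f)" for n "is"
    by (induction n arbitrary: "is")
      (auto simp: smooth_on_def has_partial_ex_iff simp flip: partials.simps(2))
  from this[of _ "[]"] show "\<forall>n. Ck n S f" by simp
next
  assume "\<forall>n. Ck n S f"
  then have "\<forall>n. Ck n S (partials is f)" for "is"
  proof (induction "is")
    case (Cons i "is")
    then have "Ck (Suc n) S (partials is f)" for n by blast
    then show ?case by simp
  qed simp
  then have "Ck 1 S (partials is f)" for "is" by blast
  then show "smooth_on S f" by (auto simp: smooth_on_def has_partial_ex_iff)
qed

lemma smooth_on_Ck: "smooth_on S f \<Longrightarrow> Ck n S f"
  by (simp add: smooth_on_iff_Ck)

lemma smooth_on_continuous: "smooth_on S f \<Longrightarrow> continuous_on S f"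
  using smooth_on_Ck[of S f 0] by simp

lemma smooth_on_has_partial: "smooth_on S f \<Longrightarrow> x \<in> S \<Longrightarrow> has_partial i f (partial i f x) x"
  using smooth_on_Ck[of S f "Suc 0"] by simp

lemma smooth_on_partial: "smooth_on S f \<Longrightarrow> smooth_on S (partial i f)"
  using smooth_on_Ck[of S f "Suc n" for n] by (simp add: smooth_on_iff_Ck[of S "partial i f"])

lemma smooth_on_partials: "smooth_on S f \<Longrightarrow> smooth_on S (partials is f)"
  by (induction "is") (auto intro: smooth_on_partial)

lemma smooth_on_cong: "open S \<Longrightarrow> (\<And>x. x \<in> S \<Longrightarrow> f x = g x) \<Longrightarrow> smooth_on S f \<longleftrightarrow> smooth_on S g"
  unfolding smooth_on_iff_Ck using Ck_cong by blast

lemma smooth_on_subset: "smooth_on S f \<Longrightarrow> T \<subseteq> S \<Longrightarrow> smooth_on T f"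
  unfolding smooth_on_iff_Ck using Ck_subset by blast

lemma smooth_on_const: "smooth_on S (\<lambda>x. c)"
  unfolding smooth_on_iff_Ck using Ck_const by blast

lemma smooth_on_coord: "smooth_on S (\<lambda>x. x $ j)"
  unfolding smooth_on_iff_Ck using Ck_coord by blast

lemma smooth_on_add: "open S \<Longrightarrow> smooth_on S f \<Longrightarrow> smooth_on S g \<Longrightarrow> smooth_on S (\<lambda>x. f x + g x)"
  unfolding smooth_on_iff_Ck using Ck_add by blast

lemma smooth_on_mult: "open S \<Longrightarrow> smooth_on S f \<Longrightarrow> smooth_on S g \<Longrightarrow> smooth_on S (\<lambda>x. f x * g x)"
  unfolding smooth_on_iff_Ck using Ck_mult by blast

lemma smooth_on_diff: "open S \<Longrightarrow> smooth_on S f \<Longrightarrow> smooth_on S g \<Longrightarrow> smooth_on S (\<lambda>x. f x - g x)"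
  using smooth_on_add[of S f "\<lambda>x. - 1 * g x"] smooth_on_mult[OF _ smooth_on_const, of S g "- 1"] by simp

lemma smooth_on_inverse:
  "open S \<Longrightarrow> (\<And>x. x \<in> S \<Longrightarrow> f x \<noteq> 0) \<Longrightarrow> smooth_on S f \<Longrightarrow> smooth_on S (\<lambda>x. inverse (f x))"
  unfolding smooth_on_iff_Ck using Ck_inverse by blast

lemma smooth_on_sum:
  assumes "open S" "\<And>a. a \<in> A \<Longrightarrow> smooth_on S (f a)"
  shows "smooth_on S (\<lambda>x. \<Sum>a\<in>A. f a x)"
  using assms(2) unfolding smooth_on_iff_Ck by (intro allI Ck_sum[OF assms(1)]) blast

lemma smooth_on_compose:
  fixes \<phi> :: "'k ^ 'm::finite \<Rightarrow> 'k::real_normed_field ^ 'n::finite"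
  assumes "open S" "open T" "\<And>x. x \<in> S \<Longrightarrow> \<phi> x \<in> T"
    "smooth_on T f" "\<And>j. smooth_on S (\<lambda>x. \<phi> x $ j)"
  shows "smooth_on S (\<lambda>x. f (\<phi> x))"
  unfolding smooth_on_iff_Ck
proof
  show "Ck n S (\<lambda>x. f (\<phi> x))" for n
    by (rule Ck_compose[OF assms(1-3)[rule_format]]) (use assms(4,5) in \<open>simp_all add: smooth_on_Ck\<close>)
qed

lemma partial_add:
  assumes "smooth_on S f" "smooth_on S g" "x \<in> S"
  shows "partial i (\<lambda>x. f x + g x) x = partial i f x + partial i g x"
  by (intro has_partial_imp_eq has_partial_add smooth_on_has_partial[where S = S] assms)

lemma partial_mult:
  assumes "smooth_on S f" "smooth_on S g" "x \<in> S"
  shows "partial i (\<lambda>x. f x * g x) x = partial i f x * g x + f x * partial i g x"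
  by (intro has_partial_imp_eq has_partial_mult smooth_on_has_partial[where S = S] assms)

lemma partial_const: "partial i (\<lambda>x. c) x = 0"
  by (intro has_partial_imp_eq has_partial_const)

lemma partial_coord: "partial i (\<lambda>x. x $ j) x = (if i = j then 1 else 0)"
  by (intro has_partial_imp_eq has_partial_coord)

lemma partial_cmult: "smooth_on S f \<Longrightarrow> x \<in> S \<Longrightarrow> partial i (\<lambda>x. c * f x) x = c * partial i f x"
  using partial_mult[OF smooth_on_const[of S c], of f x i] by (simp add: partial_const)

lemma partial_diff:
  assumes "open S" "smooth_on S f" "smooth_on S g" "x \<in> S"
  shows "partial i (\<lambda>x. f x - g x) x = partial i f x - partial i g x"
  using partial_add[OF assms(2) smooth_on_mult[OF assms(1) smooth_on_const[of S "- 1"] assms(3)] assms(4), of i]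
    partial_cmult[OF assms(3,4), of i "- 1"] by simp

lemma partial_sum:
  assumes S: "open S" and "\<And>a. a \<in> A \<Longrightarrow> smooth_on S (f a)" and x: "x \<in> S"
  shows "partial i (\<lambda>x. \<Sum>a\<in>A. f a x) x = (\<Sum>a\<in>A. partial i (f a) x)"
  using assms(2)
proof (induction A rule: infinite_finite_induct)
  case (insert a A)
  then have "partial i (\<lambda>x. f a x + (\<Sum>a\<in>A. f a x)) x = partial i (f a) x + partial i (\<lambda>x. \<Sum>a\<in>A. f a x) x"
    by (intro partial_add[where S = S] smooth_on_sum S x) auto
  then show ?case using insert by simp
qed (auto simp: partial_const)

lemma partial_compose:
  fixes \<phi> :: "'k ^ 'm::finite \<Rightarrow> 'k::real_normed_field ^ 'n::finite"
  assumes "open T" "smooth_on T f" "\<phi> x \<in> T" "\<And>j. smooth_on S (\<lambda>x. \<phi> x $ j)" "x \<in> S"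
  shows "partial i (\<lambda>x. f (\<phi> x)) x = (\<Sum>j\<in>UNIV. partial j f (\<phi> x) * partial i (\<lambda>x. \<phi> x $ j) x)"
proof -
  have "Ck 1 T f" using assms(2) smooth_on_iff_Ck by blast
  then show ?thesis
    by (intro has_partial_imp_eq has_partial_compose[OF assms(1)] smooth_on_has_partial[OF assms(4,5)] assms(3))
qed

lemma partial_commute:
  assumes "open S" "x \<in> S" "smooth_on S f"
  shows "partial i (partial j f) x = partial j (partial i f) x"
proof (rule mixed_partials_commute[OF assms(1,2)])
  have "isCont (partial a (partial b f)) x" for a b
    using smooth_on_continuous[OF smooth_on_partial[OF smooth_on_partial[OF assms(3)]]] assms(1,2)
    by (simp add: continuous_on_eq_continuous_at)
  then show "isCont (partial i (partial j f)) x" "isCont (partial j (partial i f)) x" by auto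
  fix y assume "y \<in> S"
  then show "has_partial j f (partial j f y) y" "has_partial i f (partial i f y) y"
    "has_partial i (partial j f) (partial i (partial j f) y) y"
    "has_partial j (partial i f) (partial j (partial i f) y) y"
    by (intro smooth_on_has_partial[where S = S] smooth_on_partial assms; assumption)+
qed

lemma partial_partials_commute:
  assumes "open S" "smooth_on S f" "x \<in> S"
  shows "partial i (partials is f) x = partials is (partial i f) x"
  using assms(3)
proof (induction "is" arbitrary: x)
  case (Cons j "is")
  have "partial i (partial j (partials is f)) x = partial j (partial i (partials is f)) x"
    using assms Cons.prems by (intro partial_commute[where S = S] smooth_on_partials)
  also have "\<dots> = partial j (partials is (partial i f)) x"
    using assms(1) Cons.prems Cons.IH by (rule partial_cong)
  finally show ?case by simp
qed simp

section \<open>Smooth germs and their order of vanishing\<close>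

lemma germ_eqI: "open S \<Longrightarrow> 0 \<in> S \<Longrightarrow> (\<And>x. x \<in> S \<Longrightarrow> f x = g x) \<Longrightarrow> germ_eq f g"
  unfolding germ_eq_def eventually_nhds by blast

lemma germ_eqE:
  assumes "germ_eq f g"
  obtains S where "open S" "0 \<in> S" "\<And>x. x \<in> S \<Longrightarrow> f x = g x"
  using assms unfolding germ_eq_def eventually_nhds by blast

lemma germ_eq_refl: "germ_eq f f"
  by (simp add: germ_eq_def)

lemma germ_eq_sym: "germ_eq f g \<Longrightarrow> germ_eq g f"
  by (simp add: germ_eq_def eq_commute)

lemma germ_eq_trans: "germ_eq f g \<Longrightarrow> germ_eq g h \<Longrightarrow> germ_eq f h"
  by (auto simp: germ_eq_def elim: eventually_elim2)

lemma germ_eq_add: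
  "germ_eq f f' \<Longrightarrow> germ_eq g g' \<Longrightarrow> germ_eq (\<lambda>x. f x + g x) (\<lambda>x. f' x + g' x)"
  by (auto simp: germ_eq_def elim: eventually_elim2)

lemma smooth_germsI: "open S \<Longrightarrow> 0 \<in> S \<Longrightarrow> smooth_on S f \<Longrightarrow> f \<in> smooth_germs"
  unfolding smooth_germs_def by blast

lemma smooth_germsE:
  assumes "f \<in> smooth_germs"
  obtains S where "open S" "0 \<in> S" "smooth_on S f"
  using assms unfolding smooth_germs_def by blast

text \<open>
  On a common neighbourhood the formulas of calculus for finitely many germs hold pointwise, which
  replaces most reasoning with germs by reasoning with functions on an open set.
\<close>

lemma smooth_germs_common:
  assumes "finite I" "\<And>i. i \<in> I \<Longrightarrow> f i \<in> smooth_germs"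
  obtains S where "open S" "0 \<in> S" "\<And>i. i \<in> I \<Longrightarrow> smooth_on S (f i)"
proof -
  have "\<forall>i\<in>I. \<exists>S. open S \<and> 0 \<in> S \<and> smooth_on S (f i)"
    using assms(2) by (auto simp: smooth_germs_def)
  then obtain S where S: "\<And>i. i \<in> I \<Longrightarrow> open (S i) \<and> 0 \<in> S i \<and> smooth_on (S i) (f i)"
    by metis
  show ?thesis
    by (rule that[of "\<Inter>i\<in>I. S i"]) (use S assms(1) in \<open>auto intro: smooth_on_subset\<close>)
qed

lemma smooth_germs_common2:
  assumes "f \<in> smooth_germs" "g \<in> smooth_germs"
  obtains S where "open S" "0 \<in> S" "smooth_on S f" "smooth_on S g"
proof -
  obtain S T where "open S" "0 \<in> S" "smooth_on S f" "open T" "0 \<in> T" "smooth_on T g"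
    using assms by (auto elim!: smooth_germsE)
  then show ?thesis by (intro that[of "S \<inter> T"]) (auto intro: smooth_on_subset)
qed

lemma smooth_germs_cong:
  assumes "germ_eq f g"
  shows "f \<in> smooth_germs \<longleftrightarrow> g \<in> smooth_germs"
proof -
  have "g \<in> smooth_germs" if "f \<in> smooth_germs" "germ_eq f g"
    for f g :: "'a::real_normed_field ^ 'b::finite \<Rightarrow> 'a"
  proof -
    obtain S where S: "open S" "0 \<in> S" "smooth_on S f" using \<open>f \<in> _\<close> by (rule smooth_germsE)
    obtain T where T: "open T" "0 \<in> T" "\<And>x. x \<in> T \<Longrightarrow> f x = g x" using \<open>germ_eq f g\<close> by (rule germ_eqE) blast
    have "smooth_on (S \<inter> T) f" using S by (auto intro: smooth_on_subset)
    then have "smooth_on (S \<inter> T) g" using S T smooth_on_cong[of "S \<inter> T" f g] by auto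
    then show ?thesis using S T by (intro smooth_germsI[of "S \<inter> T"]) auto
  qed
  then show ?thesis using assms germ_eq_sym by blast
qed

lemma smooth_germs_const: "(\<lambda>x. c) \<in> smooth_germs"
  by (rule smooth_germsI[of UNIV]) (auto intro: smooth_on_const)

lemma smooth_germs_coord: "(\<lambda>x. x $ i) \<in> smooth_germs"
  by (rule smooth_germsI[of UNIV]) (auto intro: smooth_on_coord)

lemma smooth_germs_add: "f \<in> smooth_germs \<Longrightarrow> g \<in> smooth_germs \<Longrightarrow> (\<lambda>x. f x + g x) \<in> smooth_germs"
  by (rule smooth_germs_common2, assumption+) (auto intro: smooth_germsI smooth_on_add)

lemma smooth_germs_diff: "f \<in> smooth_germs \<Longrightarrow> g \<in> smooth_germs \<Longrightarrow> (\<lambda>x. f x - g x) \<in> smooth_germs"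
  by (rule smooth_germs_common2, assumption+) (auto intro: smooth_germsI smooth_on_diff)

lemma smooth_germs_mult: "f \<in> smooth_germs \<Longrightarrow> g \<in> smooth_germs \<Longrightarrow> (\<lambda>x. f x * g x) \<in> smooth_germs"
  by (rule smooth_germs_common2, assumption+) (auto intro: smooth_germsI smooth_on_mult)

lemma smooth_germs_sum:
  assumes "\<And>a. a \<in> A \<Longrightarrow> f a \<in> smooth_germs"
  shows "(\<lambda>x. \<Sum>a\<in>A. f a x) \<in> smooth_germs"
  using assms
proof (induction A rule: infinite_finite_induct)
  case (insert a A)
  then show ?case using smooth_germs_add[of "f a" "\<lambda>x. \<Sum>a\<in>A. f a x"] by simp
qed (simp_all add: smooth_germs_const)

lemma smooth_germs_partial: "f \<in> smooth_germs \<Longrightarrow> partial i f \<in> smooth_germs"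
  by (erule smooth_germsE) (auto intro: smooth_germsI smooth_on_partial)

text \<open>
  A composite germ is smooth only where the inner map stays in the domain of the outer one.  The two
  neighbourhoods are part of the conclusion, because the chain rule refers to them.
\<close>

lemma smooth_germs_compose_nbhd:
  fixes \<phi> :: "'k ^ 'm::finite \<Rightarrow> 'k::real_normed_field ^ 'n::finite"
  assumes f: "f \<in> smooth_germs" and \<phi>: "\<And>j. (\<lambda>x. \<phi> x $ j) \<in> smooth_germs" and "\<phi> 0 = 0"
  obtains S T where "open S" "0 \<in> S" "smooth_on S f" "open T" "0 \<in> T" "\<And>x. x \<in> T \<Longrightarrow> \<phi> x \<in> S"
    "\<And>j. smooth_on T (\<lambda>x. \<phi> x $ j)" "smooth_on T (\<lambda>x. f (\<phi> x))"
proof -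
  obtain S where S: "open S" "0 \<in> S" "smooth_on S f" using f by (rule smooth_germsE)
  obtain T where T: "open T" "0 \<in> T" "\<And>j. smooth_on T (\<lambda>x. \<phi> x $ j)"
    using smooth_germs_common[of UNIV "\<lambda>j x. \<phi> x $ j"] \<phi> by auto
  have "continuous_on T \<phi>" by (rule continuous_on_vec) (rule smooth_on_continuous[OF T(3)])
  then have "open (T \<inter> \<phi> -` S)" using S T by (simp add: continuous_open_preimage)
  moreover have \<phi>S: "smooth_on (T \<inter> \<phi> -` S) (\<lambda>x. \<phi> x $ j)" for j
    by (rule smooth_on_subset[OF T(3)]) auto
  moreover have "smooth_on (T \<inter> \<phi> -` S) (\<lambda>x. f (\<phi> x))"
    by (rule smooth_on_compose[OF _ S(1) _ S(3) \<phi>S]) (use calculation in auto)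
  ultimately show ?thesis using S T \<open>\<phi> 0 = 0\<close>
    by (intro that[of S "T \<inter> \<phi> -` S"]) auto
qed

lemma smooth_germs_comp:
  fixes \<phi> :: "'k ^ 'm::finite \<Rightarrow> 'k::real_normed_field ^ 'n::finite"
  assumes "f \<in> smooth_germs" "\<And>j. (\<lambda>x. \<phi> x $ j) \<in> smooth_germs" "\<phi> 0 = 0"
  shows "(\<lambda>x. f (\<phi> x)) \<in> smooth_germs"
  by (rule smooth_germs_compose_nbhd[OF assms]) (rule smooth_germsI)

lemma smooth_germs_prod:
  assumes "\<And>a. a \<in> A \<Longrightarrow> f a \<in> smooth_germs"
  shows "(\<lambda>x. \<Prod>a\<in>A. f a x) \<in> smooth_germs"
  using assms
proof (induction A rule: infinite_finite_induct)
  case (insert a A)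
  then show ?case using smooth_germs_mult[of "f a" "\<lambda>x. \<Prod>a\<in>A. f a x"] by simp
qed (simp_all add: smooth_germs_const)

lemma smooth_germs_det:
  fixes A :: "'k::real_normed_field ^ 'p::finite \<Rightarrow> 'k ^ 'q::finite ^ 'q"
  assumes "\<And>i j. (\<lambda>x. A x $ i $ j) \<in> smooth_germs"
  shows "(\<lambda>x. det (A x)) \<in> smooth_germs"
  unfolding det_def by (intro smooth_germs_sum smooth_germs_mult smooth_germs_const smooth_germs_prod assms)

lemma eventually_nonzero_germ:
  assumes "f \<in> smooth_germs" "f 0 \<noteq> 0"
  obtains S where "open S" "0 \<in> S" "smooth_on S f" "\<And>x. x \<in> S \<Longrightarrow> f x \<noteq> 0"
proof -
  obtain S where S: "open S" "0 \<in> S" "smooth_on S f" using assms(1) by (rule smooth_germsE)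
  have "open (S \<inter> f -` (- {0}))"
    using S by (intro continuous_open_preimage smooth_on_continuous) auto
  moreover have "smooth_on (S \<inter> f -` (- {0})) f" using S(3) by (rule smooth_on_subset) auto
  ultimately show ?thesis using S assms(2) by (intro that[of "S \<inter> f -` (- {0})"]) auto
qed

lemma smooth_germs_inverse:
  assumes "f \<in> smooth_germs" "f 0 \<noteq> 0"
  shows "(\<lambda>x. inverse (f x)) \<in> smooth_germs"
  by (rule eventually_nonzero_germ[OF assms]) (rule smooth_germsI, assumption, assumption, rule smooth_on_inverse)

lemma tendsto_map_germ:
  fixes \<psi> :: "'k::real_normed_field ^ 'm::finite \<Rightarrow> 'k ^ 'n::finite"
  assumes "\<And>j. (\<lambda>x. \<psi> x $ j) \<in> smooth_germs" "\<psi> 0 = 0"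
  shows "filterlim \<psi> (nhds 0) (nhds 0)"
proof -
  obtain S where S: "open S" "0 \<in> S" "\<And>j. smooth_on S (\<lambda>x. \<psi> x $ j)"
    using smooth_germs_common[of UNIV "\<lambda>j x. \<psi> x $ j"] assms(1) by auto
  have "continuous_on S \<psi>" by (rule continuous_on_vec) (rule smooth_on_continuous[OF S(3)])
  then have "isCont \<psi> 0" using S by (simp add: continuous_on_eq_continuous_at)
  then have "(\<psi> \<longlongrightarrow> \<psi> 0) (nhds 0)" by (simp only: isCont_def tendsto_at_iff_tendsto_nhds[of \<psi> 0])
  then show ?thesis using assms(2) by simp
qed

lemma eventually_map_germ:
  fixes \<psi> :: "'k::real_normed_field ^ 'm::finite \<Rightarrow> 'k ^ 'n::finite"
  assumes "\<And>j. (\<lambda>x. \<psi> x $ j) \<in> smooth_germs" "\<psi> 0 = 0" "\<forall>\<^sub>F y in nhds 0. P y"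
  shows "\<forall>\<^sub>F x in nhds 0. P (\<psi> x)"
  using tendsto_map_germ[OF assms(1,2)] assms(3) by (auto simp: filterlim_iff)

lemma partials_germ_cong:
  assumes "germ_eq f g"
  shows "partials is f 0 = partials is g 0"
  using assms by (elim germ_eqE) (auto intro: partials_cong)

text \<open>
  By Hadamard's lemma these germs form the \<open>n\<close>-th power of the maximal ideal.  The description by
  derivatives at 0 has the advantage that its behaviour under differentiation is immediate, so that
  its properties follow by induction from the recursion \<open>vanishes_Suc\<close>.
\<close>

definition vanishes :: "nat \<Rightarrow> ('k::real_normed_field ^ 'n::finite \<Rightarrow> 'k) set" where
  "vanishes n = {f \<in> smooth_germs. \<forall>is. length is < n \<longrightarrow> partials is f 0 = 0}"

lemma vanishes_smooth: "f \<in> vanishes n \<Longrightarrow> f \<in> smooth_germs"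
  by (simp add: vanishes_def)

lemma vanishes_0: "vanishes 0 = smooth_germs"
  by (simp add: vanishes_def)

lemma vanishes_Suc: "f \<in> vanishes (Suc n) \<longleftrightarrow> f \<in> smooth_germs \<and> f 0 = 0 \<and> (\<forall>i. partial i f \<in> vanishes n)"
proof
  assume f: "f \<in> vanishes (Suc n)"
  then have "partials is f 0 = 0" if "length is < Suc n" for "is"
    using that by (simp add: vanishes_def)
  from this[of "[]"] have "f 0 = 0" by simp
  moreover have "partials is (partial i f) 0 = 0" if "length is < n" for i "is"
    using f that unfolding vanishes_def by (simp flip: partials_snoc)
  ultimately show "f \<in> smooth_germs \<and> f 0 = 0 \<and> (\<forall>i. partial i f \<in> vanishes n)"
    using f by (auto simp: vanishes_def smooth_germs_partial)
next
  assume f: "f \<in> smooth_germs \<and> f 0 = 0 \<and> (\<forall>i. partial i f \<in> vanishes n)"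
  have "partials is f 0 = 0" if "length is < Suc n" for "is"
    using that f by (cases "is" rule: rev_cases) (auto simp: partials_snoc vanishes_def)
  then show "f \<in> vanishes (Suc n)" using f by (simp add: vanishes_def)
qed

lemma vanishes_mono: "f \<in> vanishes n \<Longrightarrow> m \<le> n \<Longrightarrow> f \<in> vanishes m"
  by (auto simp: vanishes_def)

lemma vanishes_1: "vanishes (Suc 0) = max_ideal"
  using vanishes_Suc[of _ 0] by (auto simp: max_ideal_def vanishes_0 smooth_germs_partial)

lemma vanishes_cong:
  assumes "germ_eq f g"
  shows "f \<in> vanishes n \<longleftrightarrow> g \<in> vanishes n"
  using smooth_germs_cong[OF assms] partials_germ_cong[OF assms] by (simp add: vanishes_def)

lemma vanishes_const_0: "(\<lambda>x. 0) \<in> vanishes n"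
proof (induction n)
  case (Suc n)
  then show ?case by (simp add: vanishes_Suc smooth_germs_const partial_const[abs_def])
qed (simp add: vanishes_0 smooth_germs_const)

lemma vanishes_add: "f \<in> vanishes n \<Longrightarrow> g \<in> vanishes n \<Longrightarrow> (\<lambda>x. f x + g x) \<in> vanishes n"
proof (induction n arbitrary: f g)
  case (Suc n)
  then have "f \<in> smooth_germs" "g \<in> smooth_germs" by (auto simp: vanishes_smooth)
  then obtain S where S: "open S" "0 \<in> S" "smooth_on S f" "smooth_on S g"
    by (rule smooth_germs_common2)
  have g: "germ_eq (partial i (\<lambda>x. f x + g x)) (\<lambda>x. partial i f x + partial i g x)" for i
    using S by (intro germ_eqI[of S] partial_add)
  have "(\<lambda>x. partial i f x + partial i g x) \<in> vanishes n" for i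
    using Suc by (simp add: vanishes_Suc)
  then have "partial i (\<lambda>x. f x + g x) \<in> vanishes n" for i
    using vanishes_cong[OF g] by blast
  then show ?case using Suc.prems by (simp add: vanishes_Suc smooth_germs_add)
qed (simp add: vanishes_0 smooth_germs_add)

text \<open>
  By the product rule, each derivative of a product lowers the order of only one factor.
\<close>

lemma vanishes_mult:
  "f \<in> vanishes a \<Longrightarrow> g \<in> vanishes b \<Longrightarrow> (\<lambda>x. f x * g x) \<in> vanishes (a + b)"
proof (induction "a + b" arbitrary: a b f g)
  case 0
  then show ?case by (simp add: vanishes_0 smooth_germs_mult)
next
  case (Suc n)
  then have sm: "f \<in> smooth_germs" "g \<in> smooth_germs" by (auto simp: vanishes_smooth)
  then obtain S where S: "open S" "0 \<in> S" "smooth_on S f" "smooth_on S g"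
    by (rule smooth_germs_common2)
  have g: "germ_eq (partial i (\<lambda>x. f x * g x)) (\<lambda>x. partial i f x * g x + f x * partial i g x)" for i
    using S by (intro germ_eqI[of S] partial_mult)
  have "(\<lambda>x. partial i f x * g x) \<in> vanishes n" for i
  proof (cases a)
    case 0
    then show ?thesis
      using Suc.hyps(1)[of 0 n "partial i f" g] Suc.hyps(2) Suc.prems vanishes_mono[of g b n]
      by (auto simp: vanishes_0 smooth_germs_partial)
  next
    case (Suc a')
    then show ?thesis
      using Suc.hyps(1)[of a' b "partial i f" g] Suc.hyps(2) Suc.prems by (auto simp: vanishes_Suc)
  qed
  moreover have "(\<lambda>x. f x * partial i g x) \<in> vanishes n" for i
  proof (cases b)
    case 0
    then show ?thesis
      using Suc.hyps(1)[of n 0 f "partial i g"] Suc.hyps(2) Suc.prems vanishes_mono[of f a n]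
      by (auto simp: vanishes_0 smooth_germs_partial)
  next
    case (Suc b')
    then show ?thesis
      using Suc.hyps(1)[of a b' f "partial i g"] Suc.hyps(2) Suc.prems by (auto simp: vanishes_Suc)
  qed
  ultimately have "partial i (\<lambda>x. f x * g x) \<in> vanishes n" for i
    using vanishes_cong[OF g] vanishes_add by blast
  moreover have "f 0 * g 0 = 0"
    using Suc.hyps(2) Suc.prems by (cases a; cases b) (auto simp: vanishes_Suc)
  ultimately show ?case
    unfolding Suc.hyps(2)[symmetric] using sm by (simp add: vanishes_Suc smooth_germs_mult)
qed

lemma vanishes_mult_left: "f \<in> smooth_germs \<Longrightarrow> g \<in> vanishes n \<Longrightarrow> (\<lambda>x. f x * g x) \<in> vanishes n"
  using vanishes_mult[of f 0 g n] by (simp add: vanishes_0)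

lemma vanishes_mult_right: "f \<in> vanishes n \<Longrightarrow> g \<in> smooth_germs \<Longrightarrow> (\<lambda>x. f x * g x) \<in> vanishes n"
  using vanishes_mult[of f n g 0] by (simp add: vanishes_0)

lemma vanishes_cmult: "f \<in> vanishes n \<Longrightarrow> (\<lambda>x. c * f x) \<in> vanishes n"
  by (rule vanishes_mult_left[OF smooth_germs_const])

lemma vanishes_diff: "f \<in> vanishes n \<Longrightarrow> g \<in> vanishes n \<Longrightarrow> (\<lambda>x. f x - g x) \<in> vanishes n"
  using vanishes_add[of f n "\<lambda>x. - 1 * g x"] vanishes_cmult[of g n "- 1"] by simp

lemma vanishes_sum:
  assumes "\<And>a. a \<in> A \<Longrightarrow> f a \<in> vanishes n"
  shows "(\<lambda>x. \<Sum>a\<in>A. f a x) \<in> vanishes n"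
  using assms
proof (induction A rule: infinite_finite_induct)
  case (insert a A)
  then show ?case using vanishes_add[of "f a" n "\<lambda>x. \<Sum>a\<in>A. f a x"] by simp
qed (simp_all add: vanishes_const_0)

text \<open>
  By the chain rule, a derivative of \<open>f \<circ> \<phi>\<close> is a combination of derivatives of \<open>f\<close>, composed with
  \<open>\<phi>\<close>, with smooth coefficients.
\<close>

lemma vanishes_compose:
  fixes \<phi> :: "'k ^ 'm::finite \<Rightarrow> 'k::real_normed_field ^ 'n::finite"
  assumes \<phi>: "\<And>j. (\<lambda>x. \<phi> x $ j) \<in> smooth_germs" and \<phi>0: "\<phi> 0 = 0"
  shows "f \<in> vanishes n \<Longrightarrow> (\<lambda>x. f (\<phi> x)) \<in> vanishes n"
proof (induction n arbitrary: f)
  case 0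
  then show ?case by (simp add: vanishes_0 smooth_germs_comp \<phi> \<phi>0)
next
  case (Suc n)
  then have "f \<in> smooth_germs" by (simp add: vanishes_smooth)
  then obtain S T where ST: "open S" "0 \<in> S" "smooth_on S f" "open T" "0 \<in> T" "\<And>x. x \<in> T \<Longrightarrow> \<phi> x \<in> S"
    "\<And>j. smooth_on T (\<lambda>x. \<phi> x $ j)" "smooth_on T (\<lambda>x. f (\<phi> x))"
    by (rule smooth_germs_compose_nbhd[OF _ \<phi> \<phi>0]) (rule that; assumption)
  have "(\<lambda>x. partial j f (\<phi> x) * partial i (\<lambda>x. \<phi> x $ j) x) \<in> vanishes n" for i j
    using Suc by (intro vanishes_mult_right Suc.IH smooth_germs_partial \<phi>) (auto simp: vanishes_Suc)
  then have "(\<lambda>x. \<Sum>j\<in>UNIV. partial j f (\<phi> x) * partial i (\<lambda>x. \<phi> x $ j) x) \<in> vanishes n" for i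
    by (rule vanishes_sum)
  moreover have "germ_eq (partial i (\<lambda>x. f (\<phi> x)))
      (\<lambda>x. \<Sum>j\<in>UNIV. partial j f (\<phi> x) * partial i (\<lambda>x. \<phi> x $ j) x)" for i
    using ST by (intro germ_eqI[of T] partial_compose[where T = S and S = T])
  ultimately have "partial i (\<lambda>x. f (\<phi> x)) \<in> vanishes n" for i
    using vanishes_cong by blast
  moreover have "(\<lambda>x. f (\<phi> x)) \<in> smooth_germs" using ST by (auto intro: smooth_germsI)
  ultimately show ?case using Suc.prems \<phi>0 by (simp add: vanishes_Suc)
qed

text \<open>
  This is the elementary inclusion in Hadamard's lemma; the hypothesis on the tangent space supplies
  a remainder in a power of the maximal ideal, and only its order at 0 matters.
\<close>

lemma vanishes_max_ideal_power: "f \<in> max_ideal_power n \<Longrightarrow> f \<in> vanishes n"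
proof (induction n arbitrary: f)
  case (Suc n)
  then obtain N a v where av: "\<And>i. i < (N::nat) \<Longrightarrow> a i \<in> max_ideal \<and> v i \<in> max_ideal_power n"
    and f: "germ_eq f (\<lambda>x. \<Sum>i<N. a i x * v i x)"
    by (auto simp: germ_span_def)
  have "(\<lambda>x. \<Sum>i<N. a i x * v i x) \<in> vanishes (Suc n)"
    using av Suc.IH vanishes_mult[of _ "Suc 0" _ n] by (intro vanishes_sum) (auto simp: vanishes_1)
  then show ?case using vanishes_cong[OF f] by blast
qed (simp add: vanishes_0)

section \<open>Taylor polynomials and jets\<close>

text \<open>
  The homogeneous part of degree \<open>m\<close> of the Taylor series at 0.  As in \<open>jet\<close>, the sum ranges over
  ordered lists of directions.
\<close>

definition taylor_part :: "nat \<Rightarrow> ('k::real_normed_field ^ 'n::finite \<Rightarrow> 'k) \<Rightarrow> 'k ^ 'n \<Rightarrow> 'k" where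
  "taylor_part m f x = (\<Sum>is | length is = m. partials is f 0 * prod_list (map (\<lambda>i. x $ i) is)) / fact m"

definition taylor :: "nat \<Rightarrow> ('k::real_normed_field ^ 'n::finite \<Rightarrow> 'k) \<Rightarrow> 'k ^ 'n \<Rightarrow> 'k" where
  "taylor k f x = (\<Sum>m\<le>k. taylor_part m f x)"

lemma jet_eq_taylor: "jet k f x $ j = taylor k (\<lambda>y. f y $ j) x"
  by (simp add: jet_def taylor_def taylor_part_def)

lemma finite_lists_length: "finite {is::'n::finite list. length is = m}"
  using finite_lists_length_eq[OF finite, of UNIV m] by simp

lemma taylor_part_0: "taylor_part 0 f x = f 0"
  by (simp add: taylor_part_def)

text \<open>
  Splitting off the innermost derivative, that is the last entry of the list, gives a recursion that
  reduces statements about the degree \<open>m + 1\<close> part of \<open>f\<close> to the degree \<open>m\<close> parts of its first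
  derivatives.
\<close>

lemma taylor_part_Suc:
  "taylor_part (Suc m) f x = (\<Sum>i\<in>UNIV. x $ i * taylor_part m (partial i f) x) / of_nat (Suc m)"
proof -
  let ?X = "\<lambda>is. prod_list (map (\<lambda>i. x $ i) is)"
  have "(\<Sum>is | length is = Suc m. partials is f 0 * ?X is)
      = (\<Sum>(i, is)\<in>UNIV \<times> {is. length is = m}. partials (is @ [i]) f 0 * ?X (is @ [i]))"
  proof -
    have "is \<in> (\<lambda>(i, is). is @ [i]) ` (UNIV \<times> {is. length is = m})" if "length is = Suc m" for "is" :: "'b list"
      using that by (cases "is" rule: rev_cases) auto
    then have "{is. length is = Suc m} = (\<lambda>(i, is). is @ [i]) ` (UNIV \<times> {is::'b list. length is = m})"
      by auto
    moreover have "inj_on (\<lambda>(i, is). is @ [i]) (UNIV \<times> {is::'b list. length is = m})"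
      by (auto simp: inj_on_def)
    ultimately show ?thesis by (simp only: sum.reindex) (simp add: case_prod_beta)
  qed
  also have "\<dots> = (\<Sum>i\<in>UNIV. \<Sum>is | length is = m. x $ i * (partials is (partial i f) 0 * ?X is))"
    by (simp add: sum.cartesian_product partials_snoc mult_ac)
  also have "\<dots> = (\<Sum>i\<in>UNIV. x $ i * taylor_part m (partial i f) x) * fact m"
    by (simp add: taylor_part_def flip: sum_distrib_left sum_divide_distrib)
  finally show ?thesis by (simp add: taylor_part_def[of "Suc m"] del: of_nat_Suc)
qed

lemma taylor_part_cong: "germ_eq f g \<Longrightarrow> taylor_part m f = taylor_part m g"
  by (rule ext) (simp add: taylor_part_def partials_germ_cong)

lemma smooth_on_taylor_part: "smooth_on UNIV (taylor_part m f)"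
proof (induction m arbitrary: f)
  case 0
  then show ?case by (simp add: taylor_part_0[abs_def] smooth_on_const)
next
  case (Suc m)
  have "smooth_on UNIV (\<lambda>x. (\<Sum>i\<in>UNIV. x $ i * taylor_part m (partial i f) x) * inverse (of_nat (Suc m)))"
    by (intro smooth_on_mult smooth_on_sum smooth_on_coord smooth_on_const Suc.IH open_UNIV)
  then show ?case by (simp add: taylor_part_Suc[abs_def] divide_inverse)
qed

lemma smooth_germs_taylor_part: "taylor_part m f \<in> smooth_germs"
  by (rule smooth_germsI[OF open_UNIV _ smooth_on_taylor_part]) simp

lemma partials_add:
  assumes "f \<in> smooth_germs" "g \<in> smooth_germs"
  shows "partials is (\<lambda>x. f x + g x) 0 = partials is f 0 + partials is g 0"
proof -
  obtain S where S: "open S" "0 \<in> S" "smooth_on S f" "smooth_on S g"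
    using assms by (rule smooth_germs_common2)
  have "partials is (\<lambda>x. f x + g x) x = partials is f x + partials is g x" if "x \<in> S" for x
    using that
  proof (induction "is" arbitrary: x)
    case (Cons i "is")
    have "partial i (partials is (\<lambda>x. f x + g x)) x = partial i (\<lambda>x. partials is f x + partials is g x) x"
      using S(1) Cons.prems Cons.IH by (rule partial_cong)
    also have "\<dots> = partial i (partials is f) x + partial i (partials is g) x"
      using S Cons.prems by (intro partial_add[where S = S] smooth_on_partials)
    finally show ?case by simp
  qed simp
  then show ?thesis using S(2) by blast
qed

lemma partials_cmult:
  assumes "f \<in> smooth_germs"
  shows "partials is (\<lambda>x. c * f x) 0 = c * partials is f 0"
proof -
  obtain S where S: "open S" "0 \<in> S" "smooth_on S f" using assms by (rule smooth_germsE)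
  have "partials is (\<lambda>x. c * f x) x = c * partials is f x" if "x \<in> S" for x
    using that
  proof (induction "is" arbitrary: x)
    case (Cons i "is")
    have "partial i (partials is (\<lambda>x. c * f x)) x = partial i (\<lambda>x. c * partials is f x) x"
      using S(1) Cons.prems Cons.IH by (rule partial_cong)
    also have "\<dots> = c * partial i (partials is f) x"
      using S Cons.prems by (intro partial_cmult[where S = S] smooth_on_partials)
    finally show ?case by simp
  qed simp
  then show ?thesis using S(2) by blast
qed

lemma partials_const_0: "partials is (\<lambda>x. 0) = (\<lambda>x. 0)"
  by (induction "is") (simp_all add: partial_const[abs_def])

lemma partials_sum:
  assumes "\<And>a. a \<in> A \<Longrightarrow> f a \<in> smooth_germs"
  shows "partials is (\<lambda>x. \<Sum>a\<in>A. f a x) 0 = (\<Sum>a\<in>A. partials is (f a) 0)"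
  using assms
proof (induction A rule: infinite_finite_induct)
  case (insert a A)
  then have "partials is (\<lambda>x. f a x + (\<Sum>a\<in>A. f a x)) 0 = partials is (f a) 0 + partials is (\<lambda>x. \<Sum>a\<in>A. f a x) 0"
    by (intro partials_add smooth_germs_sum) auto
  then show ?case using insert by simp
qed (simp_all add: partials_const_0)

lemma taylor_part_add:
  assumes "f \<in> smooth_germs" "g \<in> smooth_germs"
  shows "taylor_part m (\<lambda>x. f x + g x) x = taylor_part m f x + taylor_part m g x"
  by (simp add: taylor_part_def partials_add[OF assms] distrib_right sum.distrib add_divide_distrib)

lemma taylor_add:
  "f \<in> smooth_germs \<Longrightarrow> g \<in> smooth_germs \<Longrightarrow> taylor k (\<lambda>x. f x + g x) x = taylor k f x + taylor k g x"
  by (simp add: taylor_def taylor_part_add sum.distrib)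

lemma taylor_part_const: "taylor_part m (\<lambda>x. c) x = (if m = 0 then c else 0)"
proof (induction m arbitrary: c)
  case (Suc m)
  then show ?case by (simp add: taylor_part_Suc partial_const[abs_def])
qed (simp add: taylor_part_0)

lemma taylor_part_cmult:
  assumes "f \<in> smooth_germs"
  shows "taylor_part m (\<lambda>x. c * f x) x = c * taylor_part m f x"
  using assms
proof (induction m arbitrary: f)
  case (Suc m)
  obtain S where S: "open S" "0 \<in> S" "smooth_on S f" using Suc.prems by (rule smooth_germsE)
  have g: "germ_eq (partial i (\<lambda>x. c * f x)) (\<lambda>x. c * partial i f x)" for i
    using S by (intro germ_eqI[of S] partial_cmult)
  then have "taylor_part m (partial i (\<lambda>x. c * f x)) x = c * taylor_part m (partial i f) x" for i
    by (simp only: taylor_part_cong[OF g] Suc.IH[OF smooth_germs_partial[OF Suc.prems]])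
  then show ?case by (simp add: taylor_part_Suc sum_distrib_left mult_ac)
qed (simp add: taylor_part_0)

lemma taylor_vanishes:
  assumes "f \<in> vanishes (Suc k)"
  shows "taylor k f = (\<lambda>x. 0)"
proof -
  have "partials is f 0 = 0" if "length is \<le> k" for "is"
    using assms that by (simp add: vanishes_def)
  then show ?thesis by (simp add: taylor_def[abs_def] taylor_part_def[abs_def])
qed

text \<open>
  The Taylor polynomial is linear, and zero on germs of higher order.
\<close>

lemma taylor_eqI:
  assumes "f \<in> smooth_germs" "(\<lambda>x. f x - g x) \<in> vanishes (Suc k)"
  shows "taylor k f = taylor k g"
proof
  fix x
  have d: "(\<lambda>x. g x - f x) \<in> vanishes (Suc k)" using vanishes_cmult[OF assms(2), of "- 1"] by simp
  have "taylor k (\<lambda>x. f x + (g x - f x)) x = taylor k f x + taylor k (\<lambda>x. g x - f x) x"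
    using assms(1) vanishes_smooth[OF d] by (rule taylor_add)
  then show "taylor k f x = taylor k g x" by (simp add: taylor_vanishes[OF d])
qed

text \<open>
  The recursion \<open>taylor_part_Suc\<close> puts one derivative in the innermost position and leaves the
  others; that \<open>\<partial>\<^sub>j\<close> can be moved there is the symmetry of mixed derivatives.
\<close>

lemma partial_taylor_part:
  assumes "f \<in> smooth_germs"
  shows "partial j (taylor_part (Suc m) f) x = taylor_part m (partial j f) x"
  using assms
proof (induction m arbitrary: f x)
  case 0
  have "has_partial j (\<lambda>x. \<Sum>i\<in>UNIV. x $ i * partial i f 0) (\<Sum>i\<in>UNIV. (if j = i then 1 else 0) * partial i f 0 + x $ i * 0) x"
    using has_partial_mult[OF has_partial_coord has_partial_const] unfolding has_partial_def
    by (intro DERIV_sum) blast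
  from has_partial_imp_eq[OF this] show ?case
    by (simp add: taylor_part_Suc[abs_def] taylor_part_0 if_distrib[where f = "\<lambda>u. u * _"] cong: if_cong)
next
  case (Suc m)
  obtain S where S: "open S" "0 \<in> S" "smooth_on S f" using Suc.prems by (rule smooth_germsE)
  have comm: "taylor_part m (partial j (partial i f)) = taylor_part m (partial i (partial j f))" for i
    using S by (intro taylor_part_cong germ_eqI[of S] partial_commute[of S])
  let ?c = "inverse (of_nat (Suc (Suc m))) :: 'a"
  have tp: "taylor_part (Suc (Suc m)) f = (\<lambda>x. ?c * (\<Sum>i\<in>UNIV. x $ i * taylor_part (Suc m) (partial i f) x))"
    by (rule ext) (simp only: taylor_part_Suc[of "Suc m"] divide_inverse mult.commute)
  have "partial j (taylor_part (Suc (Suc m)) f) x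
    = ?c * partial j (\<lambda>x. \<Sum>i\<in>UNIV. x $ i * taylor_part (Suc m) (partial i f) x) x"
    unfolding tp by (intro partial_cmult[where S = UNIV] smooth_on_sum smooth_on_mult smooth_on_coord smooth_on_taylor_part) auto
  also have "partial j (\<lambda>x. \<Sum>i\<in>UNIV. x $ i * taylor_part (Suc m) (partial i f) x) x
    = (\<Sum>i\<in>UNIV. partial j (\<lambda>x. x $ i * taylor_part (Suc m) (partial i f) x) x)"
    by (intro partial_sum[where S = UNIV] smooth_on_mult smooth_on_coord smooth_on_taylor_part) auto
  also have "\<dots> = (\<Sum>i\<in>UNIV. partial j (\<lambda>x. x $ i) x * taylor_part (Suc m) (partial i f) x
      + x $ i * partial j (taylor_part (Suc m) (partial i f)) x)"
    by (intro sum.cong partial_mult[where S = UNIV] smooth_on_coord smooth_on_taylor_part) auto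
  also have "\<dots> = taylor_part (Suc m) (partial j f) x + (\<Sum>i\<in>UNIV. x $ i * taylor_part m (partial i (partial j f)) x)"
    using Suc by (simp add: partial_coord sum.distrib smooth_germs_partial comm if_distrib[where f = "\<lambda>u. u * _"] cong: if_cong)
  also have "(\<Sum>i\<in>UNIV. x $ i * taylor_part m (partial i (partial j f)) x)
      = of_nat (Suc m) * taylor_part (Suc m) (partial j f) x"
    using of_nat_neq_0[where 'a = 'a, of m] by (simp only: taylor_part_Suc) (simp del: of_nat_Suc)
  also have "?c * (taylor_part (Suc m) (partial j f) x + of_nat (Suc m) * taylor_part (Suc m) (partial j f) x)
      = (?c * of_nat (Suc (Suc m))) * taylor_part (Suc m) (partial j f) x"
    by (simp add: algebra_simps)
  also have "?c * of_nat (Suc (Suc m)) = 1"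
    using of_nat_neq_0[where 'a = 'a, of "Suc m"] by (simp del: of_nat_Suc)
  finally show ?case by simp
qed

lemma partial_taylor:
  assumes "f \<in> smooth_germs"
  shows "partial j (taylor (Suc k) f) x = taylor k (partial j f) x"
proof -
  have "partial j (taylor (Suc k) f) x = (\<Sum>m\<le>Suc k. partial j (taylor_part m f) x)"
    unfolding taylor_def[abs_def]
    by (intro partial_sum[where S = UNIV] smooth_on_taylor_part) auto
  also have "\<dots> = partial j (taylor_part 0 f) x + (\<Sum>m\<le>k. partial j (taylor_part (Suc m) f) x)"
    by (rule sum.atMost_Suc_shift)
  also have "partial j (taylor_part 0 f) x = 0" by (simp add: taylor_part_0[abs_def] partial_const)
  also have "0 + (\<Sum>m\<le>k. partial j (taylor_part (Suc m) f) x) = taylor k (partial j f) x"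
    by (simp add: partial_taylor_part[OF assms] taylor_def)
  finally show ?thesis .
qed

lemma smooth_germs_taylor: "taylor k f \<in> smooth_germs"
  unfolding taylor_def[abs_def] by (intro smooth_germs_sum smooth_germs_taylor_part)

lemma taylor_at_0: "taylor k f 0 = f 0"
proof (induction k)
  case (Suc k)
  have "taylor_part (Suc k) f 0 = 0" by (simp add: taylor_part_Suc)
  then show ?case using Suc by (simp add: taylor_def)
qed (simp add: taylor_def taylor_part_0)

text \<open>
  Differentiating the remainder of order \<open>k + 1\<close> of \<open>f\<close> gives the remainders of order \<open>k\<close> of the
  derivatives of \<open>f\<close>.
\<close>

lemma taylor_remainder:
  "f \<in> smooth_germs \<Longrightarrow> (\<lambda>x. f x - taylor k f x) \<in> vanishes (Suc k)"
proof (induction k arbitrary: f)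
  case 0
  have "taylor 0 f = (\<lambda>x. f 0)" by (simp add: taylor_def[abs_def] taylor_part_0)
  then show ?case
    using 0 by (simp add: vanishes_Suc vanishes_0 smooth_germs_diff smooth_germs_const smooth_germs_partial)
next
  case (Suc k)
  have d: "(\<lambda>x. f x - taylor (Suc k) f x) \<in> smooth_germs"
    by (intro smooth_germs_diff smooth_germs_taylor Suc.prems)
  obtain S where S: "open S" "0 \<in> S" "smooth_on S f" "smooth_on S (taylor (Suc k) f)"
    using Suc.prems smooth_germs_taylor by (rule smooth_germs_common2)
  have g: "germ_eq (partial i (\<lambda>x. f x - taylor (Suc k) f x)) (\<lambda>x. partial i f x - taylor k (partial i f) x)" for i
    unfolding partial_taylor[OF Suc.prems, symmetric] using S by (intro germ_eqI[of S] partial_diff)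
  have "partial i (\<lambda>x. f x - taylor (Suc k) f x) \<in> vanishes (Suc k)" for i
    using vanishes_cong[OF g] Suc.IH[OF smooth_germs_partial[OF Suc.prems]] by blast
  then show ?case using d by (simp add: vanishes_Suc[of _ "Suc k"] taylor_at_0)
qed

text \<open>
  A germ is a polynomial of degree at most \<open>d\<close> if and only if it is its own Taylor polynomial of every
  degree from \<open>d\<close> on.  In this form no coefficients have to be compared.
\<close>

definition poly_deg_le :: "nat \<Rightarrow> ('k::real_normed_field ^ 'n::finite \<Rightarrow> 'k) set" where
  "poly_deg_le d = {f \<in> smooth_germs. \<forall>k\<ge>d. taylor k f = f}"

text \<open>
  Induction by \<open>taylor_part_Suc\<close>: the product rule for \<open>x\<^sub>i f\<close> contributes one copy of
  \<open>x\<^sub>i T\<close>, where \<open>T\<close> is the degree \<open>m + 1\<close> part of \<open>f\<close>, from the derivative of \<open>x\<^sub>i\<close>, and by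
  the recursion for \<open>f\<close> another \<open>m + 1\<close> copies from the derivatives of \<open>f\<close>; the recursion divides by
  \<open>m + 2\<close>.
\<close>

lemma taylor_part_coord_mult:
  assumes "f \<in> smooth_germs"
  shows "taylor_part (Suc m) (\<lambda>x. x $ i * f x) x = x $ i * taylor_part m f x"
  using assms
proof (induction m arbitrary: f)
  case 0
  obtain S where S: "open S" "0 \<in> S" "smooth_on S f" using 0 by (rule smooth_germsE)
  have "partial j (\<lambda>x. x $ i * f x) 0 = (if j = i then f 0 else 0)" for j
    using partial_mult[OF smooth_on_coord S(3,2)] by (simp add: partial_coord)
  then have "(\<Sum>j\<in>UNIV. x $ j * partial j (\<lambda>x. x $ i * f x) 0) = (\<Sum>j\<in>UNIV. if j = i then x $ j * f 0 else 0)"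
    by (intro sum.cong) auto
  then show ?case by (simp add: taylor_part_Suc taylor_part_0)
next
  case (Suc m)
  obtain S where S: "open S" "0 \<in> S" "smooth_on S f" using Suc.prems by (rule smooth_germsE)
  have "taylor_part (Suc m) (partial j (\<lambda>x. x $ i * f x)) x
      = (if j = i then 1 else 0) * taylor_part (Suc m) f x + x $ i * taylor_part m (partial j f) x" for j
  proof -
    have "germ_eq (partial j (\<lambda>x. x $ i * f x)) (\<lambda>x. (if j = i then 1 else 0) * f x + x $ i * partial j f x)"
      using S partial_mult[OF smooth_on_coord[of S i] S(3), of _ j]
      by (intro germ_eqI[of S]) (auto simp: partial_coord)
    then have "taylor_part (Suc m) (partial j (\<lambda>x. x $ i * f x)) x
       = taylor_part (Suc m) (\<lambda>x. (if j = i then 1 else 0) * f x + x $ i * partial j f x) x"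
      by (simp add: taylor_part_cong)
    also have "\<dots> = taylor_part (Suc m) (\<lambda>x. (if j = i then 1 else 0) * f x) x + taylor_part (Suc m) (\<lambda>x. x $ i * partial j f x) x"
      using Suc.prems
      by (intro taylor_part_add smooth_germs_mult smooth_germs_const smooth_germs_coord smooth_germs_partial)
    finally show ?thesis
      using Suc by (simp only: taylor_part_cmult smooth_germs_partial)
  qed
  then have "taylor_part (Suc (Suc m)) (\<lambda>x. x $ i * f x) x
     = (\<Sum>j\<in>UNIV. x $ j * ((if j = i then 1 else 0) * taylor_part (Suc m) f x + x $ i * taylor_part m (partial j f) x)) / of_nat (Suc (Suc m))"
    by (simp only: taylor_part_Suc[of "Suc m"])
  also have "\<dots> = (x $ i * taylor_part (Suc m) f x + x $ i * (\<Sum>j\<in>UNIV. x $ j * taylor_part m (partial j f) x)) / of_nat (Suc (Suc m))"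
    by (simp add: distrib_left sum.distrib sum_distrib_left mult_ac if_distrib[where f = "\<lambda>u. u * _"] if_distrib[where f = "\<lambda>u. _ * u"] cong: if_cong)
  also have "(\<Sum>j\<in>UNIV. x $ j * taylor_part m (partial j f) x) = of_nat (Suc m) * taylor_part (Suc m) f x"
    using of_nat_neq_0[where 'a = 'a, of m] by (simp only: taylor_part_Suc) (simp del: of_nat_Suc)
  also have "(x $ i * taylor_part (Suc m) f x + x $ i * (of_nat (Suc m) * taylor_part (Suc m) f x)) 
     = of_nat (Suc (Suc m)) * (x $ i * taylor_part (Suc m) f x)"
    by (simp add: algebra_simps)
  finally show ?case using of_nat_neq_0[where 'a = 'a, of "Suc m"] by (simp del: of_nat_Suc)
qed

lemma taylor_coord_mult:
  assumes "f \<in> smooth_germs"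
  shows "taylor (Suc k) (\<lambda>x. x $ i * f x) x = x $ i * taylor k f x"
proof -
  have "taylor (Suc k) (\<lambda>x. x $ i * f x) x
     = taylor_part 0 (\<lambda>x. x $ i * f x) x + (\<Sum>m\<le>k. taylor_part (Suc m) (\<lambda>x. x $ i * f x) x)"
    unfolding taylor_def by (rule sum.atMost_Suc_shift)
  then show ?thesis using assms
    by (simp add: taylor_part_0 taylor_part_coord_mult taylor_def sum_distrib_left)
qed

lemma poly_deg_le_const: "(\<lambda>x. c) \<in> poly_deg_le d"
proof -
  have "taylor k (\<lambda>x. c) x = c" for k and x :: "'a ^ 'b"
    by (induction k) (simp_all add: taylor_def taylor_part_const)
  then show ?thesis by (simp add: poly_deg_le_def smooth_germs_const fun_eq_iff)
qed

lemma poly_deg_le_mono: "f \<in> poly_deg_le d \<Longrightarrow> d \<le> e \<Longrightarrow> f \<in> poly_deg_le e"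
  by (auto simp: poly_deg_le_def)

lemma poly_deg_le_add: "f \<in> poly_deg_le d \<Longrightarrow> g \<in> poly_deg_le d \<Longrightarrow> (\<lambda>x. f x + g x) \<in> poly_deg_le d"
  by (auto simp: poly_deg_le_def smooth_germs_add taylor_add fun_eq_iff)

lemma poly_deg_le_coord_mult: "f \<in> poly_deg_le d \<Longrightarrow> (\<lambda>x. x $ i * f x) \<in> poly_deg_le (Suc d)"
  unfolding poly_deg_le_def
proof safe
  fix k assume f: "f \<in> smooth_germs" "\<forall>k\<ge>d. taylor k f = f" and "Suc d \<le> k"
  then obtain k' where "k = Suc k'" "d \<le> k'" by (cases k) auto
  then show "taylor k (\<lambda>x. x $ i * f x) = (\<lambda>x. x $ i * f x)"
    using f by (simp add: fun_eq_iff taylor_coord_mult)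
qed (auto intro: smooth_germs_mult smooth_germs_coord)

lemma poly_deg_le_cmult: "f \<in> poly_deg_le d \<Longrightarrow> (\<lambda>x. c * f x) \<in> poly_deg_le d"
  unfolding poly_deg_le_def
  by (auto simp: smooth_germs_mult smooth_germs_const taylor_def taylor_part_cmult fun_eq_iff simp flip: sum_distrib_left)

lemma poly_deg_le_sum:
  assumes "\<And>a. a \<in> A \<Longrightarrow> f a \<in> poly_deg_le d"
  shows "(\<lambda>x. \<Sum>a\<in>A. f a x) \<in> poly_deg_le d"
  using assms
proof (induction A rule: infinite_finite_induct)
  case (insert a A)
  then show ?case using poly_deg_le_add[of "f a" d "\<lambda>x. \<Sum>a\<in>A. f a x"] by simp
qed (simp_all add: poly_deg_le_const)

lemma poly_deg_le_prod_list: "(\<lambda>x. prod_list (map (\<lambda>i. x $ i) is)) \<in> poly_deg_le (length is)"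
  by (induction "is") (simp_all add: poly_deg_le_const poly_deg_le_coord_mult)

lemma poly_deg_le_taylor: "taylor k f \<in> poly_deg_le k"
proof -
  have "(\<lambda>x. inverse (fact m) * (\<Sum>is | length is = m. partials is f 0 * prod_list (map (\<lambda>i. x $ i) is))) \<in> poly_deg_le k"
    if "m \<le> k" for m
    using that by (intro poly_deg_le_cmult poly_deg_le_sum)
      (auto intro: poly_deg_le_mono[OF poly_deg_le_prod_list])
  then show ?thesis unfolding taylor_def[abs_def] taylor_part_def
    by (intro poly_deg_le_sum) (simp add: divide_inverse mult.commute)
qed

lemma poly_deg_le_power_mult:
  "f \<in> poly_deg_le d \<Longrightarrow> (\<lambda>x. x $ i ^ n * f x) \<in> poly_deg_le (n + d)"
  by (induction n) (auto dest: poly_deg_le_coord_mult simp: mult.assoc)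

lemma poly_deg_le_homogeneous:
  fixes P :: "'k::real_normed_field ^ 'p::finite \<Rightarrow> 'k ^ 'q::finite"
  assumes "homogeneous_map d P"
  shows "(\<lambda>x. P x $ j) \<in> poly_deg_le d"
proof -
  have mon: "(\<lambda>x::'k^'p. \<Prod>i\<in>I. x $ i ^ a i) \<in> poly_deg_le (sum a I)" for a :: "'p \<Rightarrow> nat" and I
    by (induction I rule: infinite_finite_induct) (simp_all add: poly_deg_le_const poly_deg_le_power_mult)
  obtain c where c: "\<And>x. P x $ j = (\<Sum>a | sum a UNIV = d. c a * (\<Prod>i\<in>UNIV. x $ i ^ a i))"
    using assms unfolding homogeneous_map_def by blast
  have "(\<lambda>x::'k^'p. \<Prod>i\<in>UNIV. x $ i ^ a i) \<in> poly_deg_le d" if "a \<in> {a. sum a UNIV = d}" for a :: "'p \<Rightarrow> nat"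
    using that mon[of a UNIV] by simp
  then show ?thesis
    unfolding c by (intro poly_deg_le_sum poly_deg_le_cmult)
qed

text \<open>
  The principle by which jets are computed: to know the Taylor polynomial of \<open>f\<close>, compare \<open>f\<close> with a
  polynomial up to higher order.
\<close>

lemma taylor_unique:
  assumes "f \<in> smooth_germs" "P \<in> poly_deg_le k" "(\<lambda>x. f x - P x) \<in> vanishes (Suc k)"
  shows "taylor k f = P"
  using taylor_eqI[OF assms(1,3)] assms(2) by (auto simp: poly_deg_le_def)

section \<open>Iterates of a derivation plus a matrix\<close>

definition directional ::
  "('k::real_normed_field ^ 'p::finite \<Rightarrow> 'k ^ 'p) \<Rightarrow> ('k ^ 'p \<Rightarrow> 'k) \<Rightarrow> 'k ^ 'p \<Rightarrow> 'k" where
  "directional \<xi> c x = (\<Sum>i\<in>UNIV. partial i c x * \<xi> x $ i)"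

lemma lie_deriv_nth: "lie_deriv \<xi> v x $ j = directional \<xi> (\<lambda>y. v y $ j) x"
  by (simp add: lie_deriv_def directional_def)

text \<open>
  The infinitesimal action on vector fields along a map of a vector field \<open>\<xi>\<close> on the source together
  with a matrix \<open>M\<close> of functions acting on the fibre.  Applied to \<open>h\<close> itself, with \<open>\<xi>\<close> and \<open>M\<close> ranging
  over suitable fields and matrices, it sweeps out the tangent space of \<open>h\<close>.
\<close>

definition twisted_derivation ::
  "('k::real_normed_field ^ 'p::finite \<Rightarrow> 'k ^ 'p) \<Rightarrow> ('k ^ 'p \<Rightarrow> 'k ^ 'q::finite ^ 'q) \<Rightarrow>
     ('k ^ 'p \<Rightarrow> 'k ^ 'q) \<Rightarrow> 'k ^ 'p \<Rightarrow> 'k ^ 'q" where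
  "twisted_derivation \<xi> M v x = lie_deriv \<xi> v x + M x *v v x"

lemma twisted_derivation_nth:
  "twisted_derivation \<xi> M v x $ j = directional \<xi> (\<lambda>y. v y $ j) x + (\<Sum>l\<in>UNIV. M x $ j $ l * v x $ l)"
  by (simp add: twisted_derivation_def lie_deriv_nth matrix_vector_mult_def)

text \<open>
  One order is lost by differentiating and two are gained from the coefficients of \<open>\<xi>\<close>.
\<close>

lemma directional_vanishes:
  fixes \<xi> :: "'k::real_normed_field ^ 'p::finite \<Rightarrow> 'k ^ 'p"
  assumes \<xi>: "\<And>i. (\<lambda>x. \<xi> x $ i) \<in> vanishes 2" and c: "c \<in> vanishes n"
  shows "directional \<xi> c \<in> vanishes (Suc n)"
proof -
  have "partial i c \<in> vanishes (n - 1)" for i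
    using c by (cases n) (auto simp: vanishes_Suc vanishes_0 smooth_germs_partial)
  then have "(\<lambda>x. partial i c x * \<xi> x $ i) \<in> vanishes (n - 1 + 2)" for i
    using \<xi> by (rule vanishes_mult)
  then have "(\<lambda>x. partial i c x * \<xi> x $ i) \<in> vanishes (Suc n)" for i
    by (rule vanishes_mono) simp
  then show ?thesis unfolding directional_def[abs_def] by (rule vanishes_sum)
qed

lemma twisted_derivation_vanishes:
  fixes \<xi> :: "'k::real_normed_field ^ 'p::finite \<Rightarrow> 'k ^ 'p" and v :: "'k ^ 'p \<Rightarrow> 'k ^ 'q::finite"
  assumes \<xi>: "\<And>i. (\<lambda>x. \<xi> x $ i) \<in> vanishes 2" and M: "\<And>j l. (\<lambda>x. M x $ j $ l) \<in> vanishes 1"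
    and v: "\<And>j. (\<lambda>x. v x $ j) \<in> vanishes n"
  shows "(\<lambda>x. twisted_derivation \<xi> M v x $ j) \<in> vanishes (Suc n)"
proof -
  have "(\<lambda>x. M x $ j $ l * v x $ l) \<in> vanishes (Suc n)" for l
    using vanishes_mult[OF M v, of j l l] by simp
  then have "(\<lambda>x. \<Sum>l\<in>UNIV. M x $ j $ l * v x $ l) \<in> vanishes (Suc n)" by (rule vanishes_sum)
  then show ?thesis
    unfolding twisted_derivation_nth using directional_vanishes[OF \<xi> v[of j]] by (intro vanishes_add)
qed

lemma directional_iterate_vanishes:
  fixes \<xi> :: "'k::real_normed_field ^ 'p::finite \<Rightarrow> 'k ^ 'p"
  assumes \<xi>: "\<And>i. (\<lambda>x. \<xi> x $ i) \<in> vanishes 2" and c: "c \<in> vanishes m"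
  shows "(directional \<xi> ^^ n) c \<in> vanishes (n + m)"
  by (induction n) (auto simp: c intro: directional_vanishes[OF \<xi>])

lemma twisted_derivation_iterate_vanishes:
  fixes \<xi> :: "'k::real_normed_field ^ 'p::finite \<Rightarrow> 'k ^ 'p" and v :: "'k ^ 'p \<Rightarrow> 'k ^ 'q::finite"
  assumes \<xi>: "\<And>i. (\<lambda>x. \<xi> x $ i) \<in> vanishes 2" and M: "\<And>j l. (\<lambda>x. M x $ j $ l) \<in> vanishes 1"
    and v: "\<And>j. (\<lambda>x. v x $ j) \<in> vanishes m"
  shows "(\<lambda>x. (twisted_derivation \<xi> M ^^ n) v x $ j) \<in> vanishes (n + m)"
proof (induction n arbitrary: j)
  case (Suc n)
  then show ?case using twisted_derivation_vanishes[OF \<xi> M, of "(twisted_derivation \<xi> M ^^ n) v" "n + m" j] by simp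
qed (simp add: v)

lemma smooth_on_directional:
  fixes \<xi> :: "'k::real_normed_field ^ 'p::finite \<Rightarrow> 'k ^ 'p"
  assumes "open S" "\<And>i. smooth_on S (\<lambda>x. \<xi> x $ i)" "smooth_on S c"
  shows "smooth_on S (directional \<xi> c)"
  unfolding directional_def[abs_def] by (intro smooth_on_sum smooth_on_mult smooth_on_partial assms)

lemma smooth_on_directional_iterate:
  fixes \<xi> :: "'k::real_normed_field ^ 'p::finite \<Rightarrow> 'k ^ 'p"
  assumes "open S" "\<And>i. smooth_on S (\<lambda>x. \<xi> x $ i)" "smooth_on S c"
  shows "smooth_on S ((directional \<xi> ^^ n) c)"
  by (induction n) (simp_all add: assms smooth_on_directional)

lemma smooth_on_twisted_derivation:
  fixes \<xi> :: "'k::real_normed_field ^ 'p::finite \<Rightarrow> 'k ^ 'p" and v :: "'k ^ 'p \<Rightarrow> 'k ^ 'q::finite"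
  assumes "open S" "\<And>i. smooth_on S (\<lambda>x. \<xi> x $ i)" "\<And>j l. smooth_on S (\<lambda>x. M x $ j $ l)"
    "\<And>j. smooth_on S (\<lambda>x. v x $ j)"
  shows "smooth_on S (\<lambda>x. twisted_derivation \<xi> M v x $ j)"
  unfolding twisted_derivation_nth
  by (intro smooth_on_add smooth_on_directional smooth_on_sum smooth_on_mult assms)

lemma smooth_on_twisted_derivation_iterate:
  fixes \<xi> :: "'k::real_normed_field ^ 'p::finite \<Rightarrow> 'k ^ 'p" and v :: "'k ^ 'p \<Rightarrow> 'k ^ 'q::finite"
  assumes "open S" "\<And>i. smooth_on S (\<lambda>x. \<xi> x $ i)" "\<And>j l. smooth_on S (\<lambda>x. M x $ j $ l)"
    "\<And>j. smooth_on S (\<lambda>x. v x $ j)"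
  shows "smooth_on S (\<lambda>x. (twisted_derivation \<xi> M ^^ n) v x $ j)"
proof (induction n arbitrary: j)
  case (Suc n)
  then show ?case using smooth_on_twisted_derivation[OF assms(1-3), of "(twisted_derivation \<xi> M ^^ n) v" j] by simp
qed (simp add: assms)

lemma twisted_derivation_cong:
  assumes S: "open S" "x \<in> S" and eq: "\<And>y. y \<in> S \<Longrightarrow> v y = w y"
  shows "twisted_derivation \<xi> M v x = twisted_derivation \<xi> M w x"
proof -
  have "partial i (\<lambda>y. v y $ j) x = partial i (\<lambda>y. w y $ j) x" for i j
    using S by (rule partial_cong) (simp add: eq)
  then show ?thesis
    by (simp add: vec_eq_iff twisted_derivation_nth directional_def eq[OF S(2)])
qed

lemma twisted_derivation_iterate_cong:
  assumes "open S" and "\<And>y. y \<in> S \<Longrightarrow> v y = w y" and "x \<in> S"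
  shows "(twisted_derivation \<xi> M ^^ n) v x = (twisted_derivation \<xi> M ^^ n) w x"
  using assms(3) by (induction n arbitrary: x) (auto simp: assms(2) intro!: twisted_derivation_cong[OF assms(1)])

lemma twisted_derivation_sum:
  fixes v :: "'a \<Rightarrow> 'k::real_normed_field ^ 'p::finite \<Rightarrow> 'k ^ 'q::finite"
  assumes S: "open S" "x \<in> S" and v: "\<And>a j. a \<in> A \<Longrightarrow> smooth_on S (\<lambda>y. v a y $ j)"
  shows "twisted_derivation \<xi> M (\<lambda>y. \<Sum>a\<in>A. v a y) x = (\<Sum>a\<in>A. twisted_derivation \<xi> M (v a) x)"
proof -
  have p: "partial i (\<lambda>y. \<Sum>a\<in>A. v a y $ j) x = (\<Sum>a\<in>A. partial i (\<lambda>y. v a y $ j) x)" for i j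
    using S v by (intro partial_sum[where S = S])
  have "directional \<xi> (\<lambda>y. \<Sum>a\<in>A. v a y $ j) x = (\<Sum>a\<in>A. directional \<xi> (\<lambda>y. v a y $ j) x)" for j
    unfolding directional_def p sum_distrib_right by (rule sum.swap)
  moreover have "(\<Sum>l\<in>UNIV. M x $ j $ l * (\<Sum>a\<in>A. v a x $ l)) = (\<Sum>a\<in>A. \<Sum>l\<in>UNIV. M x $ j $ l * v a x $ l)" for j
    unfolding sum_distrib_left by (rule sum.swap)
  ultimately show ?thesis
    by (simp add: vec_eq_iff twisted_derivation_nth sum.distrib)
qed

lemma twisted_derivation_iterate_sum:
  fixes v :: "'a \<Rightarrow> 'k::real_normed_field ^ 'p::finite \<Rightarrow> 'k ^ 'q::finite"
  assumes S: "open S" and \<xi>: "\<And>i. smooth_on S (\<lambda>x. \<xi> x $ i)" and M: "\<And>j l. smooth_on S (\<lambda>x. M x $ j $ l)"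
    and v: "\<And>a j. a \<in> A \<Longrightarrow> smooth_on S (\<lambda>y. v a y $ j)" and x: "x \<in> S"
  shows "(twisted_derivation \<xi> M ^^ n) (\<lambda>y. \<Sum>a\<in>A. v a y) x = (\<Sum>a\<in>A. (twisted_derivation \<xi> M ^^ n) (v a) x)"
  using x
proof (induction n arbitrary: x)
  case (Suc n)
  have "twisted_derivation \<xi> M ((twisted_derivation \<xi> M ^^ n) (\<lambda>y. \<Sum>a\<in>A. v a y)) x
      = twisted_derivation \<xi> M (\<lambda>y. \<Sum>a\<in>A. (twisted_derivation \<xi> M ^^ n) (v a) y) x"
    using S Suc.prems Suc.IH by (rule twisted_derivation_cong)
  also have "\<dots> = (\<Sum>a\<in>A. twisted_derivation \<xi> M ((twisted_derivation \<xi> M ^^ n) (v a)) x)"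
    using S Suc.prems by (rule twisted_derivation_sum) (intro smooth_on_twisted_derivation_iterate S \<xi> M v)
  finally show ?case by simp
qed simp

text \<open>
  The matrix part is linear over functions, so only \<open>\<xi>\<close> contributes a derivative of the scalar.
\<close>

lemma twisted_derivation_scale:
  fixes v :: "'k::real_normed_field ^ 'p::finite \<Rightarrow> 'k ^ 'q::finite"
  assumes S: "x \<in> S" and c: "smooth_on S c" and v: "\<And>j. smooth_on S (\<lambda>y. v y $ j)"
  shows "twisted_derivation \<xi> M (\<lambda>y. c y *s v y) x = directional \<xi> c x *s v x + c x *s twisted_derivation \<xi> M v x"
proof -
  have p: "partial i (\<lambda>y. c y * v y $ j) x = partial i c x * v x $ j + c x * partial i (\<lambda>y. v y $ j) x" for i j
    using c v S by (rule partial_mult)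
  have "directional \<xi> (\<lambda>y. c y * v y $ j) x = directional \<xi> c x * v x $ j + c x * directional \<xi> (\<lambda>y. v y $ j) x" for j
    unfolding directional_def p by (simp add: sum_distrib_left sum_distrib_right sum.distrib algebra_simps)
  then show ?thesis
    by (simp add: vec_eq_iff twisted_derivation_nth sum_distrib_left algebra_simps)
qed

text \<open>
  Pascal's rule, in the form of the induction step of Leibniz' formula.
\<close>

lemma binomial_sum_step:
  fixes a b :: "nat \<Rightarrow> 'k::comm_ring_1"
  shows "(\<Sum>i\<le>n. of_nat (n choose i) * (a (Suc i) * b (n - i))) + (\<Sum>i\<le>n. of_nat (n choose i) * (a i * b (Suc n - i)))
     = (\<Sum>i\<le>Suc n. of_nat (Suc n choose i) * (a i * b (Suc n - i)))"
proof -
  have "(\<Sum>i\<le>n. of_nat (n choose i) * (a i * b (Suc n - i))) = (\<Sum>i\<le>Suc n. of_nat (n choose i) * (a i * b (Suc n - i)))"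
    by (simp add: binomial_eq_0)
  also have "\<dots> = a 0 * b (Suc n) + (\<Sum>i\<le>n. of_nat (n choose Suc i) * (a (Suc i) * b (n - i)))"
    by (subst sum.atMost_Suc_shift) simp
  finally have 1: "(\<Sum>i\<le>n. of_nat (n choose i) * (a i * b (Suc n - i)))
     = a 0 * b (Suc n) + (\<Sum>i\<le>n. of_nat (n choose Suc i) * (a (Suc i) * b (n - i)))" .
  have "(\<Sum>i\<le>Suc n. of_nat (Suc n choose i) * (a i * b (Suc n - i)))
     = a 0 * b (Suc n) + (\<Sum>i\<le>n. of_nat (Suc n choose Suc i) * (a (Suc i) * b (n - i)))"
    by (subst sum.atMost_Suc_shift) simp
  also have "\<dots> = a 0 * b (Suc n) + ((\<Sum>i\<le>n. of_nat (n choose i) * (a (Suc i) * b (n - i)))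
     + (\<Sum>i\<le>n. of_nat (n choose Suc i) * (a (Suc i) * b (n - i))))"
    by (simp add: distrib_right sum.distrib)
  finally show ?thesis unfolding 1 by (simp add: algebra_simps)
qed

lemma twisted_derivation_iterate_scale:
  fixes v :: "'k::real_normed_field ^ 'p::finite \<Rightarrow> 'k ^ 'q::finite"
  assumes S: "open S" and \<xi>: "\<And>i. smooth_on S (\<lambda>x. \<xi> x $ i)" and M: "\<And>j l. smooth_on S (\<lambda>x. M x $ j $ l)"
    and c: "smooth_on S c" and v: "\<And>j. smooth_on S (\<lambda>y. v y $ j)" and x: "x \<in> S"
  shows "(twisted_derivation \<xi> M ^^ n) (\<lambda>y. c y *s v y) x $ j
     = (\<Sum>i\<le>n. of_nat (n choose i) * ((directional \<xi> ^^ i) c x * (twisted_derivation \<xi> M ^^ (n - i)) v x $ j))"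
  using c v
proof (induction n arbitrary: c v)
  case (Suc n)
  let ?L = "twisted_derivation \<xi> M" and ?D = "directional \<xi>"
  have c': "smooth_on S (?D c)" by (intro smooth_on_directional S \<xi> Suc.prems)
  have v': "smooth_on S (\<lambda>y. ?L v y $ j)" for j by (intro smooth_on_twisted_derivation S \<xi> M Suc.prems)
  \<comment> \<open>The first application of \<open>L\<close> is expanded by the product rule; the sum over \<open>bool\<close> has its two terms.\<close>
  have "(?L ^^ Suc n) (\<lambda>y. c y *s v y) x = (?L ^^ n) (?L (\<lambda>y. c y *s v y)) x"
    by (simp add: funpow_swap1)
  also have "\<dots> = (?L ^^ n) (\<lambda>y. \<Sum>b\<in>UNIV. if b then ?D c y *s v y else c y *s ?L v y) x"
    by (rule twisted_derivation_iterate_cong[OF S _ x])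
      (simp add: UNIV_bool add.commute twisted_derivation_scale[OF _ Suc.prems])
  also have "\<dots> = (\<Sum>b\<in>UNIV. (?L ^^ n) (\<lambda>y. if b then ?D c y *s v y else c y *s ?L v y) x)"
  proof (rule twisted_derivation_iterate_sum[OF S \<xi> M _ x])
    show "smooth_on S (\<lambda>y. (if b then ?D c y *s v y else c y *s ?L v y) $ j)" for b j
      by (cases b) (simp_all add: smooth_on_mult S Suc.prems c' v')
  qed
  also have "\<dots> = (?L ^^ n) (\<lambda>y. ?D c y *s v y) x + (?L ^^ n) (\<lambda>y. c y *s ?L v y) x"
    by (simp add: UNIV_bool add.commute)
  finally have "(?L ^^ Suc n) (\<lambda>y. c y *s v y) x $ j
     = (?L ^^ n) (\<lambda>y. ?D c y *s v y) x $ j + (?L ^^ n) (\<lambda>y. c y *s ?L v y) x $ j"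
    by simp
  also have "(?L ^^ n) (\<lambda>y. ?D c y *s v y) x $ j
     = (\<Sum>i\<le>n. of_nat (n choose i) * ((?D ^^ Suc i) c x * (?L ^^ (n - i)) v x $ j))"
    using Suc.IH[OF c' Suc.prems(2)] by (simp add: funpow_swap1)
  also have "(?L ^^ n) (\<lambda>y. c y *s ?L v y) x $ j
     = (\<Sum>i\<le>n. of_nat (n choose i) * ((?D ^^ i) c x * (?L ^^ (Suc n - i)) v x $ j))"
    unfolding Suc.IH[OF Suc.prems(1) v']
    by (intro sum.cong refl) (simp add: Suc_diff_le funpow_swap1)
  finally show ?case
    unfolding binomial_sum_step[of n "\<lambda>i. (?D ^^ i) c x" "\<lambda>i. (?L ^^ i) v x $ j"] .
qed simp

text \<open>
  The product of the two sums contains all pairs \<open>(i, j)\<close> with \<open>i, j \<le> N\<close>, the Cauchy product only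
  those with \<open>i + j \<le> N\<close>; the terms in the difference vanish to order \<open>i + j > N\<close>.
\<close>

lemma vanishes_product_of_sums:
  assumes u: "\<And>i. u i \<in> vanishes i" and w: "\<And>i. w i \<in> vanishes i"
  shows "(\<lambda>x. (\<Sum>i\<le>N. u i x) * (\<Sum>i\<le>N. w i x) - (\<Sum>n\<le>N. \<Sum>i\<le>n. u i x * w (n - i) x)) \<in> vanishes (Suc N)"
proof -
  let ?A = "{..N} \<times> {..N}" and ?B = "{(i, j). i + j \<le> N}"
  have eq: "(\<Sum>i\<le>N. u i x) * (\<Sum>i\<le>N. w i x) - (\<Sum>n\<le>N. \<Sum>i\<le>n. u i x * w (n - i) x)
      = (\<Sum>p\<in>?A - ?B. u (fst p) x * w (snd p) x)" for x
  proof -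
    have "(\<Sum>n\<le>N. \<Sum>i\<le>n. u i x * w (n - i) x) = (\<Sum>p\<in>?B. u (fst p) x * w (snd p) x)"
      using sum.triangle_reindex_eq[of "\<lambda>i j. u i x * w j x" N] by (simp add: case_prod_beta)
    moreover have "(\<Sum>i\<le>N. u i x) * (\<Sum>i\<le>N. w i x) = (\<Sum>p\<in>?A. u (fst p) x * w (snd p) x)"
      by (simp add: sum_product sum.cartesian_product case_prod_beta)
    moreover have "?B \<subseteq> ?A" by auto
    ultimately show ?thesis by (simp add: sum_diff)
  qed
  have "(\<lambda>x. u (fst p) x * w (snd p) x) \<in> vanishes (Suc N)" if "p \<in> ?A - ?B" for p
    by (rule vanishes_mono[OF vanishes_mult[OF u w]]) (use that in auto)
  then show ?thesis unfolding eq by (rule vanishes_sum)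
qed

text \<open>
  Write \<open>L\<close> for the twisted derivation.  Up to terms of order above \<open>N\<close>, the exponential of \<open>L\<close> is the
  exponential of \<open>\<xi>\<close> followed by multiplication with the matrix that has the columns \<open>exp L e\<^sub>l\<close>: expand
  \<open>g\<close> as the sum of the \<open>g\<^sub>l e\<^sub>l\<close> and apply Leibniz' formula, in which the
  binomial coefficients divided by \<open>n!\<close> become the coefficients \<open>1 / (i! (n - i)!)\<close> of a product of
  exponentials.
\<close>

lemma exp_twisted_derivation:
  fixes g :: "'k::real_normed_field ^ 'p::finite \<Rightarrow> 'k ^ 'q::finite"
  assumes \<xi>: "\<And>i. (\<lambda>x. \<xi> x $ i) \<in> vanishes 2" and M: "\<And>j l. (\<lambda>x. M x $ j $ l) \<in> vanishes 1"
    and g: "\<And>j. (\<lambda>x. g x $ j) \<in> smooth_germs"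
  shows "(\<lambda>x. (\<Sum>l\<in>UNIV. (\<Sum>i\<le>N. (directional \<xi> ^^ i) (\<lambda>y. g y $ l) x / fact i)
              * (\<Sum>i\<le>N. (twisted_derivation \<xi> M ^^ i) (\<lambda>y. axis l 1) x $ j / fact i))
            - (\<Sum>n\<le>N. (twisted_derivation \<xi> M ^^ n) g x $ j / fact n)) \<in> vanishes (Suc N)"
proof -
  let ?L = "twisted_derivation \<xi> M" and ?D = "directional \<xi>"
  define u where "u l i x = (?D ^^ i) (\<lambda>y. g y $ l) x / fact i" for l i x
  define w where "w l i x = (?L ^^ i) (\<lambda>y. axis l 1) x $ j / fact i" for l i x
  obtain S where S: "open S" "0 \<in> S" "\<And>j. smooth_on S (\<lambda>x. g x $ j)"
    using smooth_germs_common[of UNIV "\<lambda>j x. g x $ j"] g by auto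
  obtain T where T: "open T" "0 \<in> T" "\<And>j. smooth_on T (\<lambda>x. \<xi> x $ j)"
    using smooth_germs_common[of UNIV "\<lambda>j x. \<xi> x $ j"] vanishes_smooth[OF \<xi>] by auto
  obtain R where R: "open R" "0 \<in> R" "\<And>p. smooth_on R (\<lambda>x. M x $ fst p $ snd p)"
    using smooth_germs_common[of UNIV "\<lambda>p x. M x $ fst p $ snd p"] vanishes_smooth[OF M] by auto
  define W where "W = S \<inter> T \<inter> R"
  have W: "open W" "0 \<in> W" using S T R by (auto simp: W_def)
  have gW: "smooth_on W (\<lambda>x. g x $ j)" for j using S(3) by (rule smooth_on_subset) (auto simp: W_def)
  have \<xi>W: "smooth_on W (\<lambda>x. \<xi> x $ j)" for j using T(3) by (rule smooth_on_subset) (auto simp: W_def)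
  have MW: "smooth_on W (\<lambda>x. M x $ i $ j)" for i j
    using R(3)[of "(i, j)"] by (intro smooth_on_subset[of R _ W]) (auto simp: W_def)
  have exp: "(?L ^^ n) g x $ j / fact n = (\<Sum>l\<in>UNIV. \<Sum>i\<le>n. u l i x * w l (n - i) x)" if x: "x \<in> W" for x n
  proof -
    have "(?L ^^ n) g x = (?L ^^ n) (\<lambda>y. \<Sum>l\<in>UNIV. g y $ l *s axis l 1) x"
      by (simp add: basis_expansion)
    also have "\<dots> = (\<Sum>l\<in>UNIV. (?L ^^ n) (\<lambda>y. g y $ l *s axis l 1) x)"
      by (rule twisted_derivation_iterate_sum[OF W(1) \<xi>W MW _ x])
        (simp add: smooth_on_mult W gW smooth_on_const)
    finally have "(?L ^^ n) g x $ j / fact n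
        = (\<Sum>l\<in>UNIV. \<Sum>i\<le>n. of_nat (n choose i) * ((?D ^^ i) (\<lambda>y. g y $ l) x * (?L ^^ (n - i)) (\<lambda>y. axis l 1) x $ j) / fact n)"
      by (simp add: twisted_derivation_iterate_scale[OF W(1) \<xi>W MW gW smooth_on_const x] sum_divide_distrib)
    also have "\<dots> = (\<Sum>l\<in>UNIV. \<Sum>i\<le>n. u l i x * w l (n - i) x)"
      by (intro sum.cong refl) (simp add: u_def w_def binomial_fact)
    finally show ?thesis .
  qed
  have "u l i \<in> vanishes i" for l i
    using vanishes_cmult[OF directional_iterate_vanishes[OF \<xi>, of "\<lambda>y. g y $ l" 0 i], of "inverse (fact i)"] g
    by (simp add: vanishes_0 u_def[abs_def] divide_inverse mult.commute)
  moreover have "w l i \<in> vanishes i" for l i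
    using vanishes_cmult[OF twisted_derivation_iterate_vanishes[OF \<xi> M, of "\<lambda>y. axis l 1" 0 i j], of "inverse (fact i)"]
    by (simp add: vanishes_0 smooth_germs_const w_def[abs_def] divide_inverse mult.commute)
  ultimately have "(\<lambda>x. \<Sum>l\<in>UNIV. (\<Sum>i\<le>N. u l i x) * (\<Sum>i\<le>N. w l i x)
      - (\<Sum>n\<le>N. \<Sum>i\<le>n. u l i x * w l (n - i) x)) \<in> vanishes (Suc N)"
    by (intro vanishes_sum vanishes_product_of_sums)
  moreover have "germ_eq (\<lambda>x. (\<Sum>l\<in>UNIV. (\<Sum>i\<le>N. u l i x) * (\<Sum>i\<le>N. w l i x))
      - (\<Sum>n\<le>N. (?L ^^ n) g x $ j / fact n))
     (\<lambda>x. \<Sum>l\<in>UNIV. (\<Sum>i\<le>N. u l i x) * (\<Sum>i\<le>N. w l i x) - (\<Sum>n\<le>N. \<Sum>i\<le>n. u l i x * w l (n - i) x))"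
  proof (rule germ_eqI[OF W])
    fix x assume x: "x \<in> W"
    have "(\<Sum>n\<le>N. (?L ^^ n) g x $ j / fact n) = (\<Sum>l\<in>UNIV. \<Sum>n\<le>N. \<Sum>i\<le>n. u l i x * w l (n - i) x)"
      unfolding exp[OF x] by (rule sum.swap)
    then show "(\<Sum>l\<in>UNIV. (\<Sum>i\<le>N. u l i x) * (\<Sum>i\<le>N. w l i x)) - (\<Sum>n\<le>N. (?L ^^ n) g x $ j / fact n)
      = (\<Sum>l\<in>UNIV. (\<Sum>i\<le>N. u l i x) * (\<Sum>i\<le>N. w l i x) - (\<Sum>n\<le>N. \<Sum>i\<le>n. u l i x * w l (n - i) x))"
      by (simp add: sum_subtractf)
  qed
  ultimately show ?thesis using vanishes_cong by (auto simp: u_def w_def)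
qed

section \<open>Flows\<close>

lemma time_space_nth [simp]: "time_space t x $ None = t" "time_space t x $ Some i = x $ i"
  by (simp_all add: time_space_def)

lemma time_space_collapse: "time_space (z $ None) (\<chi> i. z $ Some i) = z"
  by (auto simp: vec_eq_iff time_space_def split: option.split)

lemma time_space_shift:
  "time_space t x + s *s axis None 1 = time_space (t + s) (x::'k::real_normed_field ^ 'p::finite)"
  "time_space t x + s *s axis (Some i) 1 = time_space t (x + s *s axis i 1)"
  by (auto simp: vec_eq_iff axis_def time_space_def split: option.split)

text \<open>
  The map that fixes the time carries coordinate lines to coordinate lines, so derivatives in the
  position can be taken in space and time.
\<close>

lemma partials_time_slice:
  "partials is (\<lambda>x. F (time_space t x)) x = partials (map Some is) F (time_space t x)"
proof (induction "is" arbitrary: x)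
  case (Cons i "is")
  then have "partials is (\<lambda>x. F (time_space t x)) = (\<lambda>x. partials (map Some is) F (time_space t x))" by blast
  then show ?case by (simp add: partial_def time_space_shift)
qed simp

lemma eventually_time_space:
  fixes U :: "('k::real_normed_field ^ 'p::finite option) set"
  assumes "open U" "time_space t 0 \<in> U"
  obtains S where "open S" "0 \<in> S" "\<And>x. x \<in> S \<Longrightarrow> time_space t x \<in> U"
proof -
  have "continuous_on UNIV (\<lambda>x::'k ^ 'p. time_space t x $ s)" for s
    by (cases s) (simp_all add: continuous_on_component)
  then have "continuous_on UNIV (\<lambda>x::'k ^ 'p. time_space t x)" by (rule continuous_on_vec)
  then have "open ((\<lambda>x. time_space t x) -` U)" using assms(1) by (simp add: open_vimage)
  then show ?thesis using assms(2) by (intro that[of "(\<lambda>x. time_space t x) -` U"]) auto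
qed

text \<open>
  The flow as a map of space and time; this is the form in which its smoothness is given.
\<close>

definition flow_map :: "('k \<Rightarrow> 'k ^ 'p::finite \<Rightarrow> 'k ^ 'p) \<Rightarrow> 'k ^ ('p option) \<Rightarrow> 'k ^ 'p" where
  "flow_map \<Phi> z = \<Phi> (z $ None) (\<chi> i. z $ Some i)"

lemma flow_map_time_space [simp]: "flow_map \<Phi> (time_space t x) = \<Phi> t x"
  by (simp add: flow_map_def)

lemma flow_ofE:
  fixes \<xi> :: "'k::real_normed_field ^ 'p::finite \<Rightarrow> 'k ^ 'p"
  assumes "flow_of \<xi> \<Phi>"
  obtains U where "open U" "\<And>t. time_space t 0 \<in> U" "\<And>j. smooth_on U (\<lambda>z. flow_map \<Phi> z $ j)"
    "germ_eq (\<Phi> 0) id"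
    "\<And>z j. z \<in> U \<Longrightarrow> partial None (\<lambda>z. flow_map \<Phi> z $ j) z = \<xi> (flow_map \<Phi> z) $ j"
proof -
  obtain U where U: "open U" "\<And>t. time_space t 0 \<in> U" "\<And>j. smooth_on U (\<lambda>z. flow_map \<Phi> z $ j)"
    "\<And>x. time_space 0 x \<in> U \<Longrightarrow> \<Phi> 0 x = x"
    "\<And>t x j. time_space t x \<in> U \<Longrightarrow> ((\<lambda>s. \<Phi> s x $ j) has_field_derivative \<xi> (\<Phi> t x) $ j) (at t)"
    using assms unfolding flow_of_def flow_map_def by blast
  obtain S where "open S" "0 \<in> S" "\<And>x. x \<in> S \<Longrightarrow> time_space 0 x \<in> U"
    using U(1,2) by (rule eventually_time_space) blast
  then have id: "germ_eq (\<Phi> 0) id" using U(4) by (intro germ_eqI[of S]) auto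
  have "partial None (\<lambda>z. flow_map \<Phi> z $ j) z = \<xi> (flow_map \<Phi> z) $ j" if z: "z \<in> U" for z j
  proof -
    obtain t x where tx: "z = time_space t x" by (metis time_space_collapse)
    have "((\<lambda>s. \<Phi> (t + s) x $ j) has_field_derivative \<xi> (\<Phi> t x) $ j) (at 0)"
      using U(5)[of t x j] z tx DERIV_shift[of "\<lambda>s. \<Phi> s x $ j" _ 0 t] by (simp add: add.commute)
    then have "has_partial None (\<lambda>z. flow_map \<Phi> z $ j) (\<xi> (\<Phi> t x) $ j) z"
      by (simp add: has_partial_def tx time_space_shift)
    then show ?thesis unfolding tx by (simp add: has_partial_imp_eq)
  qed
  then show ?thesis using U(1-3) id by (intro that[of U])
qed

text \<open>
  Derivatives in the time and in the position commute.
\<close>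

lemma time_derivative_of_partials:
  fixes F :: "'k::real_normed_field ^ 'p::finite option \<Rightarrow> 'k"
  assumes U: "open U" "time_space t 0 \<in> U" and F: "smooth_on U F"
  shows "((\<lambda>s. partials is (\<lambda>x. F (time_space s x)) 0) has_field_derivative
           partials is (\<lambda>x. partial None F (time_space t x)) 0) (at t)"
proof -
  have "has_partial None (partials (map Some is) F) (partial None (partials (map Some is) F) (time_space t 0)) (time_space t 0)"
    by (rule smooth_on_has_partial[OF smooth_on_partials[OF F] U(2)])
  then have "((\<lambda>s. partials (map Some is) F (time_space (t + s) 0)) has_field_derivative
      partials (map Some is) (partial None F) (time_space t 0)) (at 0)"
    by (simp add: has_partial_def time_space_shift partial_partials_commute[OF U(1) F U(2)])
  then show ?thesis
    using DERIV_shift[of "\<lambda>s. partials (map Some is) F (time_space s 0)" _ 0 t]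
    by (simp add: partials_time_slice add.commute)
qed

lemma jet_1_id:
  fixes f :: "'k::real_normed_field ^ 'p::finite \<Rightarrow> 'k ^ 'p"
  shows "jet 1 f = id \<longleftrightarrow> f 0 = 0 \<and> (\<forall>i j. partial i (\<lambda>x. f x $ j) 0 = (if i = j then 1 else 0))"
proof -
  have t: "jet 1 f x $ j = f 0 $ j + (\<Sum>i\<in>UNIV. x $ i * partial i (\<lambda>x. f x $ j) 0)" for x j
    unfolding jet_eq_taylor taylor_def by (simp add: taylor_part_0 taylor_part_Suc)
  show ?thesis
  proof
    assume id: "jet 1 f = id"
    have f0: "f 0 $ j = 0" for j using t[of 0 j] unfolding id by simp
    have "partial i (\<lambda>x. f x $ j) 0 = axis i 1 $ j" for i j
      using t[of "axis i 1" j] unfolding id by (simp add: f0 axis_def if_distrib[where f = "\<lambda>u. u * _"] cong: if_cong)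
    then show "f 0 = 0 \<and> (\<forall>i j. partial i (\<lambda>x. f x $ j) 0 = (if i = j then 1 else 0))"
      using f0 by (auto simp: vec_eq_iff axis_def)
  next
    assume "f 0 = 0 \<and> (\<forall>i j. partial i (\<lambda>x. f x $ j) 0 = (if i = j then 1 else 0))"
    then have "jet 1 f x $ j = x $ j" for x j
      unfolding t by (simp add: if_distrib[where f = "\<lambda>u. _ * u"] cong: if_cong)
    then show "jet 1 f = id" by (auto simp: vec_eq_iff fun_eq_iff)
  qed
qed

text \<open>
  The field is the time derivative of the flow at time 0.  The 1-jet of the flow is constant in time,
  hence the 1-jet of the field is zero.
\<close>

lemma flow_field_vanishes:
  fixes \<xi> :: "'k::real_normed_field ^ 'p::finite \<Rightarrow> 'k ^ 'p"
  assumes \<xi>: "\<xi> \<in> theta" and flow: "flow_of \<xi> \<Phi>" and jet: "\<And>t. jet 1 (\<Phi> t) = id"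
  shows "(\<lambda>x. \<xi> x $ j) \<in> vanishes 2"
proof -
  obtain U where U: "open U" "\<And>t. time_space t 0 \<in> U" "\<And>j. smooth_on U (\<lambda>z. flow_map \<Phi> z $ j)"
    "germ_eq (\<Phi> 0) id"
    "\<And>z j. z \<in> U \<Longrightarrow> partial None (\<lambda>z. flow_map \<Phi> z $ j) z = \<xi> (flow_map \<Phi> z) $ j"
    using flow by (rule flow_ofE) blast
  obtain S where S: "open S" "0 \<in> S" "\<And>x. x \<in> S \<Longrightarrow> time_space 0 x \<in> U"
    using U(1,2) by (rule eventually_time_space) blast
  obtain R where R: "open R" "0 \<in> R" "\<And>x. x \<in> R \<Longrightarrow> \<Phi> 0 x = id x" using U(4) by (rule germ_eqE) blast
  have eq: "germ_eq (\<lambda>x. \<xi> x $ j) (\<lambda>x. partial None (\<lambda>z. flow_map \<Phi> z $ j) (time_space 0 x))"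
    using S R U(5) by (intro germ_eqI[of "S \<inter> R"]) auto
  have "partials is (\<lambda>x. \<xi> x $ j) 0 = 0" if "length is < 2" for "is"
  proof -
    have "partials is (\<lambda>x. \<Phi> s x $ j) 0 = partials is (\<lambda>x. \<Phi> 0 x $ j) 0" for s
    proof (cases "is")
      case Nil
      then show ?thesis using jet_1_id jet by (metis partials.simps(1))
    next
      case (Cons i js)
      then have "is = [i]" using that by simp
      then show ?thesis using jet_1_id[of "\<Phi> s"] jet_1_id[of "\<Phi> 0"] jet by simp
    qed
    then have const: "(\<lambda>s. partials is (\<lambda>x. \<Phi> s x $ j) 0) = (\<lambda>s. partials is (\<lambda>x. \<Phi> 0 x $ j) 0)" by blast
    have "((\<lambda>s. partials is (\<lambda>x. \<Phi> s x $ j) 0) has_field_derivative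
        partials is (\<lambda>x. partial None (\<lambda>z. flow_map \<Phi> z $ j) (time_space 0 x)) 0) (at 0)"
      using time_derivative_of_partials[OF U(1,2,3)] by simp
    then have "partials is (\<lambda>x. partial None (\<lambda>z. flow_map \<Phi> z $ j) (time_space 0 x)) 0 = 0"
      unfolding const using DERIV_unique DERIV_const by blast
    then show ?thesis using partials_germ_cong[OF eq] by simp
  qed
  then show ?thesis using \<xi> by (simp add: vanishes_def theta_def)
qed

text \<open>
  Repeated integration from 0; two functions of a variable in the field that have equal derivatives
  differ by a constant.
\<close>

lemma derivative_chain_polynomial:
  fixes c :: "nat \<Rightarrow> 'k::real_normed_field \<Rightarrow> 'k"
  assumes "\<And>n t. (c n has_field_derivative c (Suc n) t) (at t)" and "\<And>t. c (Suc N) t = 0"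
  shows "c 0 t = (\<Sum>n\<le>N. c n 0 * t ^ n / fact n)"
  using assms
proof (induction N arbitrary: c t)
  case 0
  have "\<exists>a. \<forall>t\<in>UNIV. c 0 t = a"
    using 0(1)[of 0] 0(2) by (intro has_field_derivative_zero_constant) auto
  then show ?case by auto
next
  case (Suc N)
  define e where "e t = (\<Sum>n\<le>Suc N. c n 0 * t ^ n / fact n)" for t
  have e: "e t = c 0 0 + (\<Sum>n\<le>N. c (Suc n) 0 * t ^ Suc n / fact (Suc n))" for t
    unfolding e_def by (subst sum.atMost_Suc_shift) simp
  have IH: "c (Suc 0) t = (\<Sum>n\<le>N. c (Suc n) 0 * t ^ n / fact n)" for t
    using Suc.IH[of "\<lambda>n. c (Suc n)"] Suc.prems by simp
  have summand: "((\<lambda>t. c (Suc n) 0 * t ^ Suc n / fact (Suc n)) has_field_derivative c (Suc n) 0 * t ^ n / fact n) (at t)" for n t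
  proof -
    have "((\<lambda>t. c (Suc n) 0 * t ^ Suc n / fact (Suc n)) has_field_derivative
        c (Suc n) 0 * (of_nat (Suc n) * (1 * t ^ (Suc n - Suc 0))) / fact (Suc n)) (at t)"
      by (intro DERIV_cdivide DERIV_cmult DERIV_power DERIV_ident)
    then show ?thesis by (simp del: of_nat_Suc)
  qed
  have "(e has_field_derivative 0 + (\<Sum>n\<le>N. c (Suc n) 0 * t ^ n / fact n)) (at t)" for t
    unfolding e[abs_def] by (intro DERIV_add DERIV_const DERIV_sum summand)
  then have "((\<lambda>t. c 0 t - e t) has_field_derivative 0) (at t)" for t
    using DERIV_diff[OF Suc.prems(1)[of 0 t]] IH[of t] by fastforce
  then have "\<exists>a. \<forall>t\<in>UNIV. c 0 t - e t = a"
    by (intro has_field_derivative_zero_constant) auto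
  then have "c 0 t - e t = c 0 0 - e 0" by auto
  then show ?case unfolding e_def[symmetric] using e[of 0] by simp
qed

text \<open>
  The Taylor expansion of \<open>g \<circ> \<Phi>\<^sub>t\<close> in the time \<open>t\<close>, in which the remainder is of higher order in the position.
  Let \<open>c\<^sub>n(t)\<close> be a fixed derivative of order at most \<open>N\<close>, in the position and at 0, of
  \<open>\<xi>\<^sup>n(g) \<circ> \<Phi>\<^sub>t\<close>.  The flow equation says that \<open>c\<^sub>n\<close> has the derivative \<open>c\<^sub>n\<^sub>+\<^sub>1\<close>, and \<open>c\<^sub>n = 0\<close> for \<open>n > N\<close>
  because \<open>\<xi>\<^sup>n(g)\<close> vanishes to order \<open>n\<close>.  So \<open>c\<^sub>0\<close> is a polynomial in \<open>t\<close>.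
\<close>

lemma flow_taylor:
  fixes \<xi> :: "'k::real_normed_field ^ 'p::finite \<Rightarrow> 'k ^ 'p"
  assumes \<xi>: "\<xi> \<in> theta" and flow: "flow_of \<xi> \<Phi>" and jet: "\<And>t. jet 1 (\<Phi> t) = id"
    and \<Phi>: "\<And>t. \<Phi> t \<in> map_germs" and g: "g \<in> smooth_germs"
  shows "(\<lambda>x. g (\<Phi> 1 x) - (\<Sum>n\<le>N. (directional \<xi> ^^ n) g x / fact n)) \<in> vanishes (Suc N)"
proof -
  have \<xi>2: "(\<lambda>x. \<xi> x $ j) \<in> vanishes 2" for j using \<xi> flow jet by (rule flow_field_vanishes)
  obtain U where U: "open U" "\<And>t. time_space t 0 \<in> U" "\<And>j. smooth_on U (\<lambda>z. flow_map \<Phi> z $ j)"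
    "germ_eq (\<Phi> 0) id"
    "\<And>z j. z \<in> U \<Longrightarrow> partial None (\<lambda>z. flow_map \<Phi> z $ j) z = \<xi> (flow_map \<Phi> z) $ j"
    using flow by (rule flow_ofE) blast
  have \<Phi>0: "\<Phi> t 0 = 0" and \<Phi>s: "(\<lambda>x. \<Phi> t x $ j) \<in> smooth_germs" for t j
    using \<Phi> by (auto simp: map_germs_def theta_def)
  obtain S where S: "open S" "0 \<in> S" "\<And>j. smooth_on S (\<lambda>x. \<xi> x $ j)" "smooth_on S g"
  proof -
    obtain T where T: "open T" "0 \<in> T" "\<And>j. smooth_on T (\<lambda>x. \<xi> x $ j)"
      using smooth_germs_common[of UNIV "\<lambda>j x. \<xi> x $ j"] vanishes_smooth[OF \<xi>2] by auto
    obtain R where "open R" "0 \<in> R" "smooth_on R g" using g by (rule smooth_germsE)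
    then show ?thesis using T by (intro that[of "T \<inter> R"]) (auto intro: smooth_on_subset)
  qed
  define D where "D n = (directional \<xi> ^^ n) g" for n
  have DS: "smooth_on S (D n)" for n unfolding D_def by (intro smooth_on_directional_iterate S)
  have Dg: "D n \<in> smooth_germs" for n using S(1,2) DS by (rule smooth_germsI)
  have Dv: "D n \<in> vanishes n" for n
    using directional_iterate_vanishes[OF \<xi>2, of g 0 n] g by (simp add: vanishes_0 D_def)
  \<comment> \<open>The part of space and time that the flow carries into \<open>S\<close>; it contains the whole time axis.\<close>
  define W where "W = U \<inter> flow_map \<Phi> -` S"
  have "continuous_on U (flow_map \<Phi>)" by (rule continuous_on_vec) (rule smooth_on_continuous[OF U(3)])
  then have W: "open W" "\<And>t. time_space t 0 \<in> W"
    unfolding W_def using U(1,2) S(1,2) by (auto simp: continuous_open_preimage \<Phi>0)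
  have fW: "smooth_on W (\<lambda>z. flow_map \<Phi> z $ j)" for j
    using U(3) by (rule smooth_on_subset) (auto simp: W_def)
  have inS: "flow_map \<Phi> z \<in> S" if "z \<in> W" for z using that by (simp add: W_def)
  define F where "F n z = D n (flow_map \<Phi> z)" for n z
  have F: "smooth_on W (F n)" for n
    unfolding F_def[abs_def] by (rule smooth_on_compose[OF W(1) S(1) inS DS fW])
  have F': "partial None (F n) z = F (Suc n) z" if z: "z \<in> W" for n z
  proof -
    have "partial None (F n) z = (\<Sum>j\<in>UNIV. partial j (D n) (flow_map \<Phi> z) * partial None (\<lambda>z. flow_map \<Phi> z $ j) z)"
      unfolding F_def[abs_def] by (rule partial_compose[OF S(1) DS inS[OF z] fW z])
    also have "\<dots> = F (Suc n) z"
      using z U(5) by (simp add: F_def D_def W_def directional_def)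
    finally show ?thesis .
  qed
  define c where "c is n t = partials is (\<lambda>x. F n (time_space t x)) 0" for "is" n t
  have c': "(c is n has_field_derivative c is (Suc n) t) (at t)" for "is" n t
  proof -
    have "partials (map Some is) (partial None (F n)) (time_space t 0) = partials (map Some is) (F (Suc n)) (time_space t 0)"
      using W F' by (rule partials_cong)
    then show ?thesis
      using time_derivative_of_partials[OF W(1) W(2)[of t] F[of n], of "is"] by (simp add: c_def[abs_def] partials_time_slice)
  qed
  have c0: "c is n t = 0" if "length is < n" for "is" n t
    using vanishes_compose[OF \<Phi>s[where t = t] \<Phi>0[where t = t] Dv[of n]] that by (simp add: vanishes_def c_def F_def)
  have c1: "c is n 0 = partials is (D n) 0" for "is" n
  proof -
    have "germ_eq (\<lambda>x. D n (\<Phi> 0 x)) (D n)" using U(4) by (auto elim!: germ_eqE intro: germ_eqI)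
    then show ?thesis unfolding c_def F_def flow_map_time_space by (rule partials_germ_cong)
  qed
  have g1: "(\<lambda>x. g (\<Phi> 1 x)) \<in> smooth_germs" using g \<Phi>s \<Phi>0 by (rule smooth_germs_comp)
  have Df: "(\<lambda>x. inverse (fact n) * D n x) \<in> smooth_germs" for n
    by (intro smooth_germs_mult smooth_germs_const Dg)
  have "partials is (\<lambda>x. g (\<Phi> 1 x) - (\<Sum>n\<le>N. D n x / fact n)) 0 = 0" if "length is < Suc N" for "is"
  proof -
    have "partials is (\<lambda>x. g (\<Phi> 1 x)) 0 = c is 0 1" by (simp add: c_def F_def D_def)
    also have "\<dots> = (\<Sum>n\<le>N. partials is (D n) 0 / fact n)"
      using derivative_chain_polynomial[of "c is" N 1, OF c'] c0[of "is" "Suc N"] that by (simp add: c1)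
    finally have 1: "partials is (\<lambda>x. g (\<Phi> 1 x)) 0 = (\<Sum>n\<le>N. partials is (D n) 0 / fact n)" .
    have 2: "partials is (\<lambda>x. \<Sum>n\<le>N. inverse (fact n) * D n x) 0 = (\<Sum>n\<le>N. partials is (D n) 0 / fact n)"
      by (simp only: partials_sum[OF Df] partials_cmult[OF Dg]) (simp add: divide_inverse mult.commute)
    have "partials is (\<lambda>x. g (\<Phi> 1 x) + - 1 * (\<Sum>n\<le>N. inverse (fact n) * D n x)) 0
       = partials is (\<lambda>x. g (\<Phi> 1 x)) 0 + - 1 * partials is (\<lambda>x. \<Sum>n\<le>N. inverse (fact n) * D n x) 0"
      by (subst partials_add[OF g1], intro smooth_germs_mult smooth_germs_const smooth_germs_sum Df)
        (subst partials_cmult, auto intro: smooth_germs_sum Df)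
    then show ?thesis unfolding 1 2 by (simp add: divide_inverse mult.commute)
  qed
  moreover have "(\<lambda>x. g (\<Phi> 1 x) - (\<Sum>n\<le>N. D n x / fact n)) \<in> smooth_germs"
    using smooth_germs_diff[OF g1 smooth_germs_sum[where A = "{..N}", OF Df]] by (simp add: divide_inverse mult.commute)
  ultimately show ?thesis by (simp add: vanishes_def D_def)
qed

section \<open>Contact equivalences that are linear in the fibre\<close>

text \<open>
  Cramer's formula shows that the solution of a linear system depends smoothly on the system.
\<close>

definition cramer_solution :: "'k::field ^ 'q::finite ^ 'q \<Rightarrow> 'k ^ 'q \<Rightarrow> 'k ^ 'q" where
  "cramer_solution A b = (\<chi> k. det (\<chi> i j. if j = k then b $ i else A $ i $ j) / det A)"

lemma cramer_solution: "det A \<noteq> 0 \<Longrightarrow> A *v x = b \<longleftrightarrow> x = cramer_solution A b"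
  unfolding cramer_solution_def by (rule cramer)

lemma smooth_germs_cramer_solution:
  fixes A :: "'k::real_normed_field ^ 'p::finite \<Rightarrow> 'k ^ 'q::finite ^ 'q"
  assumes A: "\<And>i j. (\<lambda>x. A x $ i $ j) \<in> smooth_germs" and b: "\<And>i. (\<lambda>x. b x $ i) \<in> smooth_germs"
    and det: "det (A 0) \<noteq> 0"
  shows "(\<lambda>x. cramer_solution (A x) (b x) $ k) \<in> smooth_germs"
proof -
  have "(\<lambda>x. det (\<chi> i j. if j = k then b x $ i else A x $ i $ j)) \<in> smooth_germs"
  proof (rule smooth_germs_det)
    show "(\<lambda>x. (\<chi> i j. if j = k then b x $ i else A x $ i $ j) $ i $ j) \<in> smooth_germs" for i j
      by (cases "j = k") (simp_all add: A b)
  qed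
  then have "(\<lambda>x. det (\<chi> i j. if j = k then b x $ i else A x $ i $ j) * inverse (det (A x))) \<in> smooth_germs"
    by (rule smooth_germs_mult) (intro smooth_germs_inverse smooth_germs_det A det)
  then show ?thesis by (simp add: cramer_solution_def divide_inverse)
qed

lemma join_nth [simp]: "join x y $ Inl i = x $ i" "join x y $ Inr j = y $ j"
  by (simp_all add: join_def)

definition base_part :: "'k ^ ('p::finite + 'q::finite) \<Rightarrow> 'k ^ 'p" where
  "base_part z = (\<chi> i. z $ Inl i)"

definition fibre_part :: "'k ^ ('p::finite + 'q::finite) \<Rightarrow> 'k ^ 'q" where
  "fibre_part z = (\<chi> j. z $ Inr j)"

lemma parts_join [simp]: "base_part (join x y) = x" "fibre_part (join x y) = y"
  by (simp_all add: base_part_def fibre_part_def vec_eq_iff)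

lemma join_parts: "join (base_part z) (fibre_part z) = z"
proof -
  have "join (base_part z) (fibre_part z) $ s = z $ s" for s
    by (cases s) (simp_all add: base_part_def fibre_part_def)
  then show ?thesis by (simp add: vec_eq_iff)
qed

lemma join_eq_iff: "z = join x y \<longleftrightarrow> base_part z = x \<and> fibre_part z = y"
  using join_parts parts_join by metis

lemma parts_0 [simp]: "base_part 0 = 0" "fibre_part 0 = 0"
  by (simp_all add: base_part_def fibre_part_def vec_eq_iff)

lemma join_0: "join 0 0 = 0"
  using join_parts[of 0] by simp

lemma mem_zero_section: "z \<in> zero_section \<longleftrightarrow> fibre_part z = 0"
  by (auto simp: zero_section_def image_iff join_eq_iff)

lemma mem_graph_of: "z \<in> graph_of f \<longleftrightarrow> fibre_part z = f (base_part z)"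
  by (auto simp: graph_of_def image_iff join_eq_iff)

lemma smooth_germs_base_part: "(\<lambda>z. base_part z $ i) \<in> smooth_germs"
  by (simp add: base_part_def smooth_germs_coord)

lemma smooth_germs_fibre_part: "(\<lambda>z. fibre_part z $ i) \<in> smooth_germs"
  by (simp add: fibre_part_def smooth_germs_coord)

lemma join_smooth_germs:
  assumes "\<And>i. (\<lambda>z. a z $ i) \<in> smooth_germs" "\<And>j. (\<lambda>z. b z $ j) \<in> smooth_germs"
  shows "(\<lambda>z. join (a z) (b z) $ s) \<in> smooth_germs"
  using assms by (cases s) simp_all

text \<open>
  By the chain rule the two Jacobian matrices at 0 are inverse to each other.
\<close>

lemma jet_1_inverse:
  fixes \<phi> \<psi> :: "'k::real_normed_field ^ 'p::finite \<Rightarrow> 'k ^ 'p"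
  assumes \<phi>: "\<phi> \<in> map_germs" and \<psi>: "\<psi> \<in> map_germs" and inv: "germ_eq (\<phi> \<circ> \<psi>) id" and jet: "jet 1 \<phi> = id"
  shows "jet 1 \<psi> = id"
proof -
  have s: "(\<lambda>x. \<phi> x $ j) \<in> smooth_germs" "(\<lambda>x. \<psi> x $ j) \<in> smooth_germs" and z: "\<psi> 0 = 0" for j
    using \<phi> \<psi> by (auto simp: map_germs_def theta_def)
  have "partial i (\<lambda>x. \<psi> x $ l) 0 = (if i = l then 1 else 0)" for i l
  proof -
    obtain S T where ST: "open S" "0 \<in> S" "smooth_on S (\<lambda>x. \<phi> x $ l)" "open T" "0 \<in> T"
      "\<And>j. smooth_on T (\<lambda>x. \<psi> x $ j)"
      by (rule smooth_germs_compose_nbhd[OF s(1) s(2) z]) (rule that; assumption)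
    have "germ_eq (\<lambda>x. \<phi> (\<psi> x) $ l) (\<lambda>x. x $ l)"
      using inv by (auto simp: germ_eq_def elim: eventually_mono)
    then have "partial i (\<lambda>x. \<phi> (\<psi> x) $ l) 0 = partial i (\<lambda>x. x $ l) 0"
      using partials_germ_cong[of _ _ "[i]"] by simp
    also have "\<dots> = (if i = l then 1 else 0)" by (rule partial_coord)
    also have "partial i (\<lambda>x. \<phi> (\<psi> x) $ l) 0 = (\<Sum>j\<in>UNIV. partial j (\<lambda>x. \<phi> x $ l) (\<psi> 0) * partial i (\<lambda>x. \<psi> x $ j) 0)"
      using ST z by (intro partial_compose[where T = S and S = T]) auto
    also have "\<dots> = partial i (\<lambda>x. \<psi> x $ l) 0"
      using jet unfolding jet_1_id
      by (simp add: z if_distrib[where f = "\<lambda>u. u * _"] cong: if_cong)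
    finally show ?thesis .
  qed
  then show ?thesis using z unfolding jet_1_id by simp
qed

text \<open>
  If \<open>\<psi>\<close> is the inverse of \<open>\<phi>\<close>, then \<open>\<Psi>(x, y) = (\<psi>(x), A(\<psi>(x)) y)\<close> maps \<open>(x, g(x))\<close> to the
  point of the new graph over \<open>\<psi>(x)\<close>.  Its inverse is \<open>(x, y) \<mapsto> (\<phi>(x), A(x)\<^sup>-\<^sup>1 y)\<close>.
\<close>

lemma VK1_equiv_linear_fibre:
  fixes A :: "'k::real_normed_field ^ 'p::finite \<Rightarrow> 'k ^ 'q::finite ^ 'q"
  assumes \<phi>: "diffeo_germ \<phi>" and V: "maps_germ \<phi> V V" and jet: "jet 1 \<phi> = id"
    and A: "\<And>i j. (\<lambda>x. A x $ i $ j) \<in> smooth_germs" and det: "det (A 0) \<noteq> 0"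
  shows "VK1_equiv V g (\<lambda>x. A x *v g (\<phi> x))"
proof -
  obtain \<psi> where \<psi>: "\<psi> \<in> map_germs" "germ_eq (\<psi> \<circ> \<phi>) id" "germ_eq (\<phi> \<circ> \<psi>) id" and \<phi>m: "\<phi> \<in> map_germs"
    using \<phi> by (auto simp: diffeo_germ_def)
  have \<phi>s: "(\<lambda>x. \<phi> x $ j) \<in> smooth_germs" and \<phi>0: "\<phi> 0 = 0" for j
    using \<phi>m by (auto simp: map_germs_def theta_def)
  have \<psi>s: "(\<lambda>x. \<psi> x $ j) \<in> smooth_germs" and \<psi>0: "\<psi> 0 = 0" for j
    using \<psi> by (auto simp: map_germs_def theta_def)
  have \<psi>bs: "(\<lambda>z. \<psi> (base_part z) $ j) \<in> smooth_germs" for j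
    by (rule smooth_germs_comp[OF \<psi>s smooth_germs_base_part]) simp
  have \<phi>bs: "(\<lambda>z. \<phi> (base_part z) $ j) \<in> smooth_germs" for j
    by (rule smooth_germs_comp[OF \<phi>s smooth_germs_base_part]) simp
  have A\<psi>s: "(\<lambda>z. A (\<psi> (base_part z)) $ i $ j) \<in> smooth_germs" for i j
    by (rule smooth_germs_comp[OF A \<psi>bs]) (simp add: \<psi>0)
  have Abs: "(\<lambda>z. A (base_part z) $ i $ j) \<in> smooth_germs" for i j
    by (rule smooth_germs_comp[OF A smooth_germs_base_part]) simp
  define \<Psi> where "\<Psi> z = join (\<psi> (base_part z)) (A (\<psi> (base_part z)) *v fibre_part z)" for z
  define \<Psi>' where "\<Psi>' z = join (\<phi> (base_part z)) (cramer_solution (A (base_part z)) (fibre_part z))" for z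
  have "\<forall>\<^sub>F x in nhds 0. det (A x) \<noteq> 0"
    by (rule eventually_nonzero_germ[OF smooth_germs_det[OF A] det]) (auto simp: eventually_nhds)
  then have d1: "\<forall>\<^sub>F z in nhds 0. det (A (\<psi> (base_part z))) \<noteq> 0"
    and d2: "\<forall>\<^sub>F z in nhds 0. det (A (base_part z)) \<noteq> 0"
    using eventually_map_germ[OF \<psi>bs, where P = "\<lambda>x. det (A x) \<noteq> 0"] \<psi>0
      eventually_map_germ[OF smooth_germs_base_part, where P = "\<lambda>x. det (A x) \<noteq> 0"] by auto
  have i1: "\<forall>\<^sub>F z in nhds 0. \<phi> (\<psi> (base_part z)) = base_part z"
    using eventually_map_germ[OF smooth_germs_base_part, where P = "\<lambda>x. \<phi> (\<psi> x) = x"] \<psi>(3)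
    by (simp add: germ_eq_def)
  have i2: "\<forall>\<^sub>F z in nhds 0. \<psi> (\<phi> (base_part z)) = base_part z"
    using eventually_map_germ[OF smooth_germs_base_part, where P = "\<lambda>x. \<psi> (\<phi> x) = x"] \<psi>(2)
    by (simp add: germ_eq_def)
  have "\<Psi> \<in> map_germs"
  proof -
    have "(\<lambda>z. (A (\<psi> (base_part z)) *v fibre_part z) $ j) \<in> smooth_germs" for j
      unfolding matrix_vector_mult_def
      by (simp, intro smooth_germs_sum smooth_germs_mult A\<psi>s smooth_germs_fibre_part)
    then have "(\<lambda>z. \<Psi> z $ s) \<in> smooth_germs" for s
      unfolding \<Psi>_def by (intro join_smooth_germs \<psi>bs)
    moreover have "\<Psi> 0 = 0" by (simp add: \<Psi>_def \<psi>0 join_0)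
    ultimately show ?thesis by (simp add: map_germs_def theta_def)
  qed
  moreover have "\<Psi>' \<in> map_germs"
  proof -
    have "(\<lambda>z. \<Psi>' z $ s) \<in> smooth_germs" for s
      unfolding \<Psi>'_def
      by (intro join_smooth_germs \<phi>bs smooth_germs_cramer_solution Abs smooth_germs_fibre_part) (simp add: det)
    moreover have "\<Psi>' 0 = 0"
      using cramer_solution[OF det, of 0 0] by (simp add: \<Psi>'_def \<phi>0 join_0)
    ultimately show ?thesis by (simp add: map_germs_def theta_def)
  qed
  moreover have "germ_eq (\<Psi>' \<circ> \<Psi>) id"
    unfolding germ_eq_def using d1 i1
  proof eventually_elim
    case (elim z)
    have "cramer_solution (A (\<psi> (base_part z))) (A (\<psi> (base_part z)) *v fibre_part z) = fibre_part z"
      using cramer_solution[OF elim(1), of "fibre_part z"] by metis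
    then show ?case using elim(2) by (simp add: \<Psi>_def \<Psi>'_def join_parts)
  qed
  moreover have "germ_eq (\<Psi> \<circ> \<Psi>') id"
    unfolding germ_eq_def using d2 i2
  proof eventually_elim
    case (elim z)
    have "A (base_part z) *v cramer_solution (A (base_part z)) (fibre_part z) = fibre_part z"
      using cramer_solution[OF elim(1), of _ "fibre_part z"] by blast
    then show ?case using elim(2) by (simp add: \<Psi>_def \<Psi>'_def join_parts)
  qed
  ultimately have "diffeo_germ \<Psi>" by (auto simp: diffeo_germ_def)
  moreover have "maps_germ \<Psi> zero_section zero_section"
    unfolding maps_germ_def mem_zero_section using d1
  proof eventually_elim
    case (elim z)
    then show ?case
      using cramer_solution[OF elim, of "fibre_part z" 0] cramer_solution[OF elim, of 0 0] by (simp add: \<Psi>_def)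
  qed
  moreover have "maps_germ \<Psi> (graph_of g) (graph_of (\<lambda>x. A x *v g (\<phi> x)))"
    unfolding maps_germ_def mem_graph_of using d1 i1
  proof eventually_elim
    case (elim z)
    let ?b = "A (\<psi> (base_part z)) *v g (base_part z)"
    show ?case
      using cramer_solution[OF elim(1), of "fibre_part z" ?b] cramer_solution[OF elim(1), of "g (base_part z)" ?b] elim(2)
      by (simp add: \<Psi>_def)
  qed
  moreover have base: "base_map \<Psi> = \<psi>"
    by (auto simp: base_map_def \<Psi>_def fun_eq_iff vec_eq_iff)
  moreover have "maps_germ \<psi> V V"
  proof -
    have "\<forall>\<^sub>F x in nhds 0. \<psi> x \<in> V \<longleftrightarrow> \<phi> (\<psi> x) \<in> V"
      using eventually_map_germ[OF \<psi>s \<psi>0 V[unfolded maps_germ_def]] .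
    moreover have "\<forall>\<^sub>F x in nhds 0. \<phi> (\<psi> x) = x" using \<psi>(3) by (simp add: germ_eq_def)
    ultimately show ?thesis unfolding maps_germ_def by eventually_elim simp
  qed
  moreover have "jet 1 \<psi> = id" using \<phi>m \<psi>(1,3) jet by (rule jet_1_inverse)
  ultimately show ?thesis unfolding VK1_equiv_def contact_equiv_by_def by auto
qed

section \<open>The tangent space and the transversal\<close>

lemma germ_eq_sum:
  fixes f g :: "'i \<Rightarrow> 'a::{zero,topological_space} \<Rightarrow> 'b::comm_monoid_add"
  assumes "finite I" "\<And>i. i \<in> I \<Longrightarrow> germ_eq (f i) (g i)"
  shows "germ_eq (\<lambda>x. \<Sum>i\<in>I. f i x) (\<lambda>x. \<Sum>i\<in>I. g i x)"
proof -
  have "\<forall>\<^sub>F x in nhds 0. \<forall>i\<in>I. f i x = g i x"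
    using assms by (auto simp: germ_eq_def intro: eventually_ball_finite)
  then show ?thesis unfolding germ_eq_def by eventually_elim simp
qed

text \<open>
  Sums of monomials are indexed by lists of directions, not by an initial segment of the natural
  numbers as in the definition of \<open>germ_span\<close>.
\<close>

lemma germ_span_finite_sum:
  assumes "finite I" "\<And>i. i \<in> I \<Longrightarrow> a i \<in> A" "\<And>i. i \<in> I \<Longrightarrow> v i \<in> M"
    and "germ_eq w (\<lambda>x. \<Sum>i\<in>I. act (a i x) (v i x))"
  shows "w \<in> germ_span act A M"
proof -
  obtain e where e: "bij_betw e {0..<card I} I" using ex_bij_betw_nat_finite[OF assms(1)] by blast
  then have e': "bij_betw e {..<card I} I" by (simp add: atLeast0LessThan)
  have "(\<Sum>i\<in>I. act (a i x) (v i x)) = (\<Sum>i<card I. act (a (e i) x) (v (e i) x))" for x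
    by (rule sum.reindex_bij_betw[OF e', symmetric])
  moreover have "e i \<in> I" if "i < card I" for i using e' that by (auto simp: bij_betw_def)
  ultimately show ?thesis
    using assms(2-4) unfolding germ_span_def mem_Collect_eq
    by (intro exI[of _ "card I"] exI[of _ "\<lambda>i. a (e i)"] exI[of _ "\<lambda>i. v (e i)"]) auto
qed

lemma monomial_max_ideal_power:
  fixes "is" :: "'p::finite list"
  shows "(\<lambda>x::'k::real_normed_field ^ 'p. prod_list (map (\<lambda>i. x $ i) is)) \<in> max_ideal_power (length is)"
proof (induction "is")
  case (Cons i "is")
  have "(\<lambda>x::'k ^ 'p. x $ i) \<in> max_ideal" by (simp add: max_ideal_def smooth_germs_coord)
  then have "(\<lambda>x::'k ^ 'p. x $ i * prod_list (map (\<lambda>i. x $ i) is)) \<in> germ_span (*) max_ideal (max_ideal_power (length is))"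
    using Cons
    by (intro germ_span_finite_sum[where I = "{()}" and a = "\<lambda>_ x. x $ i"
          and v = "\<lambda>_ x. prod_list (map (\<lambda>i. x $ i) is)"]) (simp_all add: germ_eq_refl)
  then show ?case by simp
qed (simp add: smooth_germs_const)

text \<open>
  A monomial is a product of coordinates, each of which vanishes to order 1.
\<close>

lemma vanishes_homogeneous:
  fixes P :: "'k::real_normed_field ^ 'p::finite \<Rightarrow> 'k ^ 'q::finite"
  assumes "homogeneous_map d P"
  shows "(\<lambda>x. P x $ j) \<in> vanishes d"
proof -
  have coord: "(\<lambda>x::'k ^ 'p. x $ i) \<in> vanishes 1" for i
    by (simp add: vanishes_1 max_ideal_def smooth_germs_coord)
  have pow: "(\<lambda>x::'k ^ 'p. x $ i ^ n) \<in> vanishes n" for i n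
  proof (induction n)
    case (Suc n)
    then show ?case using vanishes_mult[OF coord, of "\<lambda>x. x $ i ^ n" n i] by simp
  qed (simp add: vanishes_0 smooth_germs_const)
  have mon: "(\<lambda>x::'k^'p. \<Prod>i\<in>I. x $ i ^ a i) \<in> vanishes (sum a I)" for a :: "'p \<Rightarrow> nat" and I
  proof (induction I rule: infinite_finite_induct)
    case (insert i I)
    then show ?case using vanishes_mult[OF pow[of i "a i"] insert.IH] by simp
  qed (simp_all add: vanishes_0 smooth_germs_const)
  obtain c where c: "\<And>x. P x $ j = (\<Sum>a | sum a UNIV = d. c a * (\<Prod>i\<in>UNIV. x $ i ^ a i))"
    using assms unfolding homogeneous_map_def by blast
  have "(\<lambda>x::'k^'p. \<Prod>i\<in>UNIV. x $ i ^ a i) \<in> vanishes d" if "a \<in> {a. sum a UNIV = d}" for a :: "'p \<Rightarrow> nat"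
    using that mon[of a UNIV] by simp
  then show ?thesis unfolding c by (intro vanishes_sum vanishes_cmult)
qed

text \<open>
  The components are explicit combinations of monomials.  The sign is the one with which the part of
  degree \<open>k + 1\<close> of \<open>g\<close> is decomposed in the transversal argument.
\<close>

lemma taylor_part_max_ideal_power:
  fixes g :: "'k::real_normed_field ^ 'p::finite \<Rightarrow> 'k ^ 'q::finite"
  shows "(\<lambda>x. \<chi> j. - taylor_part m (\<lambda>y. g y $ j) x) \<in> germ_span (*s) (max_ideal_power m) theta"
proof (rule germ_span_finite_sum)
  let ?v = "\<lambda>is (x :: 'k ^ 'p). (\<chi> j. - partials is (\<lambda>y. g y $ j) 0 / fact m) :: 'k ^ 'q"
  show "finite {is :: 'p list. length is = m}" by (rule finite_lists_length)
  show "(\<lambda>x. prod_list (map (\<lambda>i. x $ i) is)) \<in> max_ideal_power m" if "is \<in> {is. length is = m}" for "is"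
    using monomial_max_ideal_power[of "is"] that by simp
  show "?v is \<in> theta" for "is" by (simp add: theta_def smooth_germs_const)
  show "germ_eq (\<lambda>x. \<chi> j. - taylor_part m (\<lambda>y. g y $ j) x)
     (\<lambda>x. \<Sum>is\<in>{is. length is = m}. prod_list (map (\<lambda>i. x $ i) is) *s ?v is x)"
    by (simp add: germ_eq_def vec_eq_iff taylor_part_def sum_divide_distrib sum_negf mult.commute)
qed

lemma vanishes_germ_span:
  assumes "r \<in> germ_span (*s) (max_ideal_power n) theta"
  shows "(\<lambda>x. r x $ j) \<in> vanishes n"
proof -
  obtain N :: nat and a v where av: "\<And>i. i < N \<Longrightarrow> a i \<in> max_ideal_power n \<and> v i \<in> theta"
    and r: "germ_eq r (\<lambda>x. \<Sum>i<N. a i x *s v i x)"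
    using assms by (auto simp: germ_span_def)
  have eq: "germ_eq (\<lambda>x. r x $ j) (\<lambda>x. \<Sum>i<N. a i x * v i x $ j)"
    using r unfolding germ_eq_def by (auto elim: eventually_mono)
  have "(\<lambda>x. \<Sum>i<N. a i x * v i x $ j) \<in> vanishes n"
    using av by (intro vanishes_sum vanishes_mult_right vanishes_max_ideal_power) (auto simp: theta_def)
  then show ?thesis using vanishes_cong[OF eq] by blast
qed

lemma pullback_ideal_coefficients:
  fixes h :: "'k::real_normed_field ^ 'p::finite \<Rightarrow> 'k ^ 'q::finite"
  assumes "b \<in> pullback_ideal h"
  obtains c where "\<And>l. c l \<in> smooth_germs" "germ_eq b (\<lambda>x. \<Sum>l\<in>UNIV. c l x * h x $ l)"
proof -
  obtain N :: nat and a v where av: "\<And>i. i < N \<Longrightarrow> a i \<in> smooth_germs \<and> v i \<in> range (\<lambda>j x. h x $ j)"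
    and b: "germ_eq b (\<lambda>x. \<Sum>i<N. a i x * v i x)"
    using assms by (auto simp: pullback_ideal_def germ_span_def)
  have "\<exists>j. v i = (\<lambda>x. h x $ j)" if "i < N" for i using av[OF that] by auto
  then obtain \<sigma> where \<sigma>: "\<And>i. i < N \<Longrightarrow> v i = (\<lambda>x. h x $ \<sigma> i)" by metis
  define c where "c l x = (\<Sum>i<N. if \<sigma> i = l then a i x else 0)" for l x
  show ?thesis
  proof (rule that)
    show "c l \<in> smooth_germs" for l
      unfolding c_def[abs_def]
    proof (rule smooth_germs_sum)
      show "(\<lambda>x. if \<sigma> i = l then a i x else 0) \<in> smooth_germs" if "i \<in> {..<N}" for i
        using av that by (cases "\<sigma> i = l") (simp_all add: smooth_germs_const)
    qed
    have "(\<Sum>l\<in>UNIV. c l x * h x $ l) = (\<Sum>i<N. a i x * v i x)" for x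
    proof -
      have "(\<Sum>l\<in>UNIV. c l x * h x $ l) = (\<Sum>i<N. \<Sum>l\<in>UNIV. (if \<sigma> i = l then a i x else 0) * h x $ l)"
        unfolding c_def sum_distrib_right by (rule sum.swap)
      also have "\<dots> = (\<Sum>i<N. a i x * v i x)"
        by (intro sum.cong refl) (simp add: \<sigma> if_distrib[where f = "\<lambda>u. u * _"] cong: if_cong)
      finally show ?thesis .
    qed
    then show "germ_eq b (\<lambda>x. \<Sum>l\<in>UNIV. c l x * h x $ l)" using b by simp
  qed
qed

lemma max_ideal_pullback_coefficients:
  fixes h :: "'k::real_normed_field ^ 'p::finite \<Rightarrow> 'k ^ 'q::finite"
  assumes "b \<in> germ_span (*) max_ideal (pullback_ideal h)"
  obtains c where "\<And>l. c l \<in> vanishes 1" "germ_eq b (\<lambda>x. \<Sum>l\<in>UNIV. c l x * h x $ l)"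
proof -
  obtain N :: nat and a v where av: "\<And>i. i < N \<Longrightarrow> a i \<in> max_ideal \<and> v i \<in> pullback_ideal h"
    and b: "germ_eq b (\<lambda>x. \<Sum>i<N. a i x * v i x)"
    using assms by (auto simp: germ_span_def)
  have "\<exists>c. i < N \<longrightarrow> (\<forall>l. c l \<in> smooth_germs) \<and> germ_eq (v i) (\<lambda>x. \<Sum>l\<in>UNIV. c l x * h x $ l)" for i
  proof (cases "i < N")
    case True
    show ?thesis by (rule pullback_ideal_coefficients[of "v i" h]) (use av True in auto)
  qed simp
  then have "\<forall>i. \<exists>c. i < N \<longrightarrow> (\<forall>l. c l \<in> smooth_germs) \<and> germ_eq (v i) (\<lambda>x. \<Sum>l\<in>UNIV. c l x * h x $ l)" by blast
  from choice[OF this] obtain d where d: "\<And>i l. i < N \<Longrightarrow> d i l \<in> smooth_germs"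
    "\<And>i. i < N \<Longrightarrow> germ_eq (v i) (\<lambda>x. \<Sum>l\<in>UNIV. d i l x * h x $ l)"
    by blast
  define c where "c l x = (\<Sum>i<N. a i x * d i l x)" for l x
  show ?thesis
  proof (rule that)
    show "c l \<in> vanishes 1" for l
      unfolding c_def[abs_def] using av d(1) by (intro vanishes_sum vanishes_mult_right) (auto simp: vanishes_1)
    have "germ_eq (\<lambda>x. \<Sum>i<N. a i x * v i x) (\<lambda>x. \<Sum>i<N. a i x * (\<Sum>l\<in>UNIV. d i l x * h x $ l))"
    proof (rule germ_eq_sum)
      fix i assume "i \<in> {..<N}"
      then show "germ_eq (\<lambda>x. a i x * v i x) (\<lambda>x. a i x * (\<Sum>l\<in>UNIV. d i l x * h x $ l))"
        using d(2)[of i] by (auto simp: germ_eq_def elim: eventually_mono)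
    qed simp
    also have "(\<lambda>x. \<Sum>i<N. a i x * (\<Sum>l\<in>UNIV. d i l x * h x $ l)) = (\<lambda>x. \<Sum>l\<in>UNIV. c l x * h x $ l)"
    proof
      fix x
      have "(\<Sum>i<N. a i x * (\<Sum>l\<in>UNIV. d i l x * h x $ l)) = (\<Sum>i<N. \<Sum>l\<in>UNIV. a i x * d i l x * h x $ l)"
        by (simp add: sum_distrib_left mult.assoc)
      also have "\<dots> = (\<Sum>l\<in>UNIV. c l x * h x $ l)"
        unfolding c_def sum_distrib_right by (rule sum.swap)
      finally show "(\<Sum>i<N. a i x * (\<Sum>l\<in>UNIV. d i l x * h x $ l)) = (\<Sum>l\<in>UNIV. c l x * h x $ l)" .
    qed
    finally show "germ_eq b (\<lambda>x. \<Sum>l\<in>UNIV. c l x * h x $ l)" using b by (rule germ_eq_trans[rotated])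
  qed
qed

text \<open>
  The ideal \<open>h\<^sup>*(m\<^sub>q)\<close> is generated by the components of \<open>h\<close>; collecting their coefficients in each
  component of \<open>w\<close> gives the rows of \<open>M\<close>.
\<close>

lemma tangent_matrix:
  fixes h :: "'k::real_normed_field ^ 'p::finite \<Rightarrow> 'k ^ 'q::finite"
  assumes "w \<in> germ_span (*s) (germ_span (*) max_ideal (pullback_ideal h)) theta"
  obtains M where "\<And>j l. (\<lambda>x. M x $ j $ l) \<in> vanishes 1" "germ_eq w (\<lambda>x. M x *v h x)"
proof -
  obtain N :: nat and a v where av: "\<And>i. i < N \<Longrightarrow> a i \<in> germ_span (*) max_ideal (pullback_ideal h) \<and> v i \<in> theta"
    and w: "germ_eq w (\<lambda>x. \<Sum>i<N. a i x *s v i x)"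
    using assms by (auto simp: germ_span_def)
  have "\<exists>c. i < N \<longrightarrow> (\<forall>l. c l \<in> vanishes 1) \<and> germ_eq (a i) (\<lambda>x. \<Sum>l\<in>UNIV. c l x * h x $ l)" for i
  proof (cases "i < N")
    case True
    show ?thesis by (rule max_ideal_pullback_coefficients[of "a i" h]) (use av True in auto)
  qed simp
  then have "\<forall>i. \<exists>c. i < N \<longrightarrow> (\<forall>l. c l \<in> vanishes 1) \<and> germ_eq (a i) (\<lambda>x. \<Sum>l\<in>UNIV. c l x * h x $ l)" by blast
  from choice[OF this] obtain d where d: "\<And>i l. i < N \<Longrightarrow> d i l \<in> vanishes 1"
    "\<And>i. i < N \<Longrightarrow> germ_eq (a i) (\<lambda>x. \<Sum>l\<in>UNIV. d i l x * h x $ l)"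
    by blast
  define M where "M x = (\<chi> j l. \<Sum>i<N. d i l x * v i x $ j)" for x
  show ?thesis
  proof (rule that)
    show "(\<lambda>x. M x $ j $ l) \<in> vanishes 1" for j l
      unfolding M_def using av d(1) by (simp, intro vanishes_sum vanishes_mult_right) (auto simp: theta_def)
    have "germ_eq (\<lambda>x. \<Sum>i<N. a i x *s v i x) (\<lambda>x. \<Sum>i<N. (\<Sum>l\<in>UNIV. d i l x * h x $ l) *s v i x)"
    proof (rule germ_eq_sum)
      fix i assume "i \<in> {..<N}"
      then show "germ_eq (\<lambda>x. a i x *s v i x) (\<lambda>x. (\<Sum>l\<in>UNIV. d i l x * h x $ l) *s v i x)"
        using d(2)[of i] by (auto simp: germ_eq_def elim: eventually_mono)
    qed simp
    also have "(\<lambda>x. \<Sum>i<N. (\<Sum>l\<in>UNIV. d i l x * h x $ l) *s v i x) = (\<lambda>x. M x *v h x)"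
    proof
      fix x
      have "(\<Sum>i<N. (\<Sum>l\<in>UNIV. d i l x * h x $ l) * v i x $ j) = (\<Sum>l\<in>UNIV. (\<Sum>i<N. d i l x * v i x $ j) * h x $ l)" for j
      proof -
        have "(\<Sum>i<N. (\<Sum>l\<in>UNIV. d i l x * h x $ l) * v i x $ j) = (\<Sum>i<N. \<Sum>l\<in>UNIV. d i l x * v i x $ j * h x $ l)"
          unfolding sum_distrib_right by (intro sum.cong refl) (simp add: mult_ac)
        also have "\<dots> = (\<Sum>l\<in>UNIV. (\<Sum>i<N. d i l x * v i x $ j) * h x $ l)"
          unfolding sum_distrib_right by (rule sum.swap)
        finally show ?thesis .
      qed
      then show "(\<Sum>i<N. (\<Sum>l\<in>UNIV. d i l x * h x $ l) *s v i x) = M x *v h x"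
        by (simp add: vec_eq_iff matrix_vector_mult_def M_def)
    qed
    finally show "germ_eq w (\<lambda>x. M x *v h x)" using w by (rule germ_eq_trans[rotated])
  qed
qed

lemma tangent_VK1_twisted:
  fixes h :: "'k::real_normed_field ^ 'p::finite \<Rightarrow> 'k ^ 'q::finite"
  assumes "u \<in> tangent_VK1 V h"
  obtains \<xi> M where "\<xi> \<in> Theta1 V" "\<And>j l. (\<lambda>x. M x $ j $ l) \<in> vanishes 1"
    "germ_eq u (twisted_derivation \<xi> M h)"
proof -
  obtain \<xi> w where \<xi>: "\<xi> \<in> Theta1 V" and w: "w \<in> germ_span (*s) (germ_span (*) max_ideal (pullback_ideal h)) theta"
    and u: "germ_eq u (\<lambda>x. lie_deriv \<xi> h x + w x)"
    using assms unfolding tangent_VK1_def germ_plus_def by blast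
  obtain M where M: "\<And>j l. (\<lambda>x. M x $ j $ l) \<in> vanishes 1" "germ_eq w (\<lambda>x. M x *v h x)"
    using w by (rule tangent_matrix) blast
  have "germ_eq u (twisted_derivation \<xi> M h)"
    unfolding twisted_derivation_def[abs_def]
    by (rule germ_eq_trans[OF u germ_eq_add[OF germ_eq_refl M(2)]])
  then show ?thesis using that \<xi> M(1) by blast
qed

text \<open>
  The twisted derivation is additive, so the difference is its value at \<open>g - h\<close>.
\<close>

lemma twisted_derivation_diff_vanishes:
  fixes \<xi> :: "'k::real_normed_field ^ 'p::finite \<Rightarrow> 'k ^ 'p" and g h :: "'k ^ 'p \<Rightarrow> 'k ^ 'q::finite"
  assumes \<xi>: "\<And>i. (\<lambda>x. \<xi> x $ i) \<in> vanishes 2" and M: "\<And>j l. (\<lambda>x. M x $ j $ l) \<in> vanishes 1"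
    and g: "\<And>j. (\<lambda>x. g x $ j) \<in> smooth_germs" and h: "\<And>j. (\<lambda>x. h x $ j) \<in> smooth_germs"
    and gh: "\<And>j. (\<lambda>x. g x $ j - h x $ j) \<in> vanishes n"
  shows "(\<lambda>x. twisted_derivation \<xi> M g x $ j - twisted_derivation \<xi> M h x $ j) \<in> vanishes (Suc n)"
proof -
  obtain S where S: "open S" "0 \<in> S" "smooth_on S (\<lambda>x. g x $ j)" "smooth_on S (\<lambda>x. h x $ j)"
    using g h by (rule smooth_germs_common2)
  have "germ_eq (\<lambda>x. twisted_derivation \<xi> M g x $ j - twisted_derivation \<xi> M h x $ j)
      (\<lambda>x. twisted_derivation \<xi> M (\<lambda>y. g y - h y) x $ j)"
  proof (rule germ_eqI[OF S(1,2)])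
    fix x assume "x \<in> S"
    then have "partial i (\<lambda>y. g y $ j - h y $ j) x = partial i (\<lambda>y. g y $ j) x - partial i (\<lambda>y. h y $ j) x" for i
      using S by (intro partial_diff)
    then show "twisted_derivation \<xi> M g x $ j - twisted_derivation \<xi> M h x $ j = twisted_derivation \<xi> M (\<lambda>y. g y - h y) x $ j"
      by (simp add: twisted_derivation_nth directional_def sum_subtractf left_diff_distrib right_diff_distrib)
  qed
  moreover have "(\<lambda>x. twisted_derivation \<xi> M (\<lambda>y. g y - h y) x $ j) \<in> vanishes (Suc n)"
    using \<xi> M by (rule twisted_derivation_vanishes) (simp add: gh)
  ultimately show ?thesis using vanishes_cong by blast
qed

text \<open>
  Each further application of \<open>L\<close> to \<open>L(g)\<close> raises the order, so the terms from \<open>L\<^sup>2(g)\<close> on are of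
  order \<open>k + 2\<close>.
\<close>

lemma exp_twisted_derivation_first_order:
  fixes \<xi> :: "'k::real_normed_field ^ 'p::finite \<Rightarrow> 'k ^ 'p" and g :: "'k ^ 'p \<Rightarrow> 'k ^ 'q::finite"
  assumes \<xi>: "\<And>i. (\<lambda>x. \<xi> x $ i) \<in> vanishes 2" and M: "\<And>j l. (\<lambda>x. M x $ j $ l) \<in> vanishes 1"
    and Lg: "\<And>j. (\<lambda>x. twisted_derivation \<xi> M g x $ j) \<in> vanishes (Suc k)"
  shows "(\<lambda>x. (\<Sum>n\<le>Suc k. (twisted_derivation \<xi> M ^^ n) g x $ j / fact n)
             - (g x $ j + twisted_derivation \<xi> M g x $ j)) \<in> vanishes (Suc (Suc k))"
proof -
  let ?t = "\<lambda>n x. (twisted_derivation \<xi> M ^^ n) g x $ j / fact n"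
  have eq: "(\<Sum>n\<le>Suc k. ?t n x) - (g x $ j + twisted_derivation \<xi> M g x $ j) = (\<Sum>n\<in>{..Suc k} - {0, 1}. ?t n x)" for x
    by (subst sum_diff) auto
  have "?t n \<in> vanishes (Suc (Suc k))" if n: "n \<in> {..Suc k} - {0, 1}" for n
  proof -
    obtain m where m: "n = Suc (Suc m)" using n by (cases n; cases "n - 1") auto
    have "(twisted_derivation \<xi> M ^^ n) g = (twisted_derivation \<xi> M ^^ Suc m) (twisted_derivation \<xi> M g)"
      unfolding m by (simp add: funpow_swap1)
    then have "(\<lambda>x. (twisted_derivation \<xi> M ^^ n) g x $ j) \<in> vanishes (Suc m + Suc k)"
      using twisted_derivation_iterate_vanishes[OF \<xi> M Lg, of "Suc m" j] by simp
    then have "(\<lambda>x. inverse (fact n) * (twisted_derivation \<xi> M ^^ n) g x $ j) \<in> vanishes (Suc (Suc k))"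
      by (intro vanishes_cmult) (rule vanishes_mono, auto)
    then show ?thesis by (simp add: divide_inverse mult.commute)
  qed
  then show ?thesis unfolding eq by (rule vanishes_sum)
qed

text \<open>
  The decomposition is applied to \<open>-H\<close>, where \<open>H\<close> is the part of degree \<open>k + 1\<close> of \<open>g\<close>, so that adding
  \<open>L(g)\<close> to \<open>g\<close> replaces this part by an element of the span of the \<open>G i\<close>.  That element enters with
  the opposite sign, whence the coefficients \<open>- \<beta> i\<close>.
\<close>

theorem complete_transversal:
  fixes h g :: "'k::real_normed_field ^ 'p::finite \<Rightarrow> 'k ^ 'q::finite"
  assumes h: "h \<in> map_germs" and G: "\<And>i. i \<in> {1..s} \<Longrightarrow> homogeneous_map (k + 1) (G i)"
    and sub: "germ_span (*s) (max_ideal_power (k + 1)) theta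
        \<subseteq> germ_plus (germ_plus (tangent_VK1 V h) (lin_span s G)) (germ_span (*s) (max_ideal_power (k + 2)) theta)"
    and g: "g \<in> map_germs" and jets: "jet k h = jet k g"
  shows "\<exists>f\<in>map_germs. VK1_equiv V g f \<and>
           (\<exists>\<alpha>. jet (k + 1) f = (\<lambda>x. jet k h x + (\<Sum>i=1..s. \<alpha> i *s G i x)))"
proof -
  have gs: "(\<lambda>x. g x $ j) \<in> smooth_germs" and hs: "(\<lambda>x. h x $ j) \<in> smooth_germs" and g0: "g 0 = 0" for j
    using g h by (auto simp: map_germs_def theta_def)
  define H where "H x = (\<chi> j. taylor_part (Suc k) (\<lambda>y. g y $ j) x)" for x
  have "(\<lambda>x. - H x) = (\<lambda>x. \<chi> j. - taylor_part (Suc k) (\<lambda>y. g y $ j) x)"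
    by (simp add: H_def vec_eq_iff fun_eq_iff)
  then have "(\<lambda>x. - H x) \<in> germ_span (*s) (max_ideal_power (k + 1)) theta"
    using taylor_part_max_ideal_power[of "Suc k" g] by (simp del: max_ideal_power.simps)
  with sub obtain u b r where u: "u \<in> tangent_VK1 V h" and b: "b \<in> lin_span s G"
    and r: "r \<in> germ_span (*s) (max_ideal_power (k + 2)) theta"
    and ubr: "germ_eq (\<lambda>x. - H x) (\<lambda>x. u x + b x + r x)"
  proof -
    assume *: "\<And>u b r. u \<in> tangent_VK1 V h \<Longrightarrow> b \<in> lin_span s G \<Longrightarrow>
      r \<in> germ_span (*s) (max_ideal_power (k + 2)) theta \<Longrightarrow> germ_eq (\<lambda>x. - H x) (\<lambda>x. u x + b x + r x) \<Longrightarrow> thesis"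
    assume "(\<lambda>x. - H x) \<in> germ_span (*s) (max_ideal_power (k + 1)) theta"
    with sub have "(\<lambda>x. - H x) \<in> germ_plus (germ_plus (tangent_VK1 V h) (lin_span s G)) (germ_span (*s) (max_ideal_power (k + 2)) theta)"
      by blast
    then obtain a u b r where "u \<in> tangent_VK1 V h" "b \<in> lin_span s G"
      "r \<in> germ_span (*s) (max_ideal_power (k + 2)) theta"
      "germ_eq (\<lambda>x. - H x) (\<lambda>x. a x + r x)" "germ_eq a (\<lambda>x. u x + b x)"
      unfolding germ_plus_def by blast
    then show thesis using * germ_eq_trans germ_eq_add[OF _ germ_eq_refl] by blast
  qed
  obtain \<beta> where \<beta>: "b = (\<lambda>x. \<Sum>i=1..s. \<beta> i *s G i x)" using b by (auto simp: lin_span_def)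
  obtain \<xi> M where \<xi>: "\<xi> \<in> Theta1 V" and M: "\<And>j l. (\<lambda>x. M x $ j $ l) \<in> vanishes 1"
    and uL: "germ_eq u (twisted_derivation \<xi> M h)"
    using u by (rule tangent_VK1_twisted) blast
  obtain \<Phi> where \<xi>t: "\<xi> \<in> theta" and flow: "flow_of \<xi> \<Phi>" and diffeo: "\<And>t. diffeo_germ (\<Phi> t)"
    and V: "\<And>t. maps_germ (\<Phi> t) V V" and jet1: "\<And>t. jet 1 (\<Phi> t) = id"
    using \<xi> by (auto simp: Theta1_def)
  have \<Phi>: "\<Phi> t \<in> map_germs" for t using diffeo by (simp add: diffeo_germ_def)
  have \<Phi>s: "(\<lambda>x. \<Phi> 1 x $ j) \<in> smooth_germs" and \<Phi>0: "\<Phi> 1 0 = 0" for j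
    using \<Phi>[of 1] by (auto simp: map_germs_def theta_def)
  have \<xi>2: "(\<lambda>x. \<xi> x $ j) \<in> vanishes 2" for j using \<xi>t flow jet1 by (rule flow_field_vanishes)
  let ?L = "twisted_derivation \<xi> M" and ?K = "Suc (Suc k)"
  \<comment> \<open>From here on \<open>L\<close> is the twisted derivation; \<open>main\<close> is the decomposition of \<open>-H\<close>, solved for \<open>L(h)\<close>.\<close>
  have main: "germ_eq (\<lambda>x. ?L h x $ j) (\<lambda>x. - H x $ j - b x $ j - r x $ j)" for j
    using ubr uL unfolding germ_eq_def by eventually_elim (simp add: vec_eq_iff algebra_simps)
  have rv: "(\<lambda>x. r x $ j) \<in> vanishes ?K" for j using vanishes_germ_span[OF r] by simp
  have bv: "(\<lambda>x. b x $ j) \<in> vanishes (Suc k)" for j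
    unfolding \<beta> using vanishes_homogeneous[OF G, of _ j] by (simp, intro vanishes_sum vanishes_cmult) simp
  have jet_diff: "(\<lambda>x. g x $ j - taylor m (\<lambda>y. g y $ j) x) \<in> vanishes (Suc m)" for m j
    using gs by (rule taylor_remainder)
  have taylor_Suc: "taylor (Suc k) (\<lambda>y. g y $ j) x = taylor k (\<lambda>y. g y $ j) x + H x $ j" for j x
    by (simp add: taylor_def H_def)
  have Hv: "(\<lambda>x. H x $ j) \<in> vanishes (Suc k)" for j
    using vanishes_diff[OF jet_diff[of j k] vanishes_mono[OF jet_diff[of j "Suc k"], of "Suc k"]]
    by (simp add: taylor_Suc)
  have gh: "(\<lambda>x. g x $ j - h x $ j) \<in> vanishes (Suc k)" for j
  proof -
    have "taylor k (\<lambda>y. h y $ j) x = taylor k (\<lambda>y. g y $ j) x" for x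
      using jets by (simp flip: jet_eq_taylor)
    then show ?thesis
      using vanishes_diff[OF jet_diff[of j k] taylor_remainder[OF hs, of j k]] by simp
  qed
  have Lgh: "(\<lambda>x. ?L g x $ j - ?L h x $ j) \<in> vanishes ?K" for j
    using \<xi>2 M gs hs gh by (rule twisted_derivation_diff_vanishes)
  have Lh: "(\<lambda>x. ?L h x $ j) \<in> vanishes (Suc k)" for j
    using vanishes_cong[OF main[of j]] vanishes_diff[OF vanishes_diff[OF vanishes_cmult[OF Hv[of j], of "- 1"] bv[of j]] vanishes_mono[OF rv[of j], of "Suc k"]]
    by simp
  have Lg: "(\<lambda>x. ?L g x $ j) \<in> vanishes (Suc k)" for j
    using vanishes_add[OF vanishes_mono[OF Lgh[of j], of "Suc k"] Lh[of j]] by simp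
  \<comment> \<open>The columns are the truncated exponentials \<open>exp L e\<^sub>l\<close>, and the constant term is the identity matrix.\<close>
  define A where "A x = (\<chi> j l. \<Sum>i\<le>Suc k. (?L ^^ i) (\<lambda>y. axis l 1) x $ j / fact i)" for x
  have Lv: "(\<lambda>x. (?L ^^ i) (\<lambda>y. axis l 1) x $ j / fact i) \<in> vanishes i" for i j l
    using vanishes_cmult[OF twisted_derivation_iterate_vanishes[OF \<xi>2 M, of "\<lambda>y. axis l 1" 0 i j], of "inverse (fact i)"]
    by (simp add: vanishes_0 smooth_germs_const divide_inverse mult.commute)
  have As: "(\<lambda>x. A x $ j $ l) \<in> smooth_germs" for j l
    unfolding A_def using vanishes_smooth[OF Lv] by (simp only: vec_lambda_beta) (rule smooth_germs_sum)
  have "A 0 = mat 1"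
  proof -
    have "(?L ^^ Suc i) (\<lambda>y. axis l 1) 0 $ j / fact (Suc i) = 0" for i j l
      using Lv[of "Suc i" l j] unfolding vanishes_Suc by blast
    then have "A 0 $ j $ l = axis l 1 $ j" for j l
      unfolding A_def by (simp only: vec_lambda_beta sum.atMost_Suc_shift) simp
    then show ?thesis by (simp add: vec_eq_iff mat_def axis_def)
  qed
  then have det: "det (A 0) \<noteq> 0" by simp
  define f where "f x = A x *v g (\<Phi> 1 x)" for x
  have f: "f \<in> map_germs"
  proof -
    have "(\<lambda>x. f x $ j) \<in> smooth_germs" for j
      unfolding f_def matrix_vector_mult_def
      by (simp, intro smooth_germs_sum smooth_germs_mult As smooth_germs_comp[OF gs \<Phi>s \<Phi>0])
    moreover have "f 0 = 0" by (simp add: f_def \<Phi>0 g0)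
    ultimately show ?thesis by (simp add: map_germs_def theta_def)
  qed
  have "VK1_equiv V g f"
    unfolding f_def[abs_def] by (rule VK1_equiv_linear_fibre[OF diffeo V jet1 As det])
  moreover have "jet (k + 1) f = (\<lambda>x. jet k h x + (\<Sum>i=1..s. - \<beta> i *s G i x))"
  proof -
    have "taylor (Suc k) (\<lambda>y. f y $ j) = (\<lambda>x. taylor k (\<lambda>y. g y $ j) x + - 1 * b x $ j)" for j
    proof (rule taylor_unique)
      show "(\<lambda>x. f x $ j) \<in> smooth_germs" using f by (simp add: map_germs_def theta_def)
      have "(\<lambda>x. b x $ j) \<in> poly_deg_le (Suc k)"
        unfolding \<beta> using poly_deg_le_homogeneous[OF G, of _ j]
        by (simp, intro poly_deg_le_sum poly_deg_le_cmult) simp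
      then show "(\<lambda>x. taylor k (\<lambda>y. g y $ j) x + - 1 * b x $ j) \<in> poly_deg_le (Suc k)"
        by (intro poly_deg_le_add poly_deg_le_cmult) (rule poly_deg_le_mono[OF poly_deg_le_taylor], simp)
      define X where "X l x = (\<Sum>i\<le>Suc k. (directional \<xi> ^^ i) (\<lambda>y. g y $ l) x / fact i)" for l x
      define E where "E x = (\<Sum>n\<le>Suc k. (?L ^^ n) g x $ j / fact n)" for x
      \<comment> \<open>Four steps, each up to order \<open>k + 2\<close>: from \<open>g \<circ> \<Phi>\<^sub>1\<close> to \<open>exp \<xi> g\<close>, to \<open>exp L g\<close>, to \<open>g + L(g)\<close>, to the polynomial.\<close>
      have 1: "(\<lambda>x. \<Sum>l\<in>UNIV. (g (\<Phi> 1 x) $ l - X l x) * A x $ j $ l) \<in> vanishes ?K"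
        unfolding X_def
        by (intro vanishes_sum vanishes_mult_right As flow_taylor[OF \<xi>t flow jet1 \<Phi> gs])
      have 2: "(\<lambda>x. (\<Sum>l\<in>UNIV. X l x * A x $ j $ l) - E x) \<in> vanishes ?K"
        using exp_twisted_derivation[OF \<xi>2 M gs, of "Suc k" j] by (simp only: X_def A_def E_def vec_lambda_beta)
      have 3: "(\<lambda>x. E x - (g x $ j + ?L g x $ j)) \<in> vanishes ?K"
        unfolding E_def using \<xi>2 M Lg by (rule exp_twisted_derivation_first_order)
      have 4: "(\<lambda>x. (g x $ j - taylor (Suc k) (\<lambda>y. g y $ j) x) + (?L g x $ j - ?L h x $ j) - r x $ j) \<in> vanishes ?K"
        by (intro vanishes_add vanishes_diff jet_diff Lgh rv)
      note sum = vanishes_add[OF vanishes_add[OF vanishes_add[OF 1 2] 3] 4]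
      have eq: "germ_eq (\<lambda>x. f x $ j - (taylor k (\<lambda>y. g y $ j) x + - 1 * b x $ j))
        (\<lambda>x. (\<Sum>l\<in>UNIV. (g (\<Phi> 1 x) $ l - X l x) * A x $ j $ l) + ((\<Sum>l\<in>UNIV. X l x * A x $ j $ l) - E x)
          + (E x - (g x $ j + ?L g x $ j))
          + ((g x $ j - taylor (Suc k) (\<lambda>y. g y $ j) x) + (?L g x $ j - ?L h x $ j) - r x $ j))"
        using main[of j] unfolding germ_eq_def
      proof eventually_elim
        case (elim x)
        have "f x $ j = (\<Sum>l\<in>UNIV. (g (\<Phi> 1 x) $ l - X l x) * A x $ j $ l) + (\<Sum>l\<in>UNIV. X l x * A x $ j $ l)"
          unfolding f_def matrix_vector_mult_def sum.distrib[symmetric] by (simp add: algebra_simps)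
        then show ?case by (simp add: elim taylor_Suc algebra_simps)
      qed
      show "(\<lambda>x. f x $ j - (taylor k (\<lambda>y. g y $ j) x + - 1 * b x $ j)) \<in> vanishes (Suc (Suc k))"
        using vanishes_cong[OF eq] sum by blast
    qed
    then have "jet (k + 1) f x $ j = jet k h x $ j + (\<Sum>i=1..s. - \<beta> i *s G i x) $ j" for x j
      unfolding jets jet_eq_taylor \<beta> by (simp add: sum_negf)
    then show ?thesis by (simp add: vec_eq_iff fun_eq_iff)
  qed
  ultimately show ?thesis
    using f by (intro bexI[of _ f] conjI exI[of _ "\<lambda>i. - \<beta> i"])
qed

theorem theorem3p3:
  shows "(\<forall>(h :: real ^ 'p::finite \<Rightarrow> real ^ 'q::finite) (V :: (real ^ 'p) set) (k::nat) (s::nat)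
             (G :: nat \<Rightarrow> real ^ 'p \<Rightarrow> real ^ 'q).
            h \<in> map_germs \<longrightarrow>
            finitely_generated (Theta V) \<longrightarrow>
            (\<forall>i\<in>{1..s}. homogeneous_map (k + 1) (G i)) \<longrightarrow>
            germ_span (*s) (max_ideal_power (k + 1)) theta
              \<subseteq> germ_plus (germ_plus (tangent_VK1 V h) (lin_span s G))
                   (germ_span (*s) (max_ideal_power (k + 2)) theta) \<longrightarrow>
            (\<forall>g\<in>map_germs. jet k h = jet k g \<longrightarrow>
               (\<exists>f\<in>map_germs. VK1_equiv V g f \<and>
                  (\<exists>\<alpha>. jet (k + 1) f = (\<lambda>x. jet k h x + (\<Sum>i=1..s. \<alpha> i *s G i x))))))
       \<and>
         (\<forall>(h :: complex ^ 'p::finite \<Rightarrow> complex ^ 'q::finite) (V :: (complex ^ 'p) set) (k::nat) (s::nat)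
             (G :: nat \<Rightarrow> complex ^ 'p \<Rightarrow> complex ^ 'q).
            h \<in> map_germs \<longrightarrow>
            finitely_generated (Theta V) \<longrightarrow>
            (\<forall>i\<in>{1..s}. homogeneous_map (k + 1) (G i)) \<longrightarrow>
            germ_span (*s) (max_ideal_power (k + 1)) theta
              \<subseteq> germ_plus (germ_plus (tangent_VK1 V h) (lin_span s G))
                   (germ_span (*s) (max_ideal_power (k + 2)) theta) \<longrightarrow>
            (\<forall>g\<in>map_germs. jet k h = jet k g \<longrightarrow>
               (\<exists>f\<in>map_germs. VK1_equiv V g f \<and>
                  (\<exists>\<alpha>. jet (k + 1) f = (\<lambda>x. jet k h x + (\<Sum>i=1..s. \<alpha> i *s G i x))))))"
  by (intro conjI allI impI ballI; rule complete_transversal; (assumption | erule (1) bspec))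

end
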